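(* Let $(\Omega,\tilde{\mathfrak r},d,\int)$ be an $n$-dimensional $( *,\mathfrak r)$-cycle over a graded $C^{*,\mathfrak r}$-algebra $(A,\mathfrak r)$ with parity $\nu$ and sign $\mathfrak s$. A necessary condition for its character to pair non-trivially with $DK_e(A^{\mathfrak r}\hat\otimes Cl_{r,s})$ is that $$\mathfrak s=(-1)^{\mu(r-s)+n(r-s+1)}\quad\text{and}\quad \nu=n+1-r+s \pmod 2 .$$
   Context: $\mu(k)=\lfloor k/2\rfloor$ for $k\in\mathbb Z$. Graded algebras. A graded $C^*$-algebra is a (real or complex) $C^*$-algebra with a $*$-automorphism $\gamma$, $\gamma^2=\mathrm{id}$; $a$ is even ($|a|=0$) if $\gamma(a)=a$, odd ($|a|=1$) if $\gamma(a)=-a$; $\gamma$ acts entrywise on matrices. A graded $C^{*,\mathfrak r}$-algebra is a complex graded $C^*$-algebra $A$ with a real structure $\mathfrak r$, i.e. an anti-linear $*$-automorphism of order 2 commuting with $\gamma$; $A^{\mathfrak r}$ is the real subalgebra of fixed elements. An OSU is an odd $x$ with $x=x^*=x^{-1}$; $\mathfrak S(A)$ is the set of OSUs. The graded tensor product $\hat\otimes$ has $(1\hat\otimes b)(a\hat\otimes1)=(-1)^{|a||b|}a\hat\otimes b$, $(a\hat\otimes b)^*=(-1)^{|a||b|}a^*\hat\otimes b^*$ and product grading. $\mathbb C l_k$ is the complex Clifford algebra generated by $k$ pairwise anticommuting OSUs $\rho_1,\dots,\rho_k$; $\mathfrak l_{r,s}$ is the real structure on $\mathbb C l_{r+s}$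 fixing $r$ generators and changing the sign of the other $s$; $Cl_{r,s}$ is its real subalgebra. $A^{\mathfrak r}\hat\otimes Cl_{r,s}$ is the real subalgebra of $(A\hat\otimes\mathbb C l_{r+s},\mathfrak r\otimes\mathfrak l_{r,s})$. Here $A$ is unital. Van Daele $K$-group. For a unital graded $C^*$-algebra $D$ with an OSU $e\in D$ (basepoint) put $e_n=e\oplus\dots\oplus e$. $V_e(D)=\bigsqcup_n\mathfrak S(M_n(D))/\!\sim$, where $x\in M_m(D)$, $y\in M_l(D)$ are equivalent if for some $n$ the elements $x\oplus e_{n-m}$, $y\oplus e_{n-l}$ are homotopic in $\mathfrak S(M_n(D))$; it is a semigroup under $\oplus$ and $DK_e(D)$ is its Grothendieck group. Cycles. An $n$-dimensional cycle over $A$ with domain algebra $\mathcal A$ consists of a $\mathbb Z\times\mathbb Z_2$-graded algebra $\Omega$, a graded (injective, suppressed) $*$-homomorphism $\varphi:A\to\Omega_0$, a densely defined differential $d$ of degree $(1,0)$ (graded Leibniz rule for the $\mathbb Z$-degree, $d^2=0$), a densely defined linear functional $\int:\Omega_n\to\mathbb C$ and a dense $*$-subalgebra $\mathcal A\subset A$ such that: (C1) $\mathcal A$ lies in the domain of $d$; (C2) $\mathcal A(d\mathcal A)^n$ lies in the domain of $\int$, there $\int\omega\omega'=(-1)^{|\omega|_{\mathbb Z}|\omega'|_{\mathbb Z}+|\omega||\omega'|}\int\omega'\omega$, and $\int$ vanishes on $(d\mathcal A)^n$; (C3) the even part of $\mathcal A\hat\otimes\mathbb C l_k$ is closed under holomorphic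 functional calculus for all $k\ge0$; (C4) in any neighbourhood of an OSU of $M_m(A\hat\otimes\mathbb C l_k)$ there is an OSU of $M_m(\mathcal A\hat\otimes\mathbb C l_k)$; (C5) if $A$ contains an OSU, $\mathcal A$ contains an OSU $e$ with $de=0$. The cycle has parity $\nu\in\mathbb Z_2$ if $\int$ vanishes on elements of $\mathbb Z_2$-degree $\nu+1$. Its character is $\xi(a_0,\dots,a_n)=\int a_0\,da_1\cdots da_n$, $a_i\in\mathcal A$. It is a $( *,\mathfrak r)$-cycle of sign $\mathfrak s\in\{\pm1\}$ if $\mathcal A$ is $\mathfrak r$-invariant, $\Omega$ is a $*$-algebra with a real structure $\tilde{\mathfrak r}$ (anti-linear $*$-automorphism of order 2), $\varphi$ intertwines $*$ and the real structures, $d(a^* )=(da)^*$ and $d(\mathfrak r(a))=\tilde{\mathfrak r}(da)$ for $a\in\mathcal A$, and $\int\tilde{\mathfrak r}(\omega)^*=\mathfrak s\int\omega$. Pairing. Let $\kappa=\sqrt2e^{i\pi/4}$ and let $\kappa_k:\mathbb C l_k\to\mathbb C$ be linear with $\kappa_k(\rho_1\cdots\rho_k)=\kappa^k$ and $\kappa_k=0$ on products of fewer than $k$ distinct generators; $\kappa_k(\omega\hat\otimes c)=\kappa_k(c)\omega$; $d$ acts entrywise on matrices and as $d\otimes\mathrm{id}$ on tensor products with $\mathbb C l_k$. Let $e\in\mathcal A\hat\otimes\mathbb C l_{r+s}$ be an OSU lying in the real subalgebra $A^{\mathfrak r}\hat\otimes Cl_{r,s}$ with $de=0$. The pairing of $\xi$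 with $[x]\in DK_e(A^{\mathfrak r}\hat\otimes Cl_{r,s})$, represented by a real OSU $x\in M_m(\mathcal A\hat\otimes\mathbb C l_{r+s})$, is $\int\mathrm{Tr}_m\kappa_{r+s}((x-e_m)(dx)^n)$, extended to a group homomorphism. Pairing non-trivially means that this homomorphism is not zero. *)

theory Defs
  imports
    "HOL-Complex_Analysis.Complex_Analysis"
    "HOL-Algebra.Free_Abelian_Groups"
    "HOL-Algebra.Generated_Groups"
    "HOL-Library.Z2"
begin

definition mu :: "int \<Rightarrow> int" where
  "mu k = \<lfloor>real_of_int k / 2\<rfloor>"


section \<open>Complex algebras and unital C*-algebras\<close>

class complex_algebra = ring +
  fixes scaleC :: "complex \<Rightarrow> 'a \<Rightarrow> 'a"  (infixr \<open>*\<^sub>C\<close> 75)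
  assumes scaleC_add_right: "c *\<^sub>C (x + y) = c *\<^sub>C x + c *\<^sub>C y"
    and scaleC_add_left: "(b + c) *\<^sub>C x = b *\<^sub>C x + c *\<^sub>C x"
    and scaleC_scaleC: "b *\<^sub>C (c *\<^sub>C x) = (b * c) *\<^sub>C x"
    and scaleC_one: "1 *\<^sub>C x = x"
    and mult_scaleC_left: "(c *\<^sub>C x) * y = c *\<^sub>C (x * y)"
    and mult_scaleC_right: "x * (c *\<^sub>C y) = c *\<^sub>C (x * y)"

global_interpretation complex_vector: vector_space "scaleC :: complex \<Rightarrow> 'a \<Rightarrow> 'a::complex_algebra"
  by unfold_locales (simp_all add: scaleC_add_right scaleC_add_left scaleC_scaleC scaleC_one)

abbreviation clinear :: "('a::complex_algebra \<Rightarrow> 'b::complex_algebra) \<Rightarrow> bool" where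
  "clinear \<equiv> Vector_Spaces.linear (*\<^sub>C) (*\<^sub>C)"

definition antilinear :: "('a::complex_algebra \<Rightarrow> 'b::complex_algebra) \<Rightarrow> bool" where
  "antilinear f \<longleftrightarrow> (\<forall>x y. f (x + y) = f x + f y) \<and> (\<forall>c x. f (c *\<^sub>C x) = cnj c *\<^sub>C f x)"

class unital_cstar_algebra = complex_algebra + real_normed_algebra_1 + banach +
  fixes star :: "'a \<Rightarrow> 'a"
  assumes scaleR_scaleC: "r *\<^sub>R x = complex_of_real r *\<^sub>C x"
    and norm_scaleC: "norm (c *\<^sub>C x) = cmod c * norm x"
    and star_star: "star (star x) = x"
    and star_add: "star (x + y) = star x + star y"
    and star_scaleC: "star (c *\<^sub>C x) = cnj c *\<^sub>C star x"
    and star_mult: "star (x * y) = star y * star x"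
    and cstar_identity: "norm (star x * x) = (norm x)\<^sup>2"

locale graded_cstar_algebra =
  fixes gr :: "'a::unital_cstar_algebra \<Rightarrow> 'a"
  assumes gr_linear: "clinear gr"
    and gr_mult: "gr (a * b) = gr a * gr b"
    and gr_star: "gr (star a) = star (gr a)"
    and gr_gr: "gr (gr a) = a"

locale graded_real_cstar_algebra = graded_cstar_algebra gr
  for gr :: "'a::unital_cstar_algebra \<Rightarrow> 'a" +
  fixes rs :: "'a \<Rightarrow> 'a"
  assumes rs_antilinear: "antilinear rs"
    and rs_mult: "rs (a * b) = rs a * rs b"
    and rs_star: "rs (star a) = star (rs a)"
    and rs_rs: "rs (rs a) = a"
    and rs_gr: "rs (gr a) = gr (rs a)"


section \<open>Graded tensor products with complex Clifford algebras, and matrices over them\<close>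

text \<open>
  The Clifford algebra on the generators \<open>\<rho>\<^sub>0, \<dots>, \<rho>\<^sub>k\<^sub>-\<^sub>1\<close> has the linear basis
  \<open>\<rho>\<^sub>I = \<rho>\<^sub>i\<^sub>1 \<cdots> \<rho>\<^sub>i\<^sub>p\<close> where \<open>I = {i\<^sub>1 < \<dots> < i\<^sub>p} \<subseteq> {..<k}\<close>.  An element \<open>\<Sum>\<^sub>I a\<^sub>I \<otimes> \<rho>\<^sub>I\<close> of the
  graded tensor product of an algebra with it is encoded as the coefficient function
  \<open>I \<mapsto> a\<^sub>I\<close>, which vanishes outside the subsets of \<open>{..<k}\<close>.  The grading of the algebra is
  given by its grading automorphism \<open>g\<close>.  Type \<open>'a clmat\<close> holds square matrices of such elements:
  \<open>x i j I\<close> is the coefficient of \<open>\<rho>\<^sub>I\<close> in the entry \<open>(i, j)\<close>.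

  The product topology of the function types, restricted to \<open>cl k UNIV\<close> or \<open>clmat m k UNIV\<close>
  (finitely many coordinates in a C*-algebra), is the topology of the C*-norm of
  \<open>A \<otimes> Cl\<^sub>k\<close>, respectively \<open>M\<^sub>m(A \<otimes> Cl\<^sub>k)\<close>.
\<close>

type_synonym 'a cl = "nat set \<Rightarrow> 'a"
type_synonym 'a clmat = "nat \<Rightarrow> nat \<Rightarrow> 'a cl"

definition cl :: "nat \<Rightarrow> 'a::zero set \<Rightarrow> 'a cl set" where
  "cl k S = {x. (\<forall>I. I \<subseteq> {..<k} \<longrightarrow> x I \<in> S) \<and> (\<forall>I. \<not> I \<subseteq> {..<k} \<longrightarrow> x I = 0)}"

text \<open>
  \<open>\<rho>\<^sub>I \<rho>\<^sub>J = (-1)\<^sup>N \<rho>\<^sub>K\<close> with \<open>K\<close> the symmetric difference of \<open>I\<close> and \<open>J\<close>, and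
  \<open>N = inversions I J\<close> the number of transpositions that sort the word (equal neighbours cancel).
\<close>

definition inversions :: "nat set \<Rightarrow> nat set \<Rightarrow> nat" where
  "inversions I J = card {(i, j). i \<in> I \<and> j \<in> J \<and> j < i}"

text \<open>
  \<open>(a \<otimes> \<rho>\<^sub>I)(b \<otimes> \<rho>\<^sub>J) = (-1)\<^bsup>|I||b|\<^esup> a b \<otimes> \<rho>\<^sub>I \<rho>\<^sub>J\<close>, and \<open>(-1)\<^bsup>|I||b|\<^esup> b\<close> is the \<open>|I|\<close>-th iterate
  of the grading automorphism at \<open>b\<close>.  Likewise
  \<open>(a \<otimes> \<rho>\<^sub>I)\<^sup>* = (-1)\<^bsup>|a||I|\<^esup> a\<^sup>* \<otimes> \<rho>\<^sub>I\<^sup>*\<close>, where \<open>\<rho>\<^sub>I\<^sup>*\<close> is the reversed word,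
  i.e. \<open>\<rho>\<^sub>I\<close> with the sign of \<open>|I|(|I|-1)/2\<close> transpositions.
\<close>

definition cl_mult :: "('a::complex_algebra \<Rightarrow> 'a) \<Rightarrow> nat \<Rightarrow> 'a cl \<Rightarrow> 'a cl \<Rightarrow> 'a cl" where
  "cl_mult g k x y = (\<lambda>K. \<Sum>(I, J) \<in> {(I, J). I \<subseteq> {..<k} \<and> J \<subseteq> {..<k} \<and> sym_diff I J = K}.
     (-1) ^ inversions I J *\<^sub>C (x I * (g ^^ card I) (y J)))"

definition cl_star :: "('a::unital_cstar_algebra \<Rightarrow> 'a) \<Rightarrow> 'a cl \<Rightarrow> 'a cl" where
  "cl_star g x = (\<lambda>I. (-1) ^ (card I choose 2) *\<^sub>C (g ^^ card I) (star (x I)))"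

definition cl_grading :: "('a::complex_algebra \<Rightarrow> 'a) \<Rightarrow> 'a cl \<Rightarrow> 'a cl" where
  "cl_grading g x = (\<lambda>I. (-1) ^ card I *\<^sub>C g (x I))"

text \<open>
  The real structure \<open>rs \<otimes> l\<^sub>r\<^sub>,\<^sub>s\<close>: the first \<open>r\<close> generators are fixed and the
  other \<open>s\<close> change sign.
\<close>

definition cl_real :: "('a::complex_algebra \<Rightarrow> 'a) \<Rightarrow> nat \<Rightarrow> nat \<Rightarrow> 'a cl \<Rightarrow> 'a cl" where
  "cl_real rs r s x = (\<lambda>I. (-1) ^ card (I \<inter> {r..<r+s}) *\<^sub>C rs (x I))"

definition cl_one :: "'a::zero_neq_one cl" where
  "cl_one = (\<lambda>I. if I = {} then 1 else 0)"

text \<open>The elementary tensor \<open>a \<otimes> \<rho>\<^sub>I\<close>, and the defining relations of the generators.\<close>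

definition cl_tensor :: "'a::zero \<Rightarrow> nat set \<Rightarrow> 'a cl" where
  "cl_tensor a I = (\<lambda>J. if J = I then a else 0)"

lemma cl_mult_tensor:
  assumes g: "clinear g" and IJ: "I \<subseteq> {..<k}" "J \<subseteq> {..<k}"
  shows "cl_mult g k (cl_tensor a I) (cl_tensor b J) =
    cl_tensor ((-1) ^ inversions I J *\<^sub>C (a * (g ^^ card I) b)) (sym_diff I J)"
proof
  fix K
  interpret g: Vector_Spaces.linear "(*\<^sub>C)" "(*\<^sub>C)" g by (rule g)
  have g0: "(g ^^ p) 0 = 0" for p
    by (induction p) (simp_all add: g.zero)
  let ?X = "{(I, J). I \<subseteq> {..<k} \<and> J \<subseteq> {..<k} \<and> sym_diff I J = K}"
  let ?c = "(-1) ^ inversions I J *\<^sub>C (a * (g ^^ card I) b)"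
  have fin: "finite ?X"
    by (rule finite_subset[of _ "Pow {..<k} \<times> Pow {..<k}"]) auto
  have "cl_mult g k (cl_tensor a I) (cl_tensor b J) K = (\<Sum>q\<in>?X. if q = (I, J) then ?c else 0)"
    unfolding cl_mult_def
  proof (rule sum.cong[OF refl])
    fix q assume "q \<in> ?X"
    obtain P Q where q: "q = (P, Q)" by (cases q)
    show "(case q of (P, Q) \<Rightarrow> (-1) ^ inversions P Q *\<^sub>C
        (cl_tensor a I P * (g ^^ card P) (cl_tensor b J Q))) = (if q = (I, J) then ?c else 0)"
      unfolding q cl_tensor_def
      by (cases "P = I"; cases "Q = J") (simp_all add: g0 complex_vector.scale_zero_right)
  qed
  also have "\<dots> = (if (I, J) \<in> ?X then ?c else 0)"
    using fin by (simp add: sum.delta')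
  also have "\<dots> = cl_tensor ?c (sym_diff I J) K"
    using IJ by (auto simp: cl_tensor_def)
  finally show "cl_mult g k (cl_tensor a I) (cl_tensor b J) K = cl_tensor ?c (sym_diff I J) K" .
qed

lemma star_one: "star (1::'a::unital_cstar_algebra) = 1"
  by (metis mult.right_neutral mult.left_neutral star_mult star_star)

lemma (in graded_cstar_algebra) gr_one: "gr 1 = 1"
  by (metis gr_gr gr_mult mult.right_neutral mult.left_neutral)

lemma (in graded_cstar_algebra) clifford_generators:
  assumes "i < k" "j < k"
  shows "cl_mult gr k (cl_tensor 1 {i}) (cl_tensor 1 {i}) = cl_one"
    and "i \<noteq> j \<Longrightarrow> cl_mult gr k (cl_tensor 1 {i}) (cl_tensor 1 {j}) =
      (\<lambda>I. - cl_mult gr k (cl_tensor 1 {j}) (cl_tensor 1 {i}) I)"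
    and "cl_star gr (cl_tensor 1 {i}) = cl_tensor 1 {i}"
    and "cl_grading gr (cl_tensor 1 {i}) = (\<lambda>I. - cl_tensor 1 {i} I)"
proof -
  interpret g: Vector_Spaces.linear "(*\<^sub>C)" "(*\<^sub>C)" gr by (rule gr_linear)
  have minus_one: "(-1) *\<^sub>C x = - x" for x :: 'a
    by (simp add: complex_vector.scale_minus_left scaleC_one)
  have inv: "inversions {p} {q} = (if q < p then 1 else 0)" for p q
  proof -
    have "{(i, j). i \<in> {p} \<and> j \<in> {q} \<and> j < i} = (if q < p then {(p, q)} else {})"
      by auto
    then show ?thesis by (simp add: inversions_def)
  qed
  have star0: "star (0::'a) = 0"
    using star_add[of "0::'a" 0] by simp
  show "cl_mult gr k (cl_tensor 1 {i}) (cl_tensor 1 {i}) = cl_one"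
    using assms by (subst cl_mult_tensor[OF gr_linear])
      (auto simp: inv gr_one scaleC_one cl_tensor_def cl_one_def)
  show "cl_mult gr k (cl_tensor 1 {i}) (cl_tensor 1 {j}) =
      (\<lambda>I. - cl_mult gr k (cl_tensor 1 {j}) (cl_tensor 1 {i}) I)" if "i \<noteq> j"
    using assms that by (simp add: cl_mult_tensor[OF gr_linear])
      (auto simp: fun_eq_iff inv gr_one scaleC_one minus_one cl_tensor_def)
  show "cl_star gr (cl_tensor 1 {i}) = cl_tensor 1 {i}"
  proof
    fix I
    have "(gr ^^ p) 0 = 0" for p
      by (induction p) (simp_all add: g.zero)
    then show "cl_star gr (cl_tensor 1 {i}) I = cl_tensor 1 {i} I"
      by (simp add: cl_star_def cl_tensor_def star_one star0 gr_one scaleC_one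
        complex_vector.scale_zero_right numeral_2_eq_2)
  qed
  show "cl_grading gr (cl_tensor 1 {i}) = (\<lambda>I. - cl_tensor 1 {i} I)"
    by (auto simp: fun_eq_iff cl_grading_def cl_tensor_def gr_one minus_one g.zero complex_vector.scale_zero_right)
qed

definition clmat :: "nat \<Rightarrow> nat \<Rightarrow> 'a::zero set \<Rightarrow> 'a clmat set" where
  "clmat m k S = {x. (\<forall>i<m. \<forall>j<m. x i j \<in> cl k S) \<and> (\<forall>i j. \<not> (i < m \<and> j < m) \<longrightarrow> x i j = (\<lambda>_. 0))}"

definition mat_mult :: "('a::complex_algebra \<Rightarrow> 'a) \<Rightarrow> nat \<Rightarrow> nat \<Rightarrow> 'a clmat \<Rightarrow> 'a clmat \<Rightarrow> 'a clmat" where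
  "mat_mult g m k x y = (\<lambda>i j I. \<Sum>l<m. cl_mult g k (x i l) (y l j) I)"

definition mat_diag :: "nat \<Rightarrow> 'a::zero cl \<Rightarrow> 'a clmat" where
  "mat_diag m e = (\<lambda>i j. if i = j \<and> i < m then e else (\<lambda>_. 0))"

definition mat_dsum :: "nat \<Rightarrow> 'a::zero clmat \<Rightarrow> 'a clmat \<Rightarrow> 'a clmat" where
  "mat_dsum m x y = (\<lambda>i j. if i < m \<and> j < m then x i j
     else if m \<le> i \<and> m \<le> j then y (i - m) (j - m) else (\<lambda>_. 0))"

text \<open>
  The odd self-adjoint unitaries of \<open>M\<^sub>m(A \<otimes> Cl\<^sub>k)\<close> with coefficients in \<open>S \<subseteq> A\<close>, and those
  fixed by the real structure \<open>rs \<otimes> l\<^sub>r\<^sub>,\<^sub>s\<close>, where \<open>k = r + s\<close>.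
\<close>

definition osu :: "('a::unital_cstar_algebra \<Rightarrow> 'a) \<Rightarrow> nat \<Rightarrow> nat \<Rightarrow> 'a set \<Rightarrow> 'a clmat set" where
  "osu g m k S = {x \<in> clmat m k S.
     (\<forall>i j. cl_grading g (x i j) = (\<lambda>I. - x i j I)) \<and>
     (\<forall>i j. cl_star g (x j i) = x i j) \<and>
     mat_mult g m k x x = mat_diag m cl_one}"

definition real_osu ::
    "('a::unital_cstar_algebra \<Rightarrow> 'a) \<Rightarrow> ('a \<Rightarrow> 'a) \<Rightarrow> nat \<Rightarrow> nat \<Rightarrow> nat \<Rightarrow> 'a set \<Rightarrow> 'a clmat set" where
  "real_osu g rs r s m S = {x \<in> osu g m (r + s) S. \<forall>i j. cl_real rs r s (x i j) = x i j}"


definition kappa :: complex where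
  "kappa = complex_of_real (sqrt 2) * exp (\<i> * complex_of_real pi / 4)"

text \<open>
  \<open>\<kappa>\<^sub>k\<close> composed with the matrix trace: \<open>\<kappa>\<^sub>k\<close> picks \<open>kappa ^ k\<close> times the coefficient of
  \<open>\<rho>\<^sub>0 \<cdots> \<rho>\<^sub>k\<^sub>-\<^sub>1\<close>.
\<close>

definition kappa_Tr :: "nat \<Rightarrow> nat \<Rightarrow> 'a::complex_algebra clmat \<Rightarrow> 'a" where
  "kappa_Tr m k w = (\<Sum>i<m. kappa ^ k *\<^sub>C w i i {..<k})"


section \<open>Holomorphic functional calculus\<close>

definition cl_inverse_of :: "('a::unital_cstar_algebra \<Rightarrow> 'a) \<Rightarrow> nat \<Rightarrow> 'a cl \<Rightarrow> 'a cl \<Rightarrow> bool" where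
  "cl_inverse_of g k x y \<longleftrightarrow> y \<in> cl k UNIV \<and> cl_mult g k x y = cl_one \<and> cl_mult g k y x = cl_one"

definition cl_spectrum :: "('a::unital_cstar_algebra \<Rightarrow> 'a) \<Rightarrow> nat \<Rightarrow> 'a cl \<Rightarrow> complex set" where
  "cl_spectrum g k b = {z. \<not> (\<exists>y. cl_inverse_of g k (\<lambda>I. z *\<^sub>C cl_one I - b I) y)}"

definition cl_resolvent :: "('a::unital_cstar_algebra \<Rightarrow> 'a) \<Rightarrow> nat \<Rightarrow> 'a cl \<Rightarrow> complex \<Rightarrow> 'a cl" where
  "cl_resolvent g k b z = (THE y. cl_inverse_of g k (\<lambda>I. z *\<^sub>C cl_one I - b I) y)"

text \<open>
  \<open>f(b) = (2\<pi>i)\<^sup>-\<^sup>1 \<integral> f(z) (z - b)\<^sup>-\<^sup>1 dz\<close>, the integral taken over the loops in the list \<open>ps\<close>.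
\<close>

definition cl_hol_calc ::
    "('a::unital_cstar_algebra \<Rightarrow> 'a) \<Rightarrow> nat \<Rightarrow> 'a cl \<Rightarrow> (complex \<Rightarrow> complex) \<Rightarrow> (real \<Rightarrow> complex) list \<Rightarrow> 'a cl" where
  "cl_hol_calc g k b f ps = (\<lambda>I. (1 / (2 * complex_of_real pi * \<i>)) *\<^sub>C
     (\<Sum>p\<leftarrow>ps. integral {0..1}
        (\<lambda>t. (f (p t) * vector_derivative p (at t within {0..1})) *\<^sub>C cl_resolvent g k b (p t) I)))"

definition hol_calc_closed :: "('a::unital_cstar_algebra \<Rightarrow> 'a) \<Rightarrow> nat \<Rightarrow> 'a cl set \<Rightarrow> bool" where
  "hol_calc_closed g k B \<longleftrightarrow> (\<forall>b\<in>B. \<forall>U f ps.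
     open U \<and> cl_spectrum g k b \<subseteq> U \<and> f holomorphic_on U \<and>
     (\<forall>p\<in>set ps. valid_path p \<and> pathfinish p = pathstart p \<and> path_image p \<subseteq> U - cl_spectrum g k b) \<and>
     (\<forall>z\<in>cl_spectrum g k b. (\<Sum>p\<leftarrow>ps. winding_number p z) = 1) \<and>
     (\<forall>z. z \<notin> U \<longrightarrow> (\<Sum>p\<leftarrow>ps. winding_number p z) = 0)
     \<longrightarrow> cl_hol_calc g k b f ps \<in> B)"


section \<open>Van Daele's K-group\<close>

text \<open>
  Van Daele's construction sees a graded algebra \<open>D\<close> only through the spaces
  \<open>S m\<close> of odd self-adjoint unitaries of \<open>M\<^sub>m(D)\<close> and the basepoint \<open>e\<close>.
\<close>

definition vd_rel ::
    "(nat \<Rightarrow> 'a::unital_cstar_algebra clmat set) \<Rightarrow> 'a cl \<Rightarrow> ((nat \<times> 'a clmat) \<times> (nat \<times> 'a clmat)) set" where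
  "vd_rel S e = {((m, x), (l, y)). 1 \<le> m \<and> 1 \<le> l \<and> x \<in> S m \<and> y \<in> S l \<and>
     (\<exists>n. m \<le> n \<and> l \<le> n \<and>
        path_component (S n) (mat_dsum m x (mat_diag (n - m) e)) (mat_dsum l y (mat_diag (n - l) e)))}"

definition vd_class ::
    "(nat \<Rightarrow> 'a::unital_cstar_algebra clmat set) \<Rightarrow> 'a cl \<Rightarrow> nat \<Rightarrow> 'a clmat \<Rightarrow> (nat \<times> 'a clmat) set" where
  "vd_class S e m x = vd_rel S e `` {(m, x)}"

definition vd_semigroup ::
    "(nat \<Rightarrow> 'a::unital_cstar_algebra clmat set) \<Rightarrow> 'a cl \<Rightarrow> (nat \<times> 'a clmat) set set" where
  "vd_semigroup S e = {(m, x). 1 \<le> m \<and> x \<in> S m} // vd_rel S e"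

definition vd_add ::
    "(nat \<Rightarrow> 'a::unital_cstar_algebra clmat set) \<Rightarrow> 'a cl \<Rightarrow>
     (nat \<times> 'a clmat) set \<Rightarrow> (nat \<times> 'a clmat) set \<Rightarrow> (nat \<times> 'a clmat) set" where
  "vd_add S e X Y = (\<Union>(m, x)\<in>X. \<Union>(l, y)\<in>Y. vd_class S e (m + l) (mat_dsum m x y))"

text \<open>
  The Grothendieck group of an abelian semigroup \<open>(V, add)\<close>: the free abelian group on \<open>V\<close>
  modulo the relations \<open>[u + v] = [u] + [v]\<close>.
\<close>

definition grothendieck_rels :: "'v set \<Rightarrow> ('v \<Rightarrow> 'v \<Rightarrow> 'v) \<Rightarrow> ('v \<Rightarrow>\<^sub>0 int) set" where
  "grothendieck_rels V add = generate (free_Abelian_group V)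
     {frag_of (add u v) - frag_of u - frag_of v | u v. u \<in> V \<and> v \<in> V}"

definition grothendieck_group :: "'v set \<Rightarrow> ('v \<Rightarrow> 'v \<Rightarrow> 'v) \<Rightarrow> ('v \<Rightarrow>\<^sub>0 int) set monoid" where
  "grothendieck_group V add = free_Abelian_group V Mod grothendieck_rels V add"

definition grothendieck_class :: "'v set \<Rightarrow> ('v \<Rightarrow> 'v \<Rightarrow> 'v) \<Rightarrow> 'v \<Rightarrow> ('v \<Rightarrow>\<^sub>0 int) set" where
  "grothendieck_class V add v = grothendieck_rels V add #>\<^bsub>free_Abelian_group V\<^esub> frag_of v"

type_synonym 'a dk = "((nat \<times> 'a clmat) set \<Rightarrow>\<^sub>0 int) set"

definition DK :: "(nat \<Rightarrow> 'a::unital_cstar_algebra clmat set) \<Rightarrow> 'a cl \<Rightarrow> 'a dk monoid" where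
  "DK S e = grothendieck_group (vd_semigroup S e) (vd_add S e)"

definition DK_class ::
    "(nat \<Rightarrow> 'a::unital_cstar_algebra clmat set) \<Rightarrow> 'a cl \<Rightarrow> nat \<Rightarrow> 'a clmat \<Rightarrow> 'a dk" where
  "DK_class S e m x = grothendieck_class (vd_semigroup S e) (vd_add S e) (vd_class S e m x)"

definition complex_add_group :: "complex monoid" where
  "complex_add_group = \<lparr>carrier = UNIV, monoid.mult = (+), one = 0\<rparr>"


section \<open>Cycles\<close>

inductive_set algebra_generated :: "'w::complex_algebra set \<Rightarrow> 'w set" for S where
  "w \<in> S \<Longrightarrow> w \<in> algebra_generated S"
| "v \<in> algebra_generated S \<Longrightarrow> w \<in> algebra_generated S \<Longrightarrow> v + w \<in> algebra_generated S"
| "v \<in> algebra_generated S \<Longrightarrow> w \<in> algebra_generated S \<Longrightarrow> v * w \<in> algebra_generated S"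
| "w \<in> algebra_generated S \<Longrightarrow> c *\<^sub>C w \<in> algebra_generated S"

definition bit_sign :: "bit \<Rightarrow> complex" where
  "bit_sign \<epsilon> = (if \<epsilon> = 0 then 1 else -1)"

text \<open>
  \<open>deg j\<close> is the part of integer degree \<open>j\<close> of \<open>\<Omega>\<close>, and \<open>gr\<Omega>\<close> is the grading automorphism of
  its \<open>\<int>\<^sub>2\<close>-grading.  The differential \<open>d\<close> and the functional \<open>tr\<close> (the integral) are meaningful on
  their domains \<open>domd\<close>, \<open>domtr\<close> only.  No compatibility of the topology of \<open>\<Omega>\<close> with its
  algebraic structure is used; it gives meaning to the density of the two domains.

  The graded trace property \<open>tr_graded_trace\<close> is stated on the algebra generated by \<open>\<A>\<close> and
  \<open>d \<A>\<close>; by the Leibniz rule its part of degree \<open>n\<close> lies in the domain of the integral.  That the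
  integral vanishes on \<open>(d \<A>)\<^sup>n\<close> (\<open>tr_closed\<close>) is void for \<open>n = 0\<close>.
\<close>

locale nc_cycle = graded_cstar_algebra gr
  for gr :: "'a::unital_cstar_algebra \<Rightarrow> 'a" +
  fixes deg :: "int \<Rightarrow> 'w::{complex_algebra, topological_space} set"
    and gr\<Omega> :: "'w \<Rightarrow> 'w"
    and emb :: "'a \<Rightarrow> 'w"
    and domd :: "'w set"
    and d :: "'w \<Rightarrow> 'w"
    and domtr :: "'w set"
    and tr :: "'w \<Rightarrow> complex"
    and \<A> :: "'a set"
    and n :: nat
  assumes deg_subspace: "complex_vector.subspace (deg j)"
    and deg_direct_sum: "\<exists>!f. finite {j. f j \<noteq> 0} \<and> (\<forall>j. f j \<in> deg j) \<and> \<omega> = (\<Sum>j | f j \<noteq> 0. f j)"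
    and deg_mult: "\<omega> \<in> deg i \<Longrightarrow> \<omega>' \<in> deg j \<Longrightarrow> \<omega> * \<omega>' \<in> deg (i + j)"
    and gr\<Omega>_linear: "clinear gr\<Omega>"
    and gr\<Omega>_mult: "gr\<Omega> (\<omega> * \<omega>') = gr\<Omega> \<omega> * gr\<Omega> \<omega>'"
    and gr\<Omega>_gr\<Omega>: "gr\<Omega> (gr\<Omega> \<omega>) = \<omega>"
    and gr\<Omega>_deg: "\<omega> \<in> deg j \<Longrightarrow> gr\<Omega> \<omega> \<in> deg j"
    and emb_linear: "clinear emb"
    and emb_mult: "emb (a * b) = emb a * emb b"
    and emb_inj: "inj emb"
    and emb_deg: "emb a \<in> deg 0"
    and emb_gr: "emb (gr a) = gr\<Omega> (emb a)"
    and domd_subspace: "complex_vector.subspace domd"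
    and domd_mult: "\<omega> \<in> domd \<Longrightarrow> \<omega>' \<in> domd \<Longrightarrow> \<omega> * \<omega>' \<in> domd"
    and domd_dense: "closure domd = UNIV"
    and d_add: "\<omega> \<in> domd \<Longrightarrow> \<omega>' \<in> domd \<Longrightarrow> d (\<omega> + \<omega>') = d \<omega> + d \<omega>'"
    and d_scaleC: "\<omega> \<in> domd \<Longrightarrow> d (c *\<^sub>C \<omega>) = c *\<^sub>C d \<omega>"
    and d_degree: "\<omega> \<in> domd \<Longrightarrow> \<omega> \<in> deg j \<Longrightarrow> gr\<Omega> \<omega> = bit_sign \<epsilon> *\<^sub>C \<omega> \<Longrightarrow>
        d \<omega> \<in> deg (j + 1) \<and> gr\<Omega> (d \<omega>) = bit_sign \<epsilon> *\<^sub>C d \<omega>"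
    and d_leibniz: "\<omega> \<in> domd \<Longrightarrow> \<omega> \<in> deg j \<Longrightarrow> \<omega>' \<in> domd \<Longrightarrow>
        d (\<omega> * \<omega>') = d \<omega> * \<omega>' + ((-1) powi j) *\<^sub>C (\<omega> * d \<omega>')"
    and d_d: "\<omega> \<in> domd \<Longrightarrow> d \<omega> \<in> domd \<and> d (d \<omega>) = 0"
    and domtr_subspace: "complex_vector.subspace domtr"
    and domtr_deg: "domtr \<subseteq> deg (int n)"
    and domtr_dense: "deg (int n) \<subseteq> closure domtr"
    and tr_add: "\<omega> \<in> domtr \<Longrightarrow> \<omega>' \<in> domtr \<Longrightarrow> tr (\<omega> + \<omega>') = tr \<omega> + tr \<omega>'"
    and tr_scaleC: "\<omega> \<in> domtr \<Longrightarrow> tr (c *\<^sub>C \<omega>) = c * tr \<omega>"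
    and \<A>_subspace: "complex_vector.subspace \<A>"
    and \<A>_mult: "a \<in> \<A> \<Longrightarrow> b \<in> \<A> \<Longrightarrow> a * b \<in> \<A>"
    and \<A>_star: "a \<in> \<A> \<Longrightarrow> star a \<in> \<A>"
    and \<A>_dense: "closure \<A> = UNIV"
    and \<A>_domd: "emb ` \<A> \<subseteq> domd"
    and tr_domain: "a \<in> \<A> \<Longrightarrow> set as \<subseteq> \<A> \<Longrightarrow> length as = n \<Longrightarrow>
        foldl (\<lambda>\<omega> b. \<omega> * d (emb b)) (emb a) as \<in> domtr"
    and tr_graded_trace: "\<omega> \<in> algebra_generated (emb ` \<A> \<union> d ` emb ` \<A>) \<Longrightarrow>
        \<omega>' \<in> algebra_generated (emb ` \<A> \<union> d ` emb ` \<A>) \<Longrightarrow>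
        \<omega> \<in> deg i \<Longrightarrow> gr\<Omega> \<omega> = bit_sign \<epsilon> *\<^sub>C \<omega> \<Longrightarrow>
        \<omega>' \<in> deg j \<Longrightarrow> gr\<Omega> \<omega>' = bit_sign \<delta> *\<^sub>C \<omega>' \<Longrightarrow> i + j = int n \<Longrightarrow>
        tr (\<omega> * \<omega>') = (-1) powi (i * j) * bit_sign (\<epsilon> * \<delta>) * tr (\<omega>' * \<omega>)"
    and tr_closed: "a \<in> \<A> \<Longrightarrow> set as \<subseteq> \<A> \<Longrightarrow> Suc (length as) = n \<Longrightarrow>
        foldl (\<lambda>\<omega> b. \<omega> * d (emb b)) (d (emb a)) as \<in> domtr \<and>
        tr (foldl (\<lambda>\<omega> b. \<omega> * d (emb b)) (d (emb a)) as) = 0"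
    and \<A>_hol_closed: "hol_calc_closed gr k {x \<in> cl k \<A>. cl_grading gr x = x}"
    and \<A>_osu_dense: "1 \<le> m \<Longrightarrow> osu gr m k UNIV \<subseteq> closure (osu gr m k \<A>)"
    and \<A>_osu_closed: "\<exists>x. gr x = - x \<and> star x = x \<and> x * x = 1 \<Longrightarrow>
        \<exists>x\<in>\<A>. gr x = - x \<and> star x = x \<and> x * x = 1 \<and> d (emb x) = 0"
begin

definition has_parity :: "bit \<Rightarrow> bool" where
  "has_parity \<nu> \<longleftrightarrow> (\<forall>\<omega>\<in>domtr. gr\<Omega> \<omega> = bit_sign (\<nu> + 1) *\<^sub>C \<omega> \<longrightarrow> tr \<omega> = 0)"

text \<open>The matrix \<open>(x - e\<^sub>m)(dx)\<^sup>n\<close> over \<open>\<Omega> \<otimes> Cl\<^sub>k\<close>; powers are iterated right multiplications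
  because \<open>\<Omega>\<close> need not have a unit.\<close>

definition char_form :: "nat \<Rightarrow> nat \<Rightarrow> 'a cl \<Rightarrow> 'a clmat \<Rightarrow> 'w clmat" where
  "char_form m k e x =
     ((\<lambda>w. mat_mult gr\<Omega> m k w (\<lambda>i j I. d (emb (x i j I)))) ^^ n)
       (\<lambda>i j I. emb (x i j I - mat_diag m e i j I))"

definition pairing_value :: "nat \<Rightarrow> nat \<Rightarrow> 'a cl \<Rightarrow> 'a clmat \<Rightarrow> complex" where
  "pairing_value m k e x = tr (kappa_Tr m k (char_form m k e x))"

end

text \<open>\<open>star\<Omega>\<close> is the involution and \<open>rs\<Omega>\<close> the real structure of \<open>\<Omega>\<close>.  The sign condition is
  imposed where both of its sides are defined.\<close>

locale star_real_cycle =
  graded_real_cstar_algebra gr rs + nc_cycle gr deg gr\<Omega> emb domd d domtr tr \<A> n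
  for gr rs :: "'a::unital_cstar_algebra \<Rightarrow> 'a"
    and deg :: "int \<Rightarrow> 'w::{complex_algebra, topological_space} set"
    and gr\<Omega> emb domd d domtr tr \<A> n +
  fixes star\<Omega> rs\<Omega> :: "'w \<Rightarrow> 'w"
    and sgn\<Omega> :: complex
  assumes sign: "sgn\<Omega> \<in> {1, -1}"
    and \<A>_real: "rs ` \<A> \<subseteq> \<A>"
    and star\<Omega>_antilinear: "antilinear star\<Omega>"
    and star\<Omega>_mult: "star\<Omega> (\<omega> * \<omega>') = star\<Omega> \<omega>' * star\<Omega> \<omega>"
    and star\<Omega>_star\<Omega>: "star\<Omega> (star\<Omega> \<omega>) = \<omega>"
    and rs\<Omega>_antilinear: "antilinear rs\<Omega>"
    and rs\<Omega>_mult: "rs\<Omega> (\<omega> * \<omega>') = rs\<Omega> \<omega> * rs\<Omega> \<omega>'"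
    and rs\<Omega>_star\<Omega>: "rs\<Omega> (star\<Omega> \<omega>) = star\<Omega> (rs\<Omega> \<omega>)"
    and rs\<Omega>_rs\<Omega>: "rs\<Omega> (rs\<Omega> \<omega>) = \<omega>"
    and emb_star: "emb (star a) = star\<Omega> (emb a)"
    and emb_rs: "emb (rs a) = rs\<Omega> (emb a)"
    and d_star: "a \<in> \<A> \<Longrightarrow> d (emb (star a)) = star\<Omega> (d (emb a))"
    and d_rs: "a \<in> \<A> \<Longrightarrow> d (emb (rs a)) = rs\<Omega> (d (emb a))"
    and tr_sign: "\<omega> \<in> domtr \<Longrightarrow> star\<Omega> (rs\<Omega> \<omega>) \<in> domtr \<Longrightarrow> tr (star\<Omega> (rs\<Omega> \<omega>)) = sgn\<Omega> * tr \<omega>"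
begin

definition basepoint :: "nat \<Rightarrow> nat \<Rightarrow> 'a cl \<Rightarrow> bool" where
  "basepoint r s e \<longleftrightarrow> mat_diag 1 e \<in> real_osu gr rs r s 1 \<A> \<and> (\<forall>I. d (emb (e I)) = 0)"

abbreviation DK_real :: "nat \<Rightarrow> nat \<Rightarrow> 'a cl \<Rightarrow> 'a dk monoid" where
  "DK_real r s e \<equiv> DK (\<lambda>m. real_osu gr rs r s m UNIV) e"

definition is_pairing :: "nat \<Rightarrow> nat \<Rightarrow> 'a cl \<Rightarrow> ('a dk \<Rightarrow> complex) \<Rightarrow> bool" where
  "is_pairing r s e \<Phi> \<longleftrightarrow> \<Phi> \<in> hom (DK_real r s e) complex_add_group \<and>
     (\<forall>m\<ge>1. \<forall>x \<in> real_osu gr rs r s m \<A>.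
        \<Phi> (DK_class (\<lambda>m. real_osu gr rs r s m UNIV) e m x) = pairing_value m (r + s) e x)"

text \<open>\<open>\<Phi>\<close> is determined by \<open>is_pairing\<close>: the classes of odd self-adjoint unitaries with coefficients
  in \<open>\<A>\<close> generate the K-group.\<close>

definition pairs_nontrivially :: "nat \<Rightarrow> nat \<Rightarrow> 'a cl \<Rightarrow> bool" where
  "pairs_nontrivially r s e \<longleftrightarrow>
     (\<exists>\<Phi>. is_pairing r s e \<Phi> \<and> (\<exists>g \<in> carrier (DK_real r s e). \<Phi> g \<noteq> 0))"

end

end

theory Submission
  imports Defs
begin

text \<open>
  Let \<open>x\<close> be a real odd self-adjoint unitary with coefficients in the domain algebra, and put
  \<open>k = r + s\<close>.  The pairing with \<open>x\<close> is, up to a power of \<open>kappa\<close>, the integral of the top Clifford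
  coefficient \<open>w\<close> of the trace of \<open>(x - e)(dx)\<^sup>n\<close>.  If it does not vanish, both conditions follow
  (\<open>pairing_constraints\<close>).  The factors \<open>x - e\<close> and \<open>dx\<close> are odd, so \<open>w\<close> has parity \<open>n + 1 - k\<close>, and
  this must be \<open>\<nu>\<close>.  They are also self-adjoint and real, so the involution composed with the real
  structure reverses their order: up to the sign that the graded involution has on the top word, it
  sends \<open>w\<close> to the top coefficient of the trace of \<open>(dx)\<^sup>n (x - e)\<close>.  By the graded trace property
  the integral of the latter is \<open>(-1)\<^sup>n\<close> times the integral of \<open>w\<close>, while by the sign condition it is
  \<open>sgn\<Omega>\<close> times the integral of \<open>w\<close> up to the sign of the involution.  Comparison gives
  \<open>sgn\<Omega>\<close>.

  It remains to find such an \<open>x\<close> with nonzero pairing when the homomorphism on the K-group is nonzero.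
  The K-group is generated by classes of real odd self-adjoint unitaries \<open>x\<close> over \<open>A\<close>, so the
  homomorphism is nonzero on one of them.  The density axiom gives an odd self-adjoint unitary \<open>y\<close>
  over the domain algebra near \<open>x\<close>, but \<open>y\<close> need not be real, and making it real by averaging would
  require a square root of a matrix over the domain algebra.  This is avoided by doubling
  (\<open>doubled_representative\<close>): write \<open>y = a + i b\<close> with real \<open>a\<close> and \<open>b\<close> and replace \<open>i\<close> by a real
  \<open>2 \<times> 2\<close> matrix of square -1.  The result is a real odd self-adjoint unitary over the domain algebra.
  It is close to \<open>x \<oplus> x\<close>, hence homotopic to it (\<open>close_real_osu_homotopic\<close>), so it represents twice
  the class of \<open>x\<close>, on which the homomorphism is nonzero as well.

  Two supporting facts enter.  The real structure and the grading are isometric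
  (\<open>star_homomorphism_contractive\<close>), so that \<open>b\<close> is small and limits of real or homogeneous matrices
  are again such.  And the sum of classes is well defined, because direct sums commute up to stable
  homotopy (\<open>vd_rel_dsum\<close>).
\<close>


section \<open>Star-automorphisms are contractive\<close>

lemma star_isometry: "norm (star a) = norm (a :: 'a::unital_cstar_algebra)"
proof -
  have le: "norm b \<le> norm (star b)" for b :: 'a
  proof (cases "b = 0")
    case False
    have "norm b * norm b \<le> norm (star b) * norm b"
      using cstar_identity[of b] norm_mult_ineq[of "star b" b] by (simp add: power2_eq_square)
    then show ?thesis using False by simp
  qed simp
  from le[of a] le[of "star a"] show ?thesis by (simp add: star_star)
qed

lemma star_scaleR: "star (r *\<^sub>R a) = r *\<^sub>R star (a :: 'a::unital_cstar_algebra)"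
  by (simp add: scaleR_scaleC star_scaleC)

lemma bounded_linear_star: "bounded_linear (star :: 'a::unital_cstar_algebra \<Rightarrow> 'a)"
  by (rule bounded_linear_intro[where K = 1]) (simp_all add: star_add star_scaleR star_isometry)

lemma half_gbinomial_le_one: "\<bar>(1/2 :: real) gchoose k\<bar> \<le> 1"
proof (induction k)
  case (Suc k)
  have "((1/2 :: real) gchoose Suc k) = (1/2 - real k) / real (Suc k) * ((1/2) gchoose k)"
    using gbinomial_mult_1[of "1/2 :: real" k] by (simp add: field_simps)
  moreover have "\<bar>(1/2 - real k) / real (Suc k)\<bar> \<le> 1" by (simp add: field_simps abs_le_iff)
  ultimately show ?case using Suc.IH
    by (metis abs_ge_zero abs_mult mult_le_one)
qed simp

text \<open>The series is the binomial series of \<open>sqrt (1 - x)\<close>; Vandermonde's identity computes its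
  square.\<close>

lemma self_adjoint_sqrt:
  fixes h :: "'a::unital_cstar_algebra"
  assumes sa: "star h = h" and lt: "norm h < 1"
  obtains c where "star c = c" "h * c = c * h" "c * c = 1 - h * h"
proof
  define x where "x = h * h"
  define a where "a n = (-1) ^ n * ((1/2 :: real) gchoose n)" for n
  define f where "f n = a n *\<^sub>R x ^ n" for n
  define c where "c = suminf f"
  have "norm x \<le> norm h * norm h" unfolding x_def by (rule norm_mult_ineq)
  also have "\<dots> \<le> 1 * norm h" using lt by (intro mult_right_mono) simp_all
  finally have nx: "norm x < 1" using lt by simp
  have a_le: "\<bar>a n\<bar> \<le> 1" for n
    using half_gbinomial_le_one[of n] by (simp add: a_def abs_mult)
  have "norm (f n) \<le> norm x ^ n" for n
    using mult_mono[OF a_le[of n] norm_power_ineq[of x n]] by (simp add: f_def)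
  then have sn: "summable (\<lambda>n. norm (f n))"
    using nx by (intro summable_comparison_test[OF _ summable_geometric[of "norm x"]]) auto
  then have sf: "summable f" by (rule summable_norm_cancel)
  have star_pow: "star (x ^ n) = x ^ n" for n
  proof (induction n)
    case (Suc n)
    then show ?case by (simp add: star_mult x_def sa power_commutes)
  qed (simp add: star_one)
  have "star c = suminf (\<lambda>n. star (f n))"
    unfolding c_def by (rule bounded_linear.suminf[OF bounded_linear_star sf])
  moreover have "star (f n) = f n" for n by (simp add: f_def star_scaleR star_pow)
  ultimately show "star c = c" by (simp add: c_def)
  have comm: "h * x ^ n = x ^ n * h" for n
    by (rule power_commuting_commutes[symmetric]) (simp add: x_def mult.assoc)
  have "h * c = suminf (\<lambda>n. h * f n)" unfolding c_def by (rule suminf_mult[OF sf, symmetric])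
  also have "\<dots> = suminf (\<lambda>n. f n * h)" by (simp add: f_def comm)
  also have "\<dots> = c * h" unfolding c_def by (rule suminf_mult2[OF sf, symmetric])
  finally show "h * c = c * h" .
  have coeff: "(\<Sum>i\<le>k. f i * f (k - i)) = ((-1) ^ k * (1 gchoose k)) *\<^sub>R x ^ k" for k
  proof -
    have "(\<Sum>i\<le>k. f i * f (k - i)) = (\<Sum>i\<le>k. (a i * a (k - i)) *\<^sub>R x ^ k)"
      by (rule sum.cong) (simp_all add: f_def flip: power_add)
    also have "\<dots> = (\<Sum>i\<le>k. a i * a (k - i)) *\<^sub>R x ^ k" by (simp add: scaleR_sum_left)
    also have "(\<Sum>i\<le>k. a i * a (k - i)) =
        (-1) ^ k * (\<Sum>i=0..k. ((1/2 :: real) gchoose i) * ((1/2) gchoose (k - i)))"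
      unfolding sum_distrib_left atMost_atLeast0
    proof (rule sum.cong[OF refl])
      fix i assume "i \<in> {0..k}"
      then have "(-1 :: real) ^ k = (-1) ^ i * (-1) ^ (k - i)" by (simp flip: power_add)
      then show "a i * a (k - i) = (-1) ^ k * (((1/2 :: real) gchoose i) * ((1/2) gchoose (k - i)))"
        by (simp add: a_def)
    qed
    also have "\<dots> = (-1) ^ k * (1 gchoose k)" by (simp add: gbinomial_Vandermonde)
    finally show ?thesis .
  qed
  have "(\<lambda>k. ((-1) ^ k * (1 gchoose k)) *\<^sub>R x ^ k) sums (c * c)"
    using Cauchy_product_sums[OF sn sn] unfolding coeff c_def .
  moreover have "(\<lambda>k. ((-1) ^ k * ((1::real) gchoose k)) *\<^sub>R x ^ k) sums
      (\<Sum>k<2. ((-1) ^ k * ((1::real) gchoose k)) *\<^sub>R x ^ k)"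
  proof (rule sums_finite)
    fix k :: nat assume "k \<notin> {..<2}"
    then have "(1::real) gchoose k = 0"
      using binomial_gbinomial[of 1 k, where 'a = real] by (simp add: binomial_eq_0)
    then show "((-1) ^ k * ((1::real) gchoose k)) *\<^sub>R x ^ k = 0" by simp
  qed simp
  ultimately have "c * c = (\<Sum>k<2. ((-1) ^ k * ((1::real) gchoose k)) *\<^sub>R x ^ k)"
    by (rule sums_unique2)
  then show "c * c = 1 - h * h" by (simp add: numeral_2_eq_2 x_def)
qed

text \<open>A self-adjoint \<open>h\<close> of norm below 1 is the real part of the unitary
  \<open>h + i sqrt (1 - h\<^sup>2)\<close>, and unitaries have norm 1 in every C*-algebra.  This bounds \<open>\<theta>\<close> on
  self-adjoint elements without any spectral theory; the C*-identity does the rest.\<close>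

lemma star_homomorphism_contractive:
  fixes \<theta> :: "'a::unital_cstar_algebra \<Rightarrow> 'a"
  assumes add: "\<And>a b. \<theta> (a + b) = \<theta> a + \<theta> b"
    and mult: "\<And>a b. \<theta> (a * b) = \<theta> a * \<theta> b"
    and st: "\<And>a. \<theta> (star a) = star (\<theta> a)"
    and scale: "\<And>r a. \<theta> (r *\<^sub>R a) = r *\<^sub>R \<theta> a"
    and one: "\<theta> 1 = 1"
  shows "norm (\<theta> a) \<le> norm a"
proof -
  have unit_ball: "norm (\<theta> h) \<le> 1" if sa: "star h = h" and lt: "norm h < 1" for h
  proof -
    obtain c where c: "star c = c" "h * c = c * h" "c * c = 1 - h * h"
      using self_adjoint_sqrt[OF sa lt] .
    define u where "u = h + \<i> *\<^sub>C c"
    have star_u: "star u = h - \<i> *\<^sub>C c"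
      by (simp add: u_def star_add star_scaleC sa c complex_vector.scale_minus_left)
    have "star u * u = (h - \<i> *\<^sub>C c) * (h + \<i> *\<^sub>C c)"
      by (subst star_u) (simp add: u_def)
    also have "\<dots> = h * h + c * c"
      by (simp add: algebra_simps mult_scaleC_left mult_scaleC_right scaleC_scaleC c(2)
        complex_vector.scale_minus_left scaleC_one)
    finally have u1: "star u * u = 1" by (simp add: c)
    have "(norm (\<theta> u))\<^sup>2 = norm (\<theta> (star u * u))" by (simp add: mult st cstar_identity)
    then have nu: "norm (\<theta> u) = 1" by (simp add: u1 one power2_eq_1_iff)
       (metis norm_ge_zero not_one_le_zero neg_0_le_iff_le)
    have "2 *\<^sub>R h = u + star u" unfolding star_u by (simp add: u_def scaleR_2)
    then have "2 *\<^sub>R \<theta> h = \<theta> u + star (\<theta> u)" by (metis add st scale)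
    then have "2 * norm (\<theta> h) \<le> 2"
      using norm_triangle_ineq[of "\<theta> u" "star (\<theta> u)"] nu
      by (metis norm_scaleR abs_numeral one_add_one star_isometry)
    then show ?thesis by simp
  qed
  have sa_bound: "norm (\<theta> h) \<le> norm h" if sa: "star h = h" for h
  proof (rule field_le_epsilon)
    fix \<epsilon> :: real assume \<epsilon>: "0 < \<epsilon>"
    define r where "r = norm h + \<epsilon>"
    have r: "0 < r" using \<epsilon> by (simp add: r_def add_nonneg_pos)
    have "norm (\<theta> ((1 / r) *\<^sub>R h)) \<le> 1"
      by (rule unit_ball) (use r \<epsilon> sa in \<open>simp_all add: star_scaleR r_def\<close>)
    then show "norm (\<theta> h) \<le> norm h + \<epsilon>"
      using r by (simp add: scale field_simps r_def)
  qed
  have "(norm (\<theta> a))\<^sup>2 = norm (\<theta> (star a * a))" by (simp add: mult st cstar_identity)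
  also have "\<dots> \<le> norm (star a * a)" by (rule sa_bound) (simp add: star_mult star_star)
  also have "\<dots> = (norm a)\<^sup>2" by (rule cstar_identity)
  finally show ?thesis by (rule power2_le_imp_le) simp
qed

lemma (in graded_cstar_algebra) norm_gr_le: "norm (gr a) \<le> norm a"
proof -
  interpret g: Vector_Spaces.linear "(*\<^sub>C)" "(*\<^sub>C)" gr by (rule gr_linear)
  show ?thesis
    by (rule star_homomorphism_contractive)
      (simp_all add: g.add g.scale gr_mult gr_star gr_one scaleR_scaleC)
qed

lemma (in graded_real_cstar_algebra) rs_add: "rs (a + b) = rs a + rs b"
  using rs_antilinear by (simp add: antilinear_def)

lemma (in graded_real_cstar_algebra) rs_scaleC: "rs (c *\<^sub>C a) = cnj c *\<^sub>C rs a"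
  using rs_antilinear by (simp add: antilinear_def)

lemma (in graded_real_cstar_algebra) rs_one: "rs 1 = 1"
  by (metis rs_rs rs_mult mult.right_neutral mult.left_neutral)

lemma (in graded_real_cstar_algebra) norm_rs_le: "norm (rs a) \<le> norm a"
  by (rule star_homomorphism_contractive)
    (simp_all add: rs_add rs_scaleC rs_mult rs_star rs_one scaleR_scaleC)

section \<open>Signs in the Clifford algebra\<close>

lemma minus_one_power_cong:
  "even a = even b \<Longrightarrow> (-1 :: 'b::ring_1) ^ a = (-1) ^ b"
  by (simp add: minus_one_power_iff)

lemma card_sym_diff_add:
  assumes "finite A" "finite B"
  shows "card (sym_diff A B) + 2 * card (A \<inter> B) = card A + card B"
proof -
  have "card A = card (A - B) + card (A \<inter> B)"
    using assms card_Un_disjoint[of "A - B" "A \<inter> B"] by (simp add: Un_Diff_Int disjoint_iff)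
  moreover have "card B = card (B - A) + card (B \<inter> A)"
    using assms card_Un_disjoint[of "B - A" "B \<inter> A"] by (simp add: Un_Diff_Int disjoint_iff)
  moreover have "card (sym_diff A B) = card (A - B) + card (B - A)"
    using assms by (intro card_Un_disjoint) auto
  ultimately show ?thesis by (simp add: Int_commute)
qed

lemma even_card_sym_diff:
  assumes "finite A" "finite B"
  shows "even (card (sym_diff A B)) = even (card A + card B)"
  using card_sym_diff_add[OF assms] by (metis even_add even_mult_iff even_numeral)

lemma finite_inversion_set: "finite I \<Longrightarrow> finite J \<Longrightarrow> finite {(i, j). i \<in> I \<and> j \<in> J \<and> j < (i::nat)}"
  by (rule finite_subset[of _ "I \<times> J"]) auto

lemma even_inversions_left:
  assumes "finite I" "finite J" "finite K"
  shows "even (inversions (sym_diff I J) K) = even (inversions I K + inversions J K)"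
proof -
  have "{(i, j). i \<in> sym_diff I J \<and> j \<in> K \<and> j < i} =
      sym_diff {(i, j). i \<in> I \<and> j \<in> K \<and> j < i} {(i, j). i \<in> J \<and> j \<in> K \<and> j < i}"
    by auto
  then show ?thesis
    unfolding inversions_def using assms
    by (simp only: even_card_sym_diff finite_inversion_set)
qed

lemma even_inversions_right:
  assumes "finite I" "finite J" "finite K"
  shows "even (inversions K (sym_diff I J)) = even (inversions K I + inversions K J)"
proof -
  have "{(i, j). i \<in> K \<and> j \<in> sym_diff I J \<and> j < i} =
      sym_diff {(i, j). i \<in> K \<and> j \<in> I \<and> j < i} {(i, j). i \<in> K \<and> j \<in> J \<and> j < i}"
    by auto
  then show ?thesis
    unfolding inversions_def using assms
    by (simp only: even_card_sym_diff finite_inversion_set)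
qed

text \<open>Sorting the word \<open>\<rho>\<^sub>I \<rho>\<^sub>J\<close> into \<open>\<rho>\<^sub>J \<rho>\<^sub>I\<close> interchanges every letter of \<open>I\<close> with every
  other letter of \<open>J\<close>; a common letter commutes with itself.\<close>

lemma inversions_swap:
  assumes "finite I" "finite J"
  shows "inversions I J + inversions J I + card (I \<inter> J) = card I * card J"
proof -
  let ?A = "{(i, j). i \<in> I \<and> j \<in> J \<and> j < i}" and ?B = "{(i, j). i \<in> I \<and> j \<in> J \<and> i < j}"
    and ?C = "{(i, j). i \<in> I \<and> j \<in> J \<and> i = j}"
  have fin: "finite ?A" "finite ?B" "finite ?C"
    by (rule finite_subset[of _ "I \<times> J"], use assms in auto)+
  have "bij_betw prod.swap ?B {(i, j). i \<in> J \<and> j \<in> I \<and> j < i}"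
    by (rule bij_betw_byWitness[of _ prod.swap]) auto
  then have "card ?B = inversions J I"
    unfolding inversions_def by (rule bij_betw_same_card)
  moreover have "bij_betw fst ?C (I \<inter> J)"
    by (rule bij_betw_byWitness[of _ "\<lambda>i. (i, i)"]) auto
  then have "card ?C = card (I \<inter> J)" by (rule bij_betw_same_card)
  moreover have "card (I \<times> J) = card ?A + card (?B \<union> ?C)"
  proof -
    have "I \<times> J = ?A \<union> (?B \<union> ?C)" by auto
    moreover have "card (?A \<union> (?B \<union> ?C)) = card ?A + card (?B \<union> ?C)"
      by (rule card_Un_disjoint[OF fin(1) finite_UnI[OF fin(2,3)]]) auto
    ultimately show ?thesis by simp
  qed
  moreover have "card (?B \<union> ?C) = card ?B + card ?C"
    by (rule card_Un_disjoint[OF fin(2,3)]) auto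
  ultimately show ?thesis by (simp add: inversions_def card_cartesian_product)
qed

lemma choose_two_add: "(a + b) choose 2 = (a choose 2) + (b choose 2) + a * (b::nat)"
proof (induction b)
  case (Suc b)
  have "Suc c choose 2 = c + (c choose 2)" for c
    using binomial_Suc_Suc[of c 1] by (simp add: numeral_2_eq_2)
  with Suc show ?case by simp
qed (simp add: binomial_eq_0)

text \<open>\<open>(-1)\<close> to the power \<open>card I choose 2\<close> is the sign of reversing the word \<open>\<rho>\<^sub>I\<close>.  Together with
  \<open>inversions_swap\<close> this says that reversal is an antiautomorphism of the Clifford algebra.\<close>

lemma even_choose_two_sym_diff:
  assumes "finite I" "finite J"
  shows "even (card (sym_diff I J) choose 2) =
    even ((card I choose 2) + (card J choose 2) + card I * card J + card (I \<inter> J))"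
proof -
  let ?k = "card (sym_diff I J)" and ?c = "card (I \<inter> J)"
  have "even ((2 * c) choose 2) = even c" for c :: nat
    unfolding choose_two by (cases c) auto
  moreover have "(?k + 2 * ?c) choose 2 = (card I + card J) choose 2"
    using card_sym_diff_add[OF assms] by simp
  then have "even ((?k choose 2) + ((2 * ?c) choose 2) + ?k * (2 * ?c)) =
      even ((card I choose 2) + (card J choose 2) + card I * card J)"
    unfolding choose_two_add by simp
  ultimately show ?thesis by simp blast
qed

lemma even_card_sym_diff_Int:
  assumes "finite I" "finite J"
  shows "even (card (sym_diff I J \<inter> T)) = even (card (I \<inter> T) + card (J \<inter> T))"
proof -
  have "sym_diff I J \<inter> T = sym_diff (I \<inter> T) (J \<inter> T)" by auto
  then show ?thesis using assms even_card_sym_diff[of "I \<inter> T" "J \<inter> T"] by (simp only:) simp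
qed

lemma sym_diff_involution: "sym_diff (sym_diff I K) K = I" "sym_diff K (sym_diff K I) = I"
  "sym_diff I (sym_diff I K) = K"
  by auto

lemma sum_sym_diff_reindex:
  assumes "K \<subseteq> P"
  shows "(\<Sum>I\<in>Pow P. f I (sym_diff I K)) = (\<Sum>I\<in>Pow P. f (sym_diff I K) I)"
  by (rule sum.reindex_bij_witness[of _ "\<lambda>I. sym_diff I K" "\<lambda>I. sym_diff I K"])
    (use assms in \<open>auto simp only: sym_diff_involution Pow_iff\<close>)


section \<open>The product of matrices over a Clifford algebra\<close>

abbreviation word_sign :: "nat set \<Rightarrow> nat set \<Rightarrow> complex" where
  "word_sign I J \<equiv> (-1) ^ inversions I J"

lemma cl_mult_apply:
  "cl_mult g k x y K = (if K \<subseteq> {..<k} then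
     \<Sum>I\<in>Pow {..<k}. word_sign I (sym_diff I K) *\<^sub>C (x I * (g ^^ card I) (y (sym_diff I K))) else 0)"
proof (cases "K \<subseteq> {..<k}")
  case True
  have "cl_mult g k x y K =
      (\<Sum>I\<in>Pow {..<k}. word_sign I (sym_diff I K) *\<^sub>C (x I * (g ^^ card I) (y (sym_diff I K))))"
    unfolding cl_mult_def
  proof (rule sum.reindex_bij_witness[of _ "\<lambda>I. (I, sym_diff I K)" fst])
    fix q assume "q \<in> {(I, J). I \<subseteq> {..<k} \<and> J \<subseteq> {..<k} \<and> sym_diff I J = K}"
    then obtain I J where q: "q = (I, J)" "sym_diff I J = K" by auto
    then have "sym_diff I K = J" by auto
    then show "(fst q, sym_diff (fst q) K) = q" and "word_sign (fst q) (sym_diff (fst q) K) *\<^sub>C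
        (x (fst q) * (g ^^ card (fst q)) (y (sym_diff (fst q) K))) =
        (case q of (I, J) \<Rightarrow> word_sign I J *\<^sub>C (x I * (g ^^ card I) (y J)))"
      by (simp_all only: q fst_conv prod.case)
  qed (use True in auto)
  then show ?thesis using True by simp
next
  case False
  then have "{(I, J). I \<subseteq> {..<k} \<and> J \<subseteq> {..<k} \<and> sym_diff I J = K} = {}" by auto
  then show ?thesis using False by (simp only: cl_mult_def sum.empty if_False)
qed

lemma mat_mult_apply:
  "mat_mult g m k x y i j K = (if K \<subseteq> {..<k} then
     \<Sum>l<m. \<Sum>I\<in>Pow {..<k}. word_sign I (sym_diff I K) *\<^sub>C (x i l I * (g ^^ card I) (y l j (sym_diff I K)))
     else 0)"
  by (simp add: mat_mult_def cl_mult_apply)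

locale graded_involution =
  fixes g :: "'b::complex_algebra \<Rightarrow> 'b"
  assumes g_linear: "clinear g"
    and g_mult: "g (a * b) = g a * g b"
    and g_g: "g (g a) = a"
begin

lemma g_pow_linear: "clinear (g ^^ p)"
proof (induction p)
  case 0
  then show ?case using complex_vector.linear_id by (simp add: id_def)
next
  case (Suc p)
  then show ?case using Vector_Spaces.linear_compose[OF Suc g_linear] by (simp add: comp_def)
qed

lemma
  shows g_pow_scaleC: "(g ^^ p) (c *\<^sub>C a) = c *\<^sub>C (g ^^ p) a"
    and g_pow_sum: "(g ^^ p) (sum f S) = (\<Sum>s\<in>S. (g ^^ p) (f s))"
    and g_pow_add: "(g ^^ p) (a + b) = (g ^^ p) a + (g ^^ p) b"
    and g_pow_diff: "(g ^^ p) (a - b) = (g ^^ p) a - (g ^^ p) b"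
proof -
  interpret Vector_Spaces.linear "(*\<^sub>C)" "(*\<^sub>C)" "g ^^ p" by (rule g_pow_linear)
  show "(g ^^ p) (c *\<^sub>C a) = c *\<^sub>C (g ^^ p) a" by (rule scale)
  show "(g ^^ p) (sum f S) = (\<Sum>s\<in>S. (g ^^ p) (f s))" by (rule sum)
  show "(g ^^ p) (a + b) = (g ^^ p) a + (g ^^ p) b" by (rule add)
  show "(g ^^ p) (a - b) = (g ^^ p) a - (g ^^ p) b" by (rule diff)
qed

lemma g_pow_zero: "(g ^^ p) 0 = 0"
  using g_pow_scaleC[of p 0 0] by (simp add: complex_vector.scale_zero_left)

lemma g_pow_mult: "(g ^^ p) (a * b) = (g ^^ p) a * (g ^^ p) b"
  by (induction p) (simp_all add: g_mult)

lemma g_pow_parity: "(g ^^ p) a = (if even p then a else g a)"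
  by (induction p) (auto simp: g_g)

lemma cl_mult_sum_left: "cl_mult g k (\<lambda>I. \<Sum>l\<in>S. x l I) y = (\<lambda>K. \<Sum>l\<in>S. cl_mult g k (x l) y K)"
proof
  fix K
  show "cl_mult g k (\<lambda>I. \<Sum>l\<in>S. x l I) y K = (\<Sum>l\<in>S. cl_mult g k (x l) y K)"
    unfolding cl_mult_apply
    by (simp add: sum_distrib_right complex_vector.scale_sum_right sum.swap[of _ S])
qed

lemma cl_mult_sum_right: "cl_mult g k x (\<lambda>I. \<Sum>l\<in>S. y l I) = (\<lambda>K. \<Sum>l\<in>S. cl_mult g k x (y l) K)"
proof
  fix K
  show "cl_mult g k x (\<lambda>I. \<Sum>l\<in>S. y l I) K = (\<Sum>l\<in>S. cl_mult g k x (y l) K)"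
    unfolding cl_mult_apply
    by (simp add: sum_distrib_left complex_vector.scale_sum_right g_pow_sum sum.swap[of _ S])
qed

text \<open>The sign \<open>word_sign\<close> is bimultiplicative for the symmetric difference, hence a 2-cocycle,
  and the powers of the grading are multiplicative in the same sense; both sides are the sum over
  the same triples of words.\<close>

lemma cl_mult_assoc: "cl_mult g k (cl_mult g k x y) z = cl_mult g k x (cl_mult g k y z)"
proof
  fix K
  let ?P = "{..<k}"
  show "cl_mult g k (cl_mult g k x y) z K = cl_mult g k x (cl_mult g k y z) K"
  proof (cases "K \<subseteq> ?P")
    case True
    define F where "F I L = (word_sign L (sym_diff L K) * word_sign I (sym_diff I L)) *\<^sub>C
      (x I * (g ^^ card I) (y (sym_diff I L)) * (g ^^ card L) (z (sym_diff L K)))" for I L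
    have "cl_mult g k (cl_mult g k x y) z K = (\<Sum>L\<in>Pow ?P. \<Sum>I\<in>Pow ?P. F I L)"
      unfolding cl_mult_apply[of _ _ "cl_mult g k x y"] if_P[OF True]
      by (rule sum.cong[OF refl]) (simp add: cl_mult_apply sum_distrib_right
        complex_vector.scale_sum_right F_def mult_scaleC_left scaleC_scaleC)
    also have "\<dots> = (\<Sum>I\<in>Pow ?P. \<Sum>L\<in>Pow ?P. F I L)" by (rule sum.swap)
    also have "\<dots> = cl_mult g k x (cl_mult g k y z) K"
      unfolding cl_mult_apply[of _ _ x] if_P[OF True]
    proof (rule sum.cong[OF refl])
      fix I assume I: "I \<in> Pow ?P"
      have sub: "sym_diff I K \<subseteq> ?P" using I True by auto
      have fI: "finite I" "finite K" using I True by (auto intro: finite_subset)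
      define H where "H M = (word_sign I (sym_diff I K) * word_sign M (sym_diff M (sym_diff I K))) *\<^sub>C
        (x I * (g ^^ card I) (y M * (g ^^ card M) (z (sym_diff M (sym_diff I K)))))" for M
      have "(\<Sum>L\<in>Pow ?P. F I L) = (\<Sum>L\<in>Pow ?P. H (sym_diff I L))"
      proof (rule sum.cong[OF refl])
        fix L assume L: "L \<in> Pow ?P"
        then have fL: "finite L" by (auto intro: finite_subset)
        have eq: "sym_diff (sym_diff I L) (sym_diff I K) = sym_diff L K" by auto
        have "even (card I + card (sym_diff I L)) = even (card L)"
          using even_card_sym_diff[OF fI(1) fL] by auto
        then have gp: "(g ^^ card I) ((g ^^ card (sym_diff I L)) b) = (g ^^ card L) b" for b
          unfolding g_pow_parity by (auto simp: g_g)
        have "even (inversions I (sym_diff I K) + inversions (sym_diff I L) (sym_diff L K)) =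
            even (inversions L (sym_diff L K) + inversions I (sym_diff I L))"
          using fI fL by (simp only: even_add even_inversions_left even_inversions_right
            finite_Un finite_Diff) blast
        then have "word_sign I (sym_diff I K) * word_sign (sym_diff I L) (sym_diff L K) =
            word_sign L (sym_diff L K) * word_sign I (sym_diff I L)"
          unfolding power_add[symmetric] by (rule minus_one_power_cong)
        then show "F I L = H (sym_diff I L)"
          unfolding H_def F_def eq g_pow_mult gp by (simp only: mult.assoc)
      qed
      also have "\<dots> = (\<Sum>M\<in>Pow ?P. H M)"
        by (rule sum.reindex_bij_witness[of _ "\<lambda>L. sym_diff I L" "\<lambda>L. sym_diff I L"])
          (use I in \<open>auto simp only: sym_diff_involution Pow_iff\<close>)
      also have "\<dots> = word_sign I (sym_diff I K) *\<^sub>C (x I * (g ^^ card I) (cl_mult g k y z (sym_diff I K)))"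
        unfolding cl_mult_apply[of _ _ y] if_P[OF sub]
        by (simp only: g_pow_sum sum_distrib_left complex_vector.scale_sum_right
          H_def g_pow_scaleC mult_scaleC_right scaleC_scaleC)
      finally show "(\<Sum>L\<in>Pow ?P. F I L) =
        word_sign I (sym_diff I K) *\<^sub>C (x I * (g ^^ card I) (cl_mult g k y z (sym_diff I K)))" .
    qed
    finally show ?thesis .
  qed (simp add: cl_mult_apply)
qed

lemma mat_mult_assoc:
  "mat_mult g m k (mat_mult g m k x y) z = mat_mult g m k x (mat_mult g m k y z)"
proof (intro ext)
  fix i j K
  have "mat_mult g m k (mat_mult g m k x y) z i j K =
      (\<Sum>l<m. \<Sum>l'<m. cl_mult g k (cl_mult g k (x i l') (y l' l)) (z l j) K)"
    by (simp add: mat_mult_def cl_mult_sum_left)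
  also have "\<dots> = (\<Sum>l'<m. \<Sum>l<m. cl_mult g k (x i l') (cl_mult g k (y l' l) (z l j)) K)"
    unfolding cl_mult_assoc by (rule sum.swap)
  also have "\<dots> = mat_mult g m k x (mat_mult g m k y z) i j K"
    by (simp add: mat_mult_def cl_mult_sum_right)
  finally show "mat_mult g m k (mat_mult g m k x y) z i j K =
    mat_mult g m k x (mat_mult g m k y z) i j K" .
qed

end

section \<open>Homogeneous matrices and their adjoints\<close>

context graded_involution
begin

text \<open>The number \<open>p\<close> is the total parity: letters of the Clifford algebra are odd, so the coefficient of
  a word with \<open>c\<close> letters has parity \<open>p + c\<close>.  On homogeneous matrices the grading automorphism in
  the product becomes a sign.\<close>

definition homogeneous :: "nat \<Rightarrow> 'b clmat \<Rightarrow> bool" where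
  "homogeneous p x \<longleftrightarrow> (\<forall>i j I. g (x i j I) = (-1) ^ (p + card I) *\<^sub>C x i j I)"

lemma homogeneousD: "homogeneous p x \<Longrightarrow> g (x i j I) = (-1) ^ (p + card I) *\<^sub>C x i j I"
  by (simp add: homogeneous_def)

lemma homogeneous_cong: "even p = even q \<Longrightarrow> homogeneous p = homogeneous q"
  by (simp add: homogeneous_def fun_eq_iff minus_one_power_iff)

lemma g_pow_homogeneous:
  assumes "homogeneous p x"
  shows "(g ^^ n) (x i j I) = (-1) ^ (n * (p + card I)) *\<^sub>C x i j I"
  by (simp only: g_pow_parity homogeneousD[OF assms] minus_one_power_iff[where 'a = complex])
    (auto simp: scaleC_one)

lemma mat_mult_homogeneous_apply:
  assumes "homogeneous q y"
  shows "mat_mult g m k x y i j K = (if K \<subseteq> {..<k} then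
     \<Sum>l<m. \<Sum>I\<in>Pow {..<k}. (-1) ^ (inversions I (sym_diff I K) + card I * (q + card (sym_diff I K)))
       *\<^sub>C (x i l I * y l j (sym_diff I K))
     else 0)"
  unfolding mat_mult_apply g_pow_homogeneous[OF assms]
  by (simp only: mult_scaleC_right scaleC_scaleC power_add)

lemma homogeneous_mat_mult:
  assumes x: "homogeneous p x" and y: "homogeneous q y"
  shows "homogeneous (p + q) (mat_mult g m k x y)"
  unfolding homogeneous_def
proof (intro allI)
  fix i j K
  show "g (mat_mult g m k x y i j K) = (-1) ^ (p + q + card K) *\<^sub>C mat_mult g m k x y i j K"
  proof (cases "K \<subseteq> {..<k}")
    case K: True
    let ?s = "\<lambda>I. inversions I (sym_diff I K) + card I * (q + card (sym_diff I K))"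
    have "g (mat_mult g m k x y i j K) =
        (\<Sum>l<m. \<Sum>I\<in>Pow {..<k}. (-1) ^ ?s I *\<^sub>C g (x i l I * y l j (sym_diff I K)))"
      unfolding mat_mult_homogeneous_apply[OF y] if_P[OF K]
      by (simp only: g_pow_sum[of 1, simplified] g_pow_scaleC[of 1, simplified])
    also have "\<dots> = (\<Sum>l<m. \<Sum>I\<in>Pow {..<k}. (-1) ^ (p + q + card K) *\<^sub>C
        (-1) ^ ?s I *\<^sub>C (x i l I * y l j (sym_diff I K)))"
    proof (intro sum.cong refl)
      fix l I assume I: "I \<in> Pow {..<k}"
      then have "finite I" "finite K" using K by (auto intro: finite_subset)
      then have "even (p + card I + (q + card (sym_diff I K))) = even (p + q + card K)"
        using even_card_sym_diff[of I K] by auto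
      then have "(-1 :: complex) ^ (p + card I) * (-1) ^ (q + card (sym_diff I K)) = (-1) ^ (p + q + card K)"
        unfolding power_add[symmetric] by (rule minus_one_power_cong)
      then show "(-1) ^ ?s I *\<^sub>C g (x i l I * y l j (sym_diff I K)) =
          (-1) ^ (p + q + card K) *\<^sub>C (-1) ^ ?s I *\<^sub>C (x i l I * y l j (sym_diff I K))"
        by (simp only: g_mult homogeneousD[OF x] homogeneousD[OF y] mult_scaleC_left
          mult_scaleC_right scaleC_scaleC) (simp only: mult_ac)
    qed
    finally show ?thesis
      unfolding mat_mult_homogeneous_apply[OF y] if_P[OF K]
      by (simp only: complex_vector.scale_sum_right)
  qed (use g_pow_zero[of 1] in \<open>simp add: mat_mult_apply complex_vector.scale_zero_right\<close>)
qed

text \<open>The graded involution \<open>(a \<otimes> \<rho>\<^sub>I)\<^sup>* = (-1)\<^bsup>|a||I|\<^esup> \<sigma> a \<otimes> \<rho>\<^sub>I\<^sup>*\<close>, composed with the change of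
  sign of the letters in \<open>T\<close>, with \<open>|a| = p + |I|\<close> for a matrix of total parity \<open>p\<close>.  As a relation
  between coefficients it can be used for an involution \<open>\<sigma>\<close> that is compatible with the grading only
  on the elements at hand; this is the situation in \<open>\<Omega>\<close>.\<close>

definition graded_adjoint :: "nat set \<Rightarrow> ('b \<Rightarrow> 'b) \<Rightarrow> nat \<Rightarrow> 'b clmat \<Rightarrow> 'b clmat \<Rightarrow> bool" where
  "graded_adjoint T \<sigma> p x x' \<longleftrightarrow> (\<forall>i j I. finite I \<longrightarrow> \<sigma> (x i j I) =
     (-1) ^ (card (I \<inter> T) + (card I choose 2) + Suc p * card I) *\<^sub>C x' j i I)"

lemma graded_adjointD: "graded_adjoint T \<sigma> p x x' \<Longrightarrow> finite I \<Longrightarrow>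
  \<sigma> (x i j I) = (-1) ^ (card (I \<inter> T) + (card I choose 2) + Suc p * card I) *\<^sub>C x' j i I"
  by (simp add: graded_adjoint_def)

lemma graded_adjoint_cong: "even p = even q \<Longrightarrow> graded_adjoint T \<sigma> p = graded_adjoint T \<sigma> q"
  by (simp add: graded_adjoint_def fun_eq_iff minus_one_power_iff)

lemma additive_sign:
  fixes \<sigma> :: "'b \<Rightarrow> 'b"
  assumes "\<And>a b. \<sigma> (a + b) = \<sigma> a + \<sigma> b"
  shows "\<sigma> ((-1) ^ n *\<^sub>C a) = (-1) ^ n *\<^sub>C \<sigma> a"
proof -
  interpret additive \<sigma> by standard (rule assms)
  show ?thesis by (simp add: minus_one_power_iff complex_vector.scale_minus_left scaleC_one minus)
qed

lemma graded_adjoint_mat_mult: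
  assumes add: "\<And>a b. \<sigma> (a + b) = \<sigma> a + \<sigma> b" and mult: "\<And>a b. \<sigma> (a * b) = \<sigma> b * \<sigma> a"
    and x: "graded_adjoint T \<sigma> p x x'" and y: "graded_adjoint T \<sigma> q y y'"
    and hy: "homogeneous q y" and hx': "homogeneous p x'"
  shows "graded_adjoint T \<sigma> (p + q) (mat_mult g m k x y) (mat_mult g m k y' x')"
  unfolding graded_adjoint_def
proof (intro allI impI)
  fix i j and K :: "nat set" assume fK: "finite K"
  interpret additive \<sigma> by standard (rule add)
  let ?\<eta> = "\<lambda>p I. card (I \<inter> T) + (card I choose 2) + Suc p * card I"
  show "\<sigma> (mat_mult g m k x y i j K) = (-1) ^ ?\<eta> (p + q) K *\<^sub>C mat_mult g m k y' x' j i K"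
  proof (cases "K \<subseteq> {..<k}")
    case K: True
    let ?s = "\<lambda>p I J. inversions I J + card I * (p + card J)"
    have "\<sigma> (mat_mult g m k x y i j K) = (\<Sum>l<m. \<Sum>I\<in>Pow {..<k}.
        (-1) ^ ?s q I (sym_diff I K) *\<^sub>C (\<sigma> (y l j (sym_diff I K)) * \<sigma> (x i l I)))"
      unfolding mat_mult_homogeneous_apply[OF hy] if_P[OF K] sum additive_sign[OF add] mult ..
    also have "\<dots> = (\<Sum>l<m. \<Sum>I\<in>Pow {..<k}. (-1) ^ ?\<eta> (p + q) K *\<^sub>C
        (-1) ^ ?s p (sym_diff I K) I *\<^sub>C (y' j l (sym_diff I K) * x' l i I))"
    proof (intro sum.cong refl)
      fix l I assume I: "I \<in> Pow {..<k}"
      define J where "J = sym_diff I K"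
      have KJ: "K = sym_diff I J" by (auto simp: J_def)
      have fI: "finite I" using I by (auto intro: finite_subset)
      then have fJ: "finite J" using fK by (simp add: J_def)
      have "even (?s q I J + ?\<eta> q J + ?\<eta> p I) = even (?\<eta> (p + q) K + ?s p J I)"
        using inversions_swap[OF fI fJ, THEN arg_cong[of _ _ even]]
        unfolding KJ even_add even_mult_iff even_Suc even_card_sym_diff[OF fI fJ]
          even_choose_two_sym_diff[OF fI fJ] even_card_sym_diff_Int[OF fI fJ]
        by argo
      then have "(-1 :: complex) ^ ?s q I J * (-1) ^ ?\<eta> q J * (-1) ^ ?\<eta> p I =
          (-1) ^ ?\<eta> (p + q) K * (-1) ^ ?s p J I"
        unfolding power_add[symmetric] by (rule minus_one_power_cong)
      then have "(-1) ^ ?s q I J *\<^sub>C (\<sigma> (y l j J) * \<sigma> (x i l I)) =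
          (-1) ^ ?\<eta> (p + q) K *\<^sub>C (-1) ^ ?s p J I *\<^sub>C (y' j l J * x' l i I)"
        by (simp only: graded_adjointD[OF x fI] graded_adjointD[OF y fJ] mult_scaleC_left
          mult_scaleC_right scaleC_scaleC) (simp only: mult_ac)
      then show "(-1) ^ ?s q I (sym_diff I K) *\<^sub>C (\<sigma> (y l j (sym_diff I K)) * \<sigma> (x i l I)) =
          (-1) ^ ?\<eta> (p + q) K *\<^sub>C (-1) ^ ?s p (sym_diff I K) I *\<^sub>C (y' j l (sym_diff I K) * x' l i I)"
        by (simp only: J_def)
    qed
    also have "\<dots> = (\<Sum>l<m. \<Sum>I\<in>Pow {..<k}. (-1) ^ ?\<eta> (p + q) K *\<^sub>C
        (-1) ^ ?s p I (sym_diff I K) *\<^sub>C (y' j l I * x' l i (sym_diff I K)))"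
      by (rule sum.cong[OF refl], rule sum_sym_diff_reindex[OF K, symmetric])
    finally show ?thesis
      unfolding mat_mult_homogeneous_apply[OF hx'] if_P[OF K]
      by (simp only: complex_vector.scale_sum_right)
  qed (simp add: mat_mult_apply complex_vector.scale_zero_right zero)
qed

lemma mat_mult_add_left:
  "mat_mult g m k (\<lambda>i j I. x i j I + y i j I) z =
    (\<lambda>i j I. mat_mult g m k x z i j I + mat_mult g m k y z i j I)"
  by (intro ext) (simp add: mat_mult_apply distrib_right scaleC_add_right sum.distrib)

lemma mat_mult_add_right:
  "mat_mult g m k x (\<lambda>i j I. y i j I + z i j I) =
    (\<lambda>i j I. mat_mult g m k x y i j I + mat_mult g m k x z i j I)"
  by (intro ext) (simp add: mat_mult_apply distrib_left g_pow_add scaleC_add_right sum.distrib)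

lemma mat_mult_diff_left:
  "mat_mult g m k (\<lambda>i j I. x i j I - y i j I) z =
    (\<lambda>i j I. mat_mult g m k x z i j I - mat_mult g m k y z i j I)"
  by (intro ext) (simp add: mat_mult_apply left_diff_distrib complex_vector.scale_right_diff_distrib
    sum_subtractf)

lemma mat_mult_diff_right:
  "mat_mult g m k x (\<lambda>i j I. y i j I - z i j I) =
    (\<lambda>i j I. mat_mult g m k x y i j I - mat_mult g m k x z i j I)"
  by (intro ext) (simp add: mat_mult_apply right_diff_distrib g_pow_diff
    complex_vector.scale_right_diff_distrib sum_subtractf)

lemma mat_mult_scaleC_left:
  "mat_mult g m k (\<lambda>i j I. c *\<^sub>C x i j I) y = (\<lambda>i j I. c *\<^sub>C mat_mult g m k x y i j I)"
  by (intro ext) (simp add: mat_mult_apply mult_scaleC_left scaleC_scaleC mult.commute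
    complex_vector.scale_sum_right complex_vector.scale_zero_right)

lemma mat_mult_scaleC_right:
  "mat_mult g m k x (\<lambda>i j I. c *\<^sub>C y i j I) = (\<lambda>i j I. c *\<^sub>C mat_mult g m k x y i j I)"
  by (intro ext) (simp add: mat_mult_apply g_pow_scaleC mult_scaleC_right scaleC_scaleC mult.commute
    complex_vector.scale_sum_right complex_vector.scale_zero_right)

end

lemma clmat_mat_mult:
  assumes "x \<in> clmat m k UNIV" "y \<in> clmat m k UNIV" "graded_involution g"
  shows "mat_mult g m k x y \<in> clmat m k UNIV"
proof -
  interpret graded_involution g by fact
  have "mat_mult g m k x y i j K = 0" if "\<not> (i < m \<and> j < m)" for i j K
    using that assms by (auto simp: mat_mult_apply clmat_def g_pow_zero complex_vector.scale_zero_right)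
  then show ?thesis by (auto simp: clmat_def cl_def fun_eq_iff mat_mult_apply)
qed

sublocale graded_cstar_algebra \<subseteq> A: graded_involution gr
  by (rule graded_involution.intro) (rule gr_linear gr_mult gr_gr)+

lemma clmat_iff: "x \<in> clmat m k S \<longleftrightarrow>
    (\<forall>i<m. \<forall>j<m. \<forall>I\<subseteq>{..<k}. x i j I \<in> S) \<and>
    (\<forall>i j I. \<not> (i < m \<and> j < m \<and> I \<subseteq> {..<k}) \<longrightarrow> x i j I = 0)"
  (is "?l = ?r")
proof
  show "?r" if ?l
    using that unfolding clmat_def cl_def fun_eq_iff by (intro conjI allI impI) blast+
  show "?l" if ?r
    using that unfolding clmat_def cl_def fun_eq_iff by (intro CollectI conjI allI impI) blast+
qed

context graded_cstar_algebra
begin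

lemma cl_mult_one_left:
  assumes "\<And>K. \<not> K \<subseteq> {..<k} \<Longrightarrow> x K = 0"
  shows "cl_mult gr k cl_one x = x"
proof
  fix K
  show "cl_mult gr k cl_one x K = x K"
  proof (cases "K \<subseteq> {..<k}")
    case True
    have "cl_mult gr k cl_one x K = (\<Sum>I\<in>Pow {..<k}. if I = {} then x K else 0)"
      unfolding cl_mult_apply if_P[OF True]
      by (rule sum.cong[OF refl]) (simp add: cl_one_def inversions_def scaleC_one
        complex_vector.scale_zero_right)
    then show ?thesis by simp
  qed (simp add: cl_mult_apply assms)
qed

lemma cl_mult_one_right:
  assumes "\<And>K. \<not> K \<subseteq> {..<k} \<Longrightarrow> x K = 0"
  shows "cl_mult gr k x cl_one = x"
proof
  fix K
  have gr_pow_one: "(gr ^^ p) 1 = 1" for p by (simp add: A.g_pow_parity gr_one)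
  show "cl_mult gr k x cl_one K = x K"
  proof (cases "K \<subseteq> {..<k}")
    case True
    have "cl_mult gr k x cl_one K = (\<Sum>I\<in>Pow {..<k}. if I = K then x K else 0)"
      unfolding cl_mult_apply if_P[OF True]
    proof (rule sum.cong[OF refl])
      fix I
      have "sym_diff I K = {} \<longleftrightarrow> I = K" by auto
      then show "word_sign I (sym_diff I K) *\<^sub>C (x I * (gr ^^ card I) (cl_one (sym_diff I K))) =
          (if I = K then x K else 0)"
        by (cases "I = K") (simp_all only: cl_one_def if_True if_False A.g_pow_zero,
          simp_all add: gr_pow_one inversions_def scaleC_one complex_vector.scale_zero_right)
    qed
    then show ?thesis using True by simp
  qed (simp add: cl_mult_apply assms)
qed

lemma cl_mult_zero_left: "cl_mult gr k (\<lambda>I. 0) x = (\<lambda>I. 0)"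
  by (simp add: cl_mult_apply fun_eq_iff complex_vector.scale_zero_right)

lemma cl_mult_zero_right: "cl_mult gr k x (\<lambda>I. 0) = (\<lambda>I. 0)"
  by (simp add: cl_mult_apply fun_eq_iff A.g_pow_zero complex_vector.scale_zero_right)

lemma mat_mult_one_left:
  assumes "x \<in> clmat m k UNIV"
  shows "mat_mult gr m k (mat_diag m cl_one) x = x"
proof (intro ext)
  fix i j K
  have x0: "\<not> K \<subseteq> {..<k} \<Longrightarrow> x i j K = 0" for i j K using assms by (auto simp: clmat_iff)
  have "mat_mult gr m k (mat_diag m cl_one) x i j K =
      (\<Sum>l<m. if l = i then x i j K else 0)"
    unfolding mat_mult_def
    by (rule sum.cong[OF refl])
      (auto simp: mat_diag_def cl_mult_one_left[OF x0] cl_mult_zero_left)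
  also have "\<dots> = x i j K" using assms by (auto simp: clmat_iff)
  finally show "mat_mult gr m k (mat_diag m cl_one) x i j K = x i j K" .
qed

lemma mat_mult_one_right:
  assumes "x \<in> clmat m k UNIV"
  shows "mat_mult gr m k x (mat_diag m cl_one) = x"
proof (intro ext)
  fix i j K
  have x0: "\<not> K \<subseteq> {..<k} \<Longrightarrow> x i j K = 0" for i j K using assms by (auto simp: clmat_iff)
  have "mat_mult gr m k x (mat_diag m cl_one) i j K =
      (\<Sum>l<m. if l = j then x i j K else 0)"
    unfolding mat_mult_def
    by (rule sum.cong[OF refl])
      (auto simp: mat_diag_def cl_mult_one_right[OF x0] cl_mult_zero_right)
  also have "\<dots> = x i j K" using assms by (auto simp: clmat_iff)
  finally show "mat_mult gr m k x (mat_diag m cl_one) i j K = x i j K" .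
qed

end

section \<open>Odd self-adjoint unitaries that are close are homotopic\<close>

lemma bounded_linear_scaleC: "bounded_linear (\<lambda>a :: 'a::unital_cstar_algebra. c *\<^sub>C a)"
  by (rule bounded_linear_intro[where K = "cmod c"])
    (simp_all add: scaleC_add_right scaleR_scaleC scaleC_scaleC norm_scaleC mult.commute)

lemma scaleC_sign_cancel: "(-1) ^ n *\<^sub>C (-1) ^ n *\<^sub>C a = (a :: 'a::complex_algebra)"
  by (simp add: scaleC_scaleC scaleC_one flip: power_add)

lemma scaleC_sign_eq_iff: "(-1) ^ n *\<^sub>C a = b \<longleftrightarrow> a = (-1) ^ n *\<^sub>C (b :: 'a::complex_algebra)"
  by (metis scaleC_sign_cancel)

context graded_cstar_algebra
begin

lemma bounded_linear_gr_pow: "bounded_linear (gr ^^ p)"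
proof (rule bounded_linear_intro[where K = 1])
  fix a b r
  show "(gr ^^ p) (a + b) = (gr ^^ p) a + (gr ^^ p) b" by (rule A.g_pow_add)
  show "(gr ^^ p) (r *\<^sub>R a) = r *\<^sub>R (gr ^^ p) a" by (simp add: scaleR_scaleC A.g_pow_scaleC)
  show "norm ((gr ^^ p) a) \<le> norm a * 1" by (simp add: A.g_pow_parity norm_gr_le)
qed

lemma norm_gr_pow_le: "norm ((gr ^^ p) a) \<le> norm a"
  by (simp add: A.g_pow_parity norm_gr_le)

lemma gr_pow_star: "(gr ^^ p) (star a) = star ((gr ^^ p) a)"
  by (simp add: A.g_pow_parity gr_star)

lemma mat_mult_scaleR_left:
  "mat_mult gr m k (\<lambda>i j I. c *\<^sub>R x i j I) y = (\<lambda>i j I. c *\<^sub>R mat_mult gr m k x y i j I)"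
  by (simp only: scaleR_scaleC A.mat_mult_scaleC_left)

lemma mat_mult_scaleR_right:
  "mat_mult gr m k x (\<lambda>i j I. c *\<^sub>R y i j I) = (\<lambda>i j I. c *\<^sub>R mat_mult gr m k x y i j I)"
  by (simp only: scaleR_scaleC A.mat_mult_scaleC_right)

text \<open>A coefficient of a product is a sum of \<open>m 2\<^sup>k\<close> products of coefficients.\<close>

lemma norm_mat_mult_le:
  assumes x: "\<And>i j I. norm (x i j I) \<le> \<alpha>" and y: "\<And>i j I. norm (y i j I) \<le> \<beta>"
  shows "norm (mat_mult gr m k x y i j K) \<le> real m * 2 ^ k * (\<alpha> * \<beta>)"
proof -
  have \<alpha>: "0 \<le> \<alpha>" and \<beta>: "0 \<le> \<beta>" using x y by (meson norm_ge_zero order_trans)+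
  show ?thesis
  proof (cases "K \<subseteq> {..<k}")
    case True
    have "norm (mat_mult gr m k x y i j K) \<le> (\<Sum>l<m. \<Sum>I\<in>Pow {..<k}. \<alpha> * \<beta>)"
      unfolding mat_mult_apply if_P[OF True]
    proof (intro sum_norm_le)
      fix l I
      have "norm (x i l I * (gr ^^ card I) (y l j (sym_diff I K))) \<le>
          norm (x i l I) * norm ((gr ^^ card I) (y l j (sym_diff I K)))"
        by (rule norm_mult_ineq)
      also have "\<dots> \<le> \<alpha> * \<beta>"
        by (rule mult_mono[OF x order_trans[OF norm_gr_pow_le y]]) (simp_all add: \<alpha>)
      finally show "norm (word_sign I (sym_diff I K) *\<^sub>C
          (x i l I * (gr ^^ card I) (y l j (sym_diff I K)))) \<le> \<alpha> * \<beta>"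
        by (simp add: norm_scaleC norm_power)
    qed
    then show ?thesis by (simp add: card_Pow mult.assoc)
  next
    case False
    then have "mat_mult gr m k x y i j K = 0" by (simp only: mat_mult_apply if_False)
    then show ?thesis using \<alpha> \<beta> by simp
  qed
qed

lemma continuous_on_mat_mult:
  assumes "\<And>i j I. continuous_on S (\<lambda>t. x t i j I)" "\<And>i j I. continuous_on S (\<lambda>t. y t i j I)"
  shows "continuous_on S (\<lambda>t. mat_mult gr m k (x t) (y t) i j K)"
  unfolding mat_mult_apply
  by (cases "K \<subseteq> {..<k}")
    (auto intro!: continuous_intros assms bounded_linear.continuous_on[OF bounded_linear_scaleC]
      bounded_linear.continuous_on[OF bounded_linear_gr_pow])

lemma sums_mat_mult_right:
  assumes "\<And>i j I. (\<lambda>n. f n i j I) sums F i j I"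
  shows "(\<lambda>n. mat_mult gr m k x (f n) i j K) sums mat_mult gr m k x F i j K"
  unfolding mat_mult_apply
  by (cases "K \<subseteq> {..<k}")
    (auto intro!: sums_sum sums_mult assms bounded_linear.sums[OF bounded_linear_scaleC]
      bounded_linear.sums[OF bounded_linear_gr_pow])

lemma sums_mat_mult_left:
  assumes "\<And>i j I. (\<lambda>n. f n i j I) sums F i j I"
  shows "(\<lambda>n. mat_mult gr m k (f n) x i j K) sums mat_mult gr m k F x i j K"
  unfolding mat_mult_apply
  by (cases "K \<subseteq> {..<k}")
    (auto intro!: sums_sum sums_mult2 assms bounded_linear.sums[OF bounded_linear_scaleC])

text \<open>In the involution of an odd matrix the grading automorphism contributes the sign with exponent
  \<open>|I| (|I| + 1)\<close>, which is even.\<close>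

lemma osu_iff:
  "x \<in> osu gr m k S \<longleftrightarrow> x \<in> clmat m k S \<and> A.homogeneous 1 x \<and> A.graded_adjoint {} star 1 x x \<and>
    mat_mult gr m k x x = mat_diag m cl_one"
proof -
  have grading: "(\<forall>i j. cl_grading gr (x i j) = (\<lambda>I. - x i j I)) \<longleftrightarrow> A.homogeneous 1 x"
  proof -
    have "(-1) ^ n *\<^sub>C a = - b \<longleftrightarrow> a = (-1) ^ (1 + n) *\<^sub>C b" for n and a b :: 'a
      unfolding scaleC_sign_eq_iff by (simp add: complex_vector.scale_minus_left)
    then show ?thesis by (simp only: A.homogeneous_def cl_grading_def fun_eq_iff)
  qed
  have star: "(\<forall>i j. cl_star gr (x j i) = x i j) \<longleftrightarrow> A.graded_adjoint {} star 1 x x"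
    if x: "x \<in> clmat m k S" and hom: "A.homogeneous 1 x"
  proof -
    have 1: "(gr ^^ card I) (star (x j i I)) = star (x j i I)" for i j I
      unfolding gr_pow_star A.g_pow_homogeneous[OF hom] by (simp add: scaleC_one)
    have 2: "x i j I = 0" if "infinite I" for i j I
    proof -
      have "\<not> I \<subseteq> {..<k}" using that finite_subset by blast
      then show ?thesis using x by (simp add: clmat_iff)
    qed
    have 3: "(-1 :: complex) ^ (card (I \<inter> {}) + (card I choose 2) + Suc 1 * card I) =
      (-1) ^ (card I choose 2)" for I :: "nat set"
      by (rule minus_one_power_cong) simp
    have 4: "star (0 :: 'a) = 0" using star_add[of "0 :: 'a" 0] by simp
    have "(\<forall>i j. cl_star gr (x j i) = x i j) \<longleftrightarrow>
        (\<forall>i j I. star (x j i I) = (-1) ^ (card I choose 2) *\<^sub>C x i j I)"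
      by (simp only: cl_star_def fun_eq_iff 1 scaleC_sign_eq_iff)
    also have "\<dots> \<longleftrightarrow> A.graded_adjoint {} star 1 x x"
      unfolding A.graded_adjoint_def 3 by (metis 2 4 complex_vector.scale_zero_right)
    finally show ?thesis .
  qed
  show ?thesis unfolding osu_def using grading star by blast
qed

end

context graded_real_cstar_algebra
begin

lemma bounded_linear_rs: "bounded_linear rs"
  by (rule bounded_linear_intro[where K = 1])
    (simp_all add: rs_add rs_scaleC scaleR_scaleC norm_rs_le)

lemma rs_sign: "rs ((-1) ^ n *\<^sub>C a) = (-1) ^ n *\<^sub>C rs a"
  by (simp add: rs_scaleC)

text \<open>The linear conditions in the definition of a real odd self-adjoint unitary, for either parity.
  They pass to products of commuting factors, to palindromic products and to limits, and so to all
  matrices that occur along the homotopy.\<close>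

definition real_self_adjoint :: "nat \<Rightarrow> nat \<Rightarrow> nat \<Rightarrow> 'a clmat \<Rightarrow> bool" where
  "real_self_adjoint r s p x \<longleftrightarrow> A.homogeneous p x \<and> A.graded_adjoint {} star p x x \<and>
    (\<forall>i j I. rs (x i j I) = (-1) ^ card (I \<inter> {r..<r+s}) *\<^sub>C x i j I)"

lemma real_osu_iff:
  "x \<in> real_osu gr rs r s m S \<longleftrightarrow> x \<in> clmat m (r + s) S \<and> real_self_adjoint r s 1 x \<and>
    mat_mult gr m (r + s) x x = mat_diag m cl_one"
proof -
  have "(\<forall>i j. cl_real rs r s (x i j) = x i j) \<longleftrightarrow>
      (\<forall>i j I. rs (x i j I) = (-1) ^ card (I \<inter> {r..<r+s}) *\<^sub>C x i j I)"
    by (simp only: cl_real_def fun_eq_iff scaleC_sign_eq_iff)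
  then show ?thesis unfolding real_osu_def osu_iff real_self_adjoint_def by blast
qed

lemma real_self_adjoint_cong:
  "even p = even q \<Longrightarrow> real_self_adjoint r s p x \<longleftrightarrow> real_self_adjoint r s q x"
  unfolding real_self_adjoint_def
  by (simp only: A.homogeneous_cong[of p q] A.graded_adjoint_cong[of p q])

lemma rs_gr_pow: "rs ((gr ^^ p) a) = (gr ^^ p) (rs a)"
  by (simp add: A.g_pow_parity rs_gr)

lemma cl_real_mat_mult:
  "cl_real rs r s (mat_mult gr m k x y i j) =
    mat_mult gr m k (\<lambda>i j. cl_real rs r s (x i j)) (\<lambda>i j. cl_real rs r s (y i j)) i j"
proof
  fix K
  interpret additive rs by standard (rule rs_add)
  let ?\<chi> = "\<lambda>I. (-1 :: complex) ^ card (I \<inter> {r..<r+s})"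
  show "cl_real rs r s (mat_mult gr m k x y i j) K =
    mat_mult gr m k (\<lambda>i j. cl_real rs r s (x i j)) (\<lambda>i j. cl_real rs r s (y i j)) i j K"
  proof (cases "K \<subseteq> {..<k}")
    case K: True
    have "cl_real rs r s (mat_mult gr m k x y i j) K = (\<Sum>l<m. \<Sum>I\<in>Pow {..<k}.
        ?\<chi> K *\<^sub>C word_sign I (sym_diff I K) *\<^sub>C (rs (x i l I) * (gr ^^ card I) (rs (y l j (sym_diff I K)))))"
      unfolding cl_real_def mat_mult_apply if_P[OF K] sum rs_sign rs_mult rs_gr_pow
        complex_vector.scale_sum_right ..
    also have "\<dots> = mat_mult gr m k (\<lambda>i j. cl_real rs r s (x i j)) (\<lambda>i j. cl_real rs r s (y i j)) i j K"
      unfolding mat_mult_apply if_P[OF K]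
    proof (intro sum.cong refl)
      fix l I assume I: "I \<in> Pow {..<k}"
      then have "finite I" "finite K" using K by (auto intro: finite_subset)
      then have "even (card (K \<inter> {r..<r+s})) =
          even (card (I \<inter> {r..<r+s}) + card (sym_diff I K \<inter> {r..<r+s}))"
        using even_card_sym_diff_Int[of I K "{r..<r+s}"] by auto
      then have "?\<chi> K = ?\<chi> I * ?\<chi> (sym_diff I K)"
        unfolding power_add[symmetric] by (rule minus_one_power_cong)
      then show "?\<chi> K *\<^sub>C word_sign I (sym_diff I K) *\<^sub>C
          (rs (x i l I) * (gr ^^ card I) (rs (y l j (sym_diff I K)))) =
          word_sign I (sym_diff I K) *\<^sub>C (cl_real rs r s (x i l) I *
            (gr ^^ card I) (cl_real rs r s (y l j) (sym_diff I K)))"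
        by (simp only: cl_real_def A.g_pow_scaleC mult_scaleC_left mult_scaleC_right scaleC_scaleC)
          (simp only: mult_ac)
    qed
    finally show ?thesis .
  qed (simp add: cl_real_def mat_mult_apply zero complex_vector.scale_zero_right)
qed

lemma rs_mat_mult:
  assumes x: "\<And>i j I. rs (x i j I) = (-1) ^ card (I \<inter> {r..<r+s}) *\<^sub>C x i j I"
    and y: "\<And>i j I. rs (y i j I) = (-1) ^ card (I \<inter> {r..<r+s}) *\<^sub>C y i j I"
  shows "rs (mat_mult gr m k x y i j K) = (-1) ^ card (K \<inter> {r..<r+s}) *\<^sub>C mat_mult gr m k x y i j K"
proof -
  have "cl_real rs r s (x i j) = x i j" "cl_real rs r s (y i j) = y i j" for i j
    by (simp_all add: cl_real_def fun_eq_iff x y scaleC_sign_cancel)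
  then have "cl_real rs r s (mat_mult gr m k x y i j) = mat_mult gr m k x y i j"
    by (simp add: cl_real_mat_mult)
  from fun_cong[OF this, of K] show ?thesis unfolding cl_real_def scaleC_sign_eq_iff .
qed

lemma real_self_adjoint_mult:
  assumes x: "real_self_adjoint r s p x" and y: "real_self_adjoint r s q y"
    and comm: "mat_mult gr m k x y = mat_mult gr m k y x"
  shows "real_self_adjoint r s (p + q) (mat_mult gr m k x y)"
proof -
  have "A.graded_adjoint {} star (p + q) (mat_mult gr m k x y) (mat_mult gr m k y x)"
    using x y by (intro A.graded_adjoint_mat_mult) (auto simp: real_self_adjoint_def star_add star_mult)
  moreover have "rs (mat_mult gr m k x y i j K) =
      (-1) ^ card (K \<inter> {r..<r+s}) *\<^sub>C mat_mult gr m k x y i j K" for i j K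
    by (rule rs_mat_mult) (use x y in \<open>auto simp: real_self_adjoint_def\<close>)
  moreover have "A.homogeneous (p + q) (mat_mult gr m k x y)"
    using x y by (intro A.homogeneous_mat_mult) (auto simp: real_self_adjoint_def)
  ultimately show ?thesis by (simp add: real_self_adjoint_def comm)
qed

lemma real_self_adjoint_sandwich:
  assumes x: "real_self_adjoint r s p x" and y: "real_self_adjoint r s q y"
  shows "real_self_adjoint r s p (mat_mult gr m k y (mat_mult gr m k x y))"
proof -
  let ?xy = "mat_mult gr m k x y" and ?yx = "mat_mult gr m k y x"
  have h12: "A.homogeneous p x" "A.homogeneous q y"
    using x y by (simp_all add: real_self_adjoint_def)
  note h3 = A.homogeneous_mat_mult[OF h12, of m k]
  note h = h12 h3 A.homogeneous_mat_mult[OF h12(2) h3, of m k]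
  have "A.graded_adjoint {} star (p + q) ?xy ?yx"
    using x y by (intro A.graded_adjoint_mat_mult) (auto simp: real_self_adjoint_def star_add star_mult)
  then have "A.graded_adjoint {} star (q + (p + q)) (mat_mult gr m k y ?xy) (mat_mult gr m k ?yx y)"
    by (rule A.graded_adjoint_mat_mult[OF star_add star_mult _ _ h(3) h(2), rotated])
      (use y in \<open>simp add: real_self_adjoint_def\<close>)
  then have "A.graded_adjoint {} star (q + (p + q)) (mat_mult gr m k y ?xy) (mat_mult gr m k y ?xy)"
    by (simp only: A.mat_mult_assoc)
  moreover have "rs (?xy i j K) = (-1) ^ card (K \<inter> {r..<r+s}) *\<^sub>C ?xy i j K" for i j K
    by (rule rs_mat_mult) (use x y in \<open>auto simp: real_self_adjoint_def\<close>)
  then have "rs (mat_mult gr m k y ?xy i j K) =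
      (-1) ^ card (K \<inter> {r..<r+s}) *\<^sub>C mat_mult gr m k y ?xy i j K" for i j K
    by (rule rs_mat_mult[rotated]) (use y in \<open>auto simp: real_self_adjoint_def\<close>)
  ultimately have "real_self_adjoint r s (q + (p + q)) (mat_mult gr m k y ?xy)"
    using h by (simp add: real_self_adjoint_def)
  then show ?thesis by (rule real_self_adjoint_cong[THEN iffD1, rotated]) (cases "even q"; simp)
qed

lemma real_self_adjoint_linear:
  assumes "real_self_adjoint r s p x" "real_self_adjoint r s p y"
  shows "real_self_adjoint r s p (\<lambda>i j I. a *\<^sub>R x i j I + b *\<^sub>R y i j I)"
proof -
  have comm: "c *\<^sub>R d *\<^sub>C z = d *\<^sub>C c *\<^sub>R z" for c d and z :: 'a
    by (simp add: scaleR_scaleC scaleC_scaleC mult.commute)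
  have "gr (a *\<^sub>R z + b *\<^sub>R w) = a *\<^sub>R gr z + b *\<^sub>R gr w" for z w
    using A.g_pow_scaleC[of 1] A.g_pow_add[of 1] by (simp add: scaleR_scaleC)
  then have "A.homogeneous p (\<lambda>i j I. a *\<^sub>R x i j I + b *\<^sub>R y i j I)"
    using assms unfolding real_self_adjoint_def A.homogeneous_def
    by (simp only: comm scaleC_add_right) simp
  moreover have "A.graded_adjoint {} star p (\<lambda>i j I. a *\<^sub>R x i j I + b *\<^sub>R y i j I)
      (\<lambda>i j I. a *\<^sub>R x i j I + b *\<^sub>R y i j I)"
    using assms unfolding real_self_adjoint_def A.graded_adjoint_def
    by (simp only: star_add star_scaleR scaleC_add_right) (simp add: comm)
  moreover have "rs (c *\<^sub>R z) = c *\<^sub>R rs z" for c z by (simp add: scaleR_scaleC rs_scaleC)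
  then have "rs (a *\<^sub>R x i j I + b *\<^sub>R y i j I) =
      (-1) ^ card (I \<inter> {r..<r+s}) *\<^sub>C (a *\<^sub>R x i j I + b *\<^sub>R y i j I)" for i j I
    using assms unfolding real_self_adjoint_def
    by (simp only: rs_add scaleC_add_right) (simp add: comm)
  ultimately show ?thesis unfolding real_self_adjoint_def by blast
qed

lemma real_self_adjoint_one: "real_self_adjoint r s 0 (mat_diag m cl_one)"
proof -
  have 0: "star (0 :: 'a) = 0" "gr 0 = 0" "rs 0 = 0"
    using star_add[of "0 :: 'a" 0] A.g_pow_zero[of 1] rs_add[of 0 0] by simp_all
  have diag: "mat_diag m cl_one i i {} = (1 :: 'a)" if "i < m" for i
    using that by (simp add: mat_diag_def cl_one_def)
  have off: "mat_diag m cl_one i j I = (0 :: 'a)" if "\<not> (i = j \<and> i < m \<and> I = {})" for i j I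
    using that by (auto simp: mat_diag_def cl_one_def)
  have "gr (mat_diag m cl_one i j I) = (-1) ^ (0 + card I) *\<^sub>C mat_diag m cl_one i j I \<and>
      star (mat_diag m cl_one i j I :: 'a) =
        (-1) ^ (card (I \<inter> {}) + (card I choose 2) + Suc 0 * card I) *\<^sub>C mat_diag m cl_one j i I \<and>
      rs (mat_diag m cl_one i j I) = (-1) ^ card (I \<inter> {r..<r+s}) *\<^sub>C mat_diag m cl_one i j I"
    for i j I
  proof (cases "i = j \<and> i < m \<and> I = {}")
    case True
    then have "j = i" "I = {}" "i < m" by auto
    then show ?thesis
      by (simp only: diag) (simp add: gr_one star_one rs_one scaleC_one binomial_eq_0)
  next
    case False
    then have "\<not> (j = i \<and> j < m \<and> I = {})" by auto
    with False show ?thesis by (simp only: off 0 complex_vector.scale_zero_right simp_thms)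
  qed
  then show ?thesis
    unfolding real_self_adjoint_def A.homogeneous_def A.graded_adjoint_def by (intro conjI allI impI) simp_all
qed

lemma real_self_adjoint_sums:
  assumes f: "\<And>n. real_self_adjoint r s p (f n)"
    and F: "\<And>i j I. (\<lambda>n. f n i j I) sums F i j I"
  shows "real_self_adjoint r s p F"
proof -
  have closed: "\<theta> (F i j I) = c *\<^sub>C F i' j' I"
    if "bounded_linear \<theta>" "\<And>n. \<theta> (f n i j I) = c *\<^sub>C f n i' j' I" for \<theta> c i j i' j' I
    using sums_unique2[OF bounded_linear.sums[OF that(1) F]
      bounded_linear.sums[OF bounded_linear_scaleC F, of c i' j' I, folded that(2)]] .
  show ?thesis
    unfolding real_self_adjoint_def A.homogeneous_def A.graded_adjoint_def
    using f[unfolded real_self_adjoint_def A.homogeneous_def A.graded_adjoint_def]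
      bounded_linear_gr_pow[of 1] bounded_linear_star bounded_linear_rs
    by (intro conjI allI impI closed) simp_all
qed

lemma mat_diag_one_clmat: "mat_diag m cl_one \<in> clmat m k UNIV"
  by (auto simp: clmat_iff mat_diag_def cl_one_def)

text \<open>The inverse of \<open>1 - \<tau> q\<close> is the Neumann series.  It converges uniformly in \<open>\<tau>\<close>, and its
  terms inherit from \<open>q\<close> every closed linear condition that powers of \<open>q\<close> satisfy.  The bound
  1/4 is the maximum of \<open>a b\<close> for \<open>a + b = 1\<close>, and the condition on \<open>\<alpha>\<close> makes
  multiplication by \<open>q\<close> contractive for the maximum norm of the coefficients.\<close>

lemma neumann_series:
  fixes q :: "'a clmat" and m k r s :: nat and \<alpha> :: real
  defines "E \<equiv> mat_diag m cl_one :: 'a clmat" and "M \<equiv> mat_mult gr m k"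
  assumes q: "real_self_adjoint r s 0 q" "q \<in> clmat m k UNIV"
    and bound: "\<And>i j I. norm (q i j I) \<le> \<alpha>" and \<alpha>: "real m * 2 ^ k * \<alpha> \<le> 1"
  obtains v where
    "\<And>\<tau>. \<tau> \<in> {0..1/4} \<Longrightarrow> v \<tau> \<in> clmat m k UNIV \<and> real_self_adjoint r s 0 (v \<tau>)"
    "\<And>\<tau>. \<tau> \<in> {0..1/4} \<Longrightarrow> M (v \<tau>) (\<lambda>i j I. E i j I - \<tau> *\<^sub>R q i j I) = E"
    "\<And>\<tau> z. \<tau> \<in> {0..1/4} \<Longrightarrow> z \<in> clmat m k UNIV \<Longrightarrow> M z q = M q z \<Longrightarrow> M z (v \<tau>) = M (v \<tau>) z"
    "\<And>i j I. continuous_on {0..1/4} (\<lambda>\<tau>. v \<tau> i j I)"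
proof
  define pw where "pw n = (M q ^^ n) E" for n
  define v where "v \<tau> = (\<lambda>i j I. suminf (\<lambda>n. \<tau> ^ n *\<^sub>R pw n i j I))" for \<tau> :: real
  have pw0: "pw 0 = E" and pwS: "pw (Suc n) = M q (pw n)" for n by (simp_all add: pw_def)
  have one_left: "M E x = x" and one_right: "M x E = x" if "x \<in> clmat m k UNIV" for x
    using that mat_mult_one_left mat_mult_one_right by (simp_all add: E_def M_def)
  have assoc: "M (M x y) z = M x (M y z)" for x y z by (simp add: M_def A.mat_mult_assoc)
  have M_clmat: "M x y \<in> clmat m k UNIV" if "x \<in> clmat m k UNIV" "y \<in> clmat m k UNIV" for x y
    unfolding M_def using that A.graded_involution_axioms by (rule clmat_mat_mult)
  have pw_clmat: "pw n \<in> clmat m k UNIV" for n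
  proof (induction n)
    case 0
    show ?case by (simp add: pw0 E_def mat_diag_one_clmat)
  qed (simp add: pwS M_clmat q)
  have pw_comm: "M z (pw n) = M (pw n) z" if z: "z \<in> clmat m k UNIV" "M z q = M q z" for z n
  proof (induction n)
    case 0
    show ?case by (simp add: pw0 one_left one_right z)
  next
    case (Suc n)
    then show ?case by (metis assoc pwS z(2))
  qed
  have pw_real: "real_self_adjoint r s 0 (pw n)" for n
  proof (induction n)
    case 0
    show ?case by (simp add: pw0 E_def real_self_adjoint_one)
  next
    case (Suc n)
    have "real_self_adjoint r s (0 + 0) (mat_mult gr m k q (pw n))"
      by (rule real_self_adjoint_mult[OF q(1) Suc]) (use pw_comm[OF q(2)] in \<open>simp add: M_def\<close>)
    then show ?case by (simp add: pwS M_def)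
  qed
  have pw_le: "norm (pw n i j I) \<le> 1" for n i j I
  proof (induction n arbitrary: i j I)
    case 0
    show ?case by (simp add: pw0 E_def mat_diag_def cl_one_def)
  next
    case (Suc n)
    have "norm (pw (Suc n) i j I) \<le> real m * 2 ^ k * (\<alpha> * 1)"
      unfolding pwS M_def by (rule norm_mat_mult_le[OF bound Suc])
    then show ?case using \<alpha> by simp
  qed
  have term_le: "norm (\<tau> ^ n *\<^sub>R pw n i j I) \<le> (1/4) ^ n" if "\<tau> \<in> {0..1/4}" for \<tau> :: real and n i j I
    using mult_mono[OF power_mono[of \<tau> "1/4" n] pw_le[of n i j I]] that by (simp add: norm_power)
  have sums: "(\<lambda>n. \<tau> ^ n *\<^sub>R pw n i j I) sums v \<tau> i j I" if "\<tau> \<in> {0..1/4}" for \<tau> :: real and i j I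
    unfolding v_def using term_le[OF that, of _ i j I]
    by (intro summable_sums summable_comparison_test[OF _ summable_geometric[of "1/4"]]) auto
  show v: "v \<tau> \<in> clmat m k UNIV \<and> real_self_adjoint r s 0 (v \<tau>)" if \<tau>: "\<tau> \<in> {0..1/4}" for \<tau>
  proof
    have "v \<tau> i j I = 0" if "\<not> (i < m \<and> j < m \<and> I \<subseteq> {..<k})" for i j I
    proof -
      have "pw n i j I = 0" for n using pw_clmat[of n] that by (simp add: clmat_iff)
      then show ?thesis by (simp add: v_def)
    qed
    then show "v \<tau> \<in> clmat m k UNIV" by (simp add: clmat_iff)
    have "real_self_adjoint r s 0 (\<lambda>i j I. \<tau> ^ n *\<^sub>R pw n i j I)" for n
      using real_self_adjoint_linear[OF pw_real[of n] pw_real[of n], of "\<tau> ^ n" 0] by simp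
    then show "real_self_adjoint r s 0 (v \<tau>)" by (rule real_self_adjoint_sums[OF _ sums[OF \<tau>]])
  qed
  have commute: "M z (v \<tau>) = M (v \<tau>) z"
    if \<tau>: "\<tau> \<in> {0..1/4}" and z: "z \<in> clmat m k UNIV" "M z q = M q z" for \<tau> z
  proof (intro ext)
    fix i j I
    have "M z (\<lambda>i j I. \<tau> ^ n *\<^sub>R pw n i j I) = M (\<lambda>i j I. \<tau> ^ n *\<^sub>R pw n i j I) z" for n
      unfolding M_def mat_mult_scaleR_left mat_mult_scaleR_right
      using pw_comm[OF z, of n] by (simp add: M_def)
    moreover have "(\<lambda>n. M z (\<lambda>i j I. \<tau> ^ n *\<^sub>R pw n i j I) i j I) sums M z (v \<tau>) i j I"
      unfolding M_def by (rule sums_mat_mult_right) (rule sums[OF \<tau>])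
    moreover have "(\<lambda>n. M (\<lambda>i j I. \<tau> ^ n *\<^sub>R pw n i j I) z i j I) sums M (v \<tau>) z i j I"
      unfolding M_def by (rule sums_mat_mult_left) (rule sums[OF \<tau>])
    ultimately show "M z (v \<tau>) i j I = M (v \<tau>) z i j I" using sums_unique2 by simp
  qed
  then show "\<And>\<tau> z. \<tau> \<in> {0..1/4} \<Longrightarrow> z \<in> clmat m k UNIV \<Longrightarrow> M z q = M q z \<Longrightarrow> M z (v \<tau>) = M (v \<tau>) z" .
  have inverse: "v \<tau> i j I = \<tau> *\<^sub>R M q (v \<tau>) i j I + E i j I" if \<tau>: "\<tau> \<in> {0..1/4}" for \<tau> i j I
  proof -
    have "(\<lambda>n. M q (\<lambda>i j I. \<tau> ^ n *\<^sub>R pw n i j I) i j I) sums M q (v \<tau>) i j I"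
      unfolding M_def by (rule sums_mat_mult_right) (rule sums[OF \<tau>])
    then have "(\<lambda>n. \<tau> ^ n *\<^sub>R pw (Suc n) i j I) sums M q (v \<tau>) i j I"
      by (simp add: pwS M_def mat_mult_scaleR_right)
    then have "(\<lambda>n. \<tau> ^ Suc n *\<^sub>R pw (Suc n) i j I) sums (\<tau> *\<^sub>R M q (v \<tau>) i j I)"
      using bounded_linear.sums[OF bounded_linear_scaleR_right[of \<tau>]] by fastforce
    then have "(\<lambda>n. \<tau> ^ n *\<^sub>R pw n i j I) sums (\<tau> *\<^sub>R M q (v \<tau>) i j I + \<tau> ^ 0 *\<^sub>R pw 0 i j I)"
      by (rule sums_Suc)
    then show ?thesis using sums_unique2[OF sums[OF \<tau>]] by (simp add: pw0)
  qed
  have right: "M (\<lambda>i j I. E i j I - \<tau> *\<^sub>R q i j I) (v \<tau>) = E" if \<tau>: "\<tau> \<in> {0..1/4}" for \<tau>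
  proof -
    have "M (\<lambda>i j I. E i j I - \<tau> *\<^sub>R q i j I) (v \<tau>) = (\<lambda>i j I. v \<tau> i j I - \<tau> *\<^sub>R M q (v \<tau>) i j I)"
      using one_left[OF v[OF \<tau>, THEN conjunct1]]
      by (simp add: M_def A.mat_mult_diff_left mat_mult_scaleR_left)
    then show ?thesis using inverse[OF \<tau>] by (simp add: fun_eq_iff)
  qed
  show "M (v \<tau>) (\<lambda>i j I. E i j I - \<tau> *\<^sub>R q i j I) = E" if \<tau>: "\<tau> \<in> {0..1/4}" for \<tau>
  proof -
    let ?h = "\<lambda>i j I. E i j I - \<tau> *\<^sub>R q i j I"
    have "?h \<in> clmat m k UNIV"
      using q(2) mat_diag_one_clmat[of m k] by (simp add: clmat_iff E_def)
    moreover have "M ?h q = M q ?h"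
      using one_left[OF q(2)] one_right[OF q(2)]
      by (simp add: M_def A.mat_mult_diff_left A.mat_mult_diff_right mat_mult_scaleR_left mat_mult_scaleR_right)
    ultimately show ?thesis using commute[OF \<tau>, of ?h] right[OF \<tau>] by simp
  qed
  show "continuous_on {0..1/4} (\<lambda>\<tau>. v \<tau> i j I)" for i j I
  proof (rule uniform_limit_theorem)
    show "uniform_limit {0..1/4} (\<lambda>N \<tau>. \<Sum>n<N. \<tau> ^ n *\<^sub>R pw n i j I) (\<lambda>\<tau>. v \<tau> i j I) sequentially"
      unfolding v_def by (rule Weierstrass_m_test[OF term_le]) (simp_all add: summable_geometric)
    show "\<forall>\<^sub>F N in sequentially. continuous_on {0..1/4} (\<lambda>\<tau>. \<Sum>n<N. \<tau> ^ n *\<^sub>R pw n i j I)"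
      by (intro always_eventually allI continuous_intros)
  qed simp
qed

text \<open>If \<open>a + b = 1\<close> and \<open>g = a x + b y\<close>, then \<open>g\<^sup>2 = 1 - a b (x - y)\<^sup>2\<close> commutes with \<open>x\<close> and
  \<open>y\<close>, so \<open>g x g\<^sup>-\<^sup>1 = (g\<^sup>2)\<^sup>-\<^sup>1 g x g\<close> is again self-adjoint.  This conjugate is \<open>x\<close> for \<open>b = 0\<close>, and
  for \<open>a = b\<close> it is \<open>y\<close>, because \<open>(x + y) x = y (x + y)\<close>.  Thus the only inverse to be controlled
  along the path is that of \<open>g\<^sup>2\<close>, a Neumann series when \<open>x - y\<close> is small.\<close>

lemma close_real_osu_homotopic:
  fixes x y :: "'a clmat"
  assumes x: "x \<in> real_osu gr rs r s m UNIV" and y: "y \<in> real_osu gr rs r s m UNIV"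
    and m: "1 \<le> m"
    and close: "\<And>i j I. norm (x i j I - y i j I) \<le> 1 / (real m * 2 ^ (r + s))"
  shows "path_component (real_osu gr rs r s m UNIV) x y"
proof -
  define k where "k = r + s"
  define M where "M = mat_mult gr m k"
  define E where "E = (mat_diag m cl_one :: 'a clmat)"
  (* x d = - d y and y d = - d x, hence q = d d commutes with x and with y. *)
  define d where "d = (\<lambda>i j I. x i j I - y i j I)"
  define q where "q = M d d"
  define N where "N = real m * 2 ^ k"
  have xc: "x \<in> clmat m k UNIV" and yc: "y \<in> clmat m k UNIV"
    and xr: "real_self_adjoint r s 1 x" and yr: "real_self_adjoint r s 1 y"
    and xx: "M x x = E" and yy: "M y y = E"
    using x y unfolding real_osu_iff by (simp_all add: k_def M_def E_def)
  have one: "M E z = z" "M z E = z" if "z \<in> clmat m k UNIV" for z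
    using that mat_mult_one_left mat_mult_one_right by (simp_all add: E_def M_def)
  have assoc: "M (M u w) z = M u (M w z)" for u w z by (simp add: M_def A.mat_mult_assoc)
  have M_clmat: "M u w \<in> clmat m k UNIV" if "u \<in> clmat m k UNIV" "w \<in> clmat m k UNIV" for u w
    unfolding M_def using that A.graded_involution_axioms by (rule clmat_mat_mult)
  note lin = A.mat_mult_add_left A.mat_mult_add_right A.mat_mult_diff_left A.mat_mult_diff_right
    mat_mult_scaleR_left mat_mult_scaleR_right
  have d_real: "real_self_adjoint r s 1 d"
    using real_self_adjoint_linear[OF xr yr, of 1 "-1"] by (simp add: d_def)
  have dc: "d \<in> clmat m k UNIV" using xc yc by (simp add: d_def clmat_iff)
  have qc: "q \<in> clmat m k UNIV" unfolding q_def by (rule M_clmat[OF dc dc])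
  have "real_self_adjoint r s (1 + 1) (mat_mult gr m k d d)"
    by (rule real_self_adjoint_mult[OF d_real d_real refl])
  then have q_real: "real_self_adjoint r s 0 q"
    using real_self_adjoint_cong[of 0 "1 + 1"] by (simp add: q_def M_def)
  have N: "0 < N" using m by (simp add: N_def)
  have "norm (d i j I) \<le> 1 / N" for i j I using close by (simp add: d_def N_def k_def)
  then have "norm (q i j I) \<le> N * (1 / N * (1 / N))" for i j I
    unfolding q_def M_def N_def by (intro norm_mat_mult_le)
  then have q_le: "norm (q i j I) \<le> 1 / N" for i j I using N by simp
  have N_le: "real m * 2 ^ k * (1 / N) \<le> 1" using N by (simp add: N_def)
  obtain v where
    v: "\<And>\<tau>. \<tau> \<in> {0..1/4} \<Longrightarrow> v \<tau> \<in> clmat m k UNIV \<and> real_self_adjoint r s 0 (v \<tau>)"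
    and v_left: "\<And>\<tau>. \<tau> \<in> {0..1/4} \<Longrightarrow> M (v \<tau>) (\<lambda>i j I. E i j I - \<tau> *\<^sub>R q i j I) = E"
    and v_comm: "\<And>\<tau> z. \<tau> \<in> {0..1/4} \<Longrightarrow> z \<in> clmat m k UNIV \<Longrightarrow> M z q = M q z \<Longrightarrow> M z (v \<tau>) = M (v \<tau>) z"
    and v_cont: "\<And>i j I. continuous_on {0..1/4} (\<lambda>\<tau>. v \<tau> i j I)"
    by (rule neumann_series[OF q_real qc q_le N_le, folded M_def E_def]) (rule that)
  have xd: "M x d = (\<lambda>i j I. - M d y i j I)" and yd: "M y d = (\<lambda>i j I. - M d x i j I)"
    unfolding d_def M_def lin by (simp_all add: xx[unfolded M_def] yy[unfolded M_def])
  have neg: "M (\<lambda>i j I. - u i j I) w = (\<lambda>i j I. - M u w i j I)"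
    "M u (\<lambda>i j I. - w i j I) = (\<lambda>i j I. - M u w i j I)" for u w
    using mat_mult_scaleR_left[of m k "-1" u w] mat_mult_scaleR_right[of m k u "-1" w] by (simp_all add: M_def)
  have xq: "M x q = M q x"
    by (simp only: q_def assoc[symmetric] xd neg) (simp only: assoc yd neg minus_minus)
  have yq: "M y q = M q y"
    by (simp only: q_def assoc[symmetric] yd neg) (simp only: assoc xd neg minus_minus)
  define g where "g t = (\<lambda>i j I. (1 - t / 2) *\<^sub>R x i j I + (t / 2) *\<^sub>R y i j I)" for t :: real
  define \<tau> where "\<tau> t = (1 - t / 2) * (t / 2)" for t :: real
  define G where "G t = M (g t) (M x (g t))" for t
  define p where "p t = M (v (\<tau> t)) (G t)" for t
  have \<tau>: "\<tau> t \<in> {0..1/4}" if "t \<in> {0..1}" for t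
  proof -
    have "\<tau> t = 1 / 4 - (1 / 2 - t / 2)\<^sup>2" by (simp add: \<tau>_def power2_eq_square field_simps)
    moreover have "0 \<le> \<tau> t" unfolding \<tau>_def using that by (intro mult_nonneg_nonneg) simp_all
    ultimately show ?thesis by simp
  qed
  have gc: "g t \<in> clmat m k UNIV" for t using xc yc by (simp add: g_def clmat_iff)
  have Gc: "G t \<in> clmat m k UNIV" for t by (simp add: G_def M_clmat gc xc)
  have g_real: "real_self_adjoint r s 1 (g t)" for t
    unfolding g_def by (rule real_self_adjoint_linear[OF xr yr])
  have G_real: "real_self_adjoint r s 1 (G t)" for t
    unfolding G_def M_def by (rule real_self_adjoint_sandwich[OF xr g_real])
  have comm_linear: "M (g t) z = M z (g t)" if "M x z = M z x" "M y z = M z y" for t z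
    using that by (simp add: g_def M_def lin)
  have gg: "M (g t) (g t) = (\<lambda>i j I. E i j I - \<tau> t *\<^sub>R q i j I)" for t
  proof (intro ext)
    fix i j I
    have "M (g t) (g t) i j I = (1 - t / 2)\<^sup>2 *\<^sub>R E i j I + (t / 2)\<^sup>2 *\<^sub>R E i j I
        + \<tau> t *\<^sub>R (M x y i j I + M y x i j I)"
      using xx yy by (simp add: g_def M_def lin \<tau>_def power2_eq_square scaleR_add_right mult.commute)
    moreover have "q i j I = 2 *\<^sub>R E i j I - (M x y i j I + M y x i j I)"
      using xx yy by (simp add: q_def d_def M_def lin scaleR_2)
    moreover have "(1 - t / 2)\<^sup>2 + (t / 2)\<^sup>2 = 1 - 2 * \<tau> t" by (simp add: \<tau>_def power2_eq_square algebra_simps)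
    ultimately show "M (g t) (g t) i j I = E i j I - \<tau> t *\<^sub>R q i j I"
      by (simp add: scaleR_diff_right flip: scaleR_add_left) (simp add: scaleR_diff_left mult.commute)
  qed
  have pS: "p t \<in> real_osu gr rs r s m UNIV" if t: "t \<in> {0..1}" for t
  proof -
    let ?v = "v (\<tau> t)" and ?g = "g t" and ?h = "\<lambda>i j I. E i j I - \<tau> t *\<^sub>R q i j I"
    note vt = v[OF \<tau>[OF t]]
    have xv: "M x ?v = M ?v x" and yv: "M y ?v = M ?v y"
      using v_comm[OF \<tau>[OF t]] xc yc xq yq by blast+
    have gv: "M ?g ?v = M ?v ?g" by (rule comm_linear[OF xv yv])
    have vG: "M ?v (G t) = M (G t) ?v"
      unfolding G_def by (metis assoc gv xv)
    have hx: "M x ?h = M ?h x"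
      using xq one[OF xc] by (simp add: M_def lin)
    have hc: "?h \<in> clmat m k UNIV" unfolding gg[symmetric] by (rule M_clmat[OF gc gc])
    have "M (G t) (G t) = M ?g (M x (M ?h (M x ?g)))"
      by (simp only: G_def assoc gg[symmetric])
    also have "\<dots> = M ?g (M ?h (M (M x x) ?g))" by (simp only: assoc[symmetric] hx)
    also have "\<dots> = M ?h ?h" by (simp only: xx one[OF gc]) (simp only: gg[symmetric] assoc)
    finally have GG: "M (G t) (G t) = M ?h ?h" .
    have "M (p t) (p t) = M ?v (M ?v (M (G t) (G t)))"
      unfolding p_def by (metis assoc vG)
    also have "\<dots> = M ?v (M (M ?v ?h) ?h)" by (simp only: GG assoc)
    also have "\<dots> = E" using v_left[OF \<tau>[OF t]] one[OF hc] by simp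
    finally have "M (p t) (p t) = E" .
    moreover have "real_self_adjoint r s (0 + 1) (mat_mult gr m k ?v (G t))"
      by (rule real_self_adjoint_mult) (use vt G_real vG in \<open>auto simp: M_def\<close>)
    ultimately show ?thesis
      using M_clmat[of ?v "G t"] vt Gc by (simp add: real_osu_iff p_def M_def E_def k_def)
  qed
  have p_cont: "continuous_on {0..1} (\<lambda>t. p t i j I)" for i j I
  proof -
    have "continuous_on {0..1} \<tau>" unfolding \<tau>_def by (intro continuous_intros) simp_all
    then have "continuous_on {0..1} (\<lambda>t. v (\<tau> t) i j I)" for i j I
      using \<tau> by (intro continuous_on_compose2[OF v_cont]) auto
    moreover have "continuous_on {0..1} (\<lambda>t. g t i j I)" for i j I
      unfolding g_def by (intro continuous_intros) simp_all
    ultimately show ?thesis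
      unfolding p_def G_def M_def by (intro continuous_on_mat_mult continuous_on_const)
  qed
  have "p 0 = x"
  proof -
    have "v 0 \<in> clmat m k UNIV" "M (v 0) E = E" using v[of 0] v_left[of 0] by simp_all
    then have "v 0 = E" using one by metis
    then show ?thesis using one[OF xc] xx by (simp add: p_def G_def \<tau>_def g_def)
  qed
  moreover have "p 1 = y"
  proof -
    have "M (g 1) x = M y (g 1)"
      using xx yy by (simp add: g_def M_def lin add.commute)
    then have "G 1 = M y (\<lambda>i j I. E i j I - \<tau> 1 *\<^sub>R q i j I)"
      by (simp only: G_def assoc[symmetric]) (simp only: assoc gg)
    moreover have yv: "M y (v (\<tau> 1)) = M (v (\<tau> 1)) y" using v_comm[OF \<tau> yc yq] by simp
    ultimately have "p 1 = M y (M (v (\<tau> 1)) (\<lambda>i j I. E i j I - \<tau> 1 *\<^sub>R q i j I))"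
      by (simp only: p_def assoc[symmetric] yv)
    then show ?thesis using v_left[OF \<tau>[of 1]] one[OF yc] by simp
  qed
  moreover have "path p"
    unfolding path_def by (intro continuous_on_coordinatewise_then_product p_cont)
  ultimately show ?thesis
    unfolding path_component_def using pS
    by (intro exI[of _ p]) (auto simp: path_image_def pathstart_def pathfinish_def)
qed

end

section \<open>Conjugation by scalar unitary matrices\<close>

text \<open>Scalars commute with the grading, so conjugation by \<open>U\<close> is an automorphism of
  \<open>M\<^sub>m(A \<otimes> Cl\<^sub>k)\<close> that preserves odd self-adjoint unitaries.  It does not leave a complex subspace of
  coefficients, which is what makes it available over the domain algebra.\<close>

definition unitary_matrix :: "nat \<Rightarrow> (nat \<Rightarrow> nat \<Rightarrow> complex) \<Rightarrow> bool" where
  "unitary_matrix m U \<longleftrightarrow> (\<forall>i j. \<not> (i < m \<and> j < m) \<longrightarrow> U i j = 0) \<and>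
    (\<forall>i<m. \<forall>j<m. (\<Sum>l<m. U i l * cnj (U j l)) = (if i = j then 1 else 0)) \<and>
    (\<forall>i<m. \<forall>j<m. (\<Sum>l<m. cnj (U l i) * U l j) = (if i = j then 1 else 0))"

definition unitary_conj :: "nat \<Rightarrow> (nat \<Rightarrow> nat \<Rightarrow> complex) \<Rightarrow> 'a::complex_algebra clmat \<Rightarrow> 'a clmat" where
  "unitary_conj m U x = (\<lambda>i j I. \<Sum>p<m. \<Sum>q<m. (U i p * cnj (U j q)) *\<^sub>C x p q I)"

context graded_involution
begin

lemma cl_mult_scaleC_left: "cl_mult g k (\<lambda>I. c *\<^sub>C x I) y K = c *\<^sub>C cl_mult g k x y K"
  by (simp add: cl_mult_apply mult_scaleC_left scaleC_scaleC mult.commute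
    complex_vector.scale_sum_right complex_vector.scale_zero_right)

lemma cl_mult_scaleC_right: "cl_mult g k x (\<lambda>I. c *\<^sub>C y I) K = c *\<^sub>C cl_mult g k x y K"
  by (simp add: cl_mult_apply g_pow_scaleC mult_scaleC_right scaleC_scaleC mult.commute
    complex_vector.scale_sum_right complex_vector.scale_zero_right)

lemma cl_mult_combination:
  "cl_mult g k (\<lambda>I. \<Sum>p\<in>P. c p *\<^sub>C x p I) (\<lambda>I. \<Sum>q\<in>Q. d q *\<^sub>C y q I) K =
    (\<Sum>p\<in>P. \<Sum>q\<in>Q. (c p * d q) *\<^sub>C cl_mult g k (x p) (y q) K)"
  by (simp only: cl_mult_sum_left cl_mult_sum_right cl_mult_scaleC_left cl_mult_scaleC_right
    complex_vector.scale_sum_right scaleC_scaleC)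

lemma mat_mult_unitary_conj:
  assumes U: "unitary_matrix m U"
  shows "mat_mult g m k (unitary_conj m U x) (unitary_conj m U y) = unitary_conj m U (mat_mult g m k x y)"
proof (intro ext)
  fix i j K
  have conj: "unitary_conj m U x i j = (\<lambda>I. \<Sum>q<m. cnj (U j q) *\<^sub>C (\<Sum>p<m. U i p *\<^sub>C x p q I))"
    "unitary_conj m U x i j = (\<lambda>I. \<Sum>p<m. U i p *\<^sub>C (\<Sum>q<m. cnj (U j q) *\<^sub>C x p q I))" for x i j
    by (simp_all add: unitary_conj_def complex_vector.scale_sum_right scaleC_scaleC mult.commute,
      rule ext, rule sum.swap)
  let ?X = "\<lambda>q I. \<Sum>p<m. U i p *\<^sub>C x p q I" and ?Y = "\<lambda>p I. \<Sum>q<m. cnj (U j q) *\<^sub>C y p q I"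
  have "mat_mult g m k (unitary_conj m U x) (unitary_conj m U y) i j K =
      (\<Sum>l<m. \<Sum>q<m. \<Sum>p<m. (cnj (U l q) * U l p) *\<^sub>C cl_mult g k (?X q) (?Y p) K)"
    by (simp only: mat_mult_def conj(1)[of x] conj(2)[of y] cl_mult_combination)
  also have "\<dots> = (\<Sum>q<m. \<Sum>p<m. (\<Sum>l<m. cnj (U l q) * U l p) *\<^sub>C cl_mult g k (?X q) (?Y p) K)"
    by (simp only: complex_vector.scale_sum_left)
      (subst sum.swap, rule sum.cong[OF refl], rule sum.swap)
  also have "\<dots> = (\<Sum>q<m. \<Sum>p<m. if p = q then cl_mult g k (?X q) (?Y p) K else 0)"
    using U by (intro sum.cong refl) (auto simp: unitary_matrix_def scaleC_one complex_vector.scale_zero_left)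
  also have "\<dots> = (\<Sum>q<m. cl_mult g k (?X q) (?Y q) K)" by simp
  also have "\<dots> = (\<Sum>l<m. \<Sum>p<m. \<Sum>q<m. (U i p * cnj (U j q)) *\<^sub>C cl_mult g k (x p l) (y l q) K)"
    by (simp only: cl_mult_combination)
  also have "\<dots> = unitary_conj m U (mat_mult g m k x y) i j K"
    by (simp only: unitary_conj_def mat_mult_def complex_vector.scale_sum_right)
      (subst sum.swap, rule sum.cong[OF refl], rule sum.swap)
  finally show "mat_mult g m k (unitary_conj m U x) (unitary_conj m U y) i j K =
    unitary_conj m U (mat_mult g m k x y) i j K" .
qed

end

context graded_cstar_algebra
begin

lemma unitary_conj_one:
  assumes U: "unitary_matrix m U"
  shows "unitary_conj m U (mat_diag m cl_one :: 'a clmat) = mat_diag m cl_one"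
proof (intro ext)
  fix i j I
  have "unitary_conj m U (mat_diag m cl_one :: 'a clmat) i j I =
      (\<Sum>p<m. \<Sum>q<m. if q = p then (U i p * cnj (U j p)) *\<^sub>C cl_one I else 0)"
    unfolding unitary_conj_def
    by (intro sum.cong refl) (auto simp: mat_diag_def complex_vector.scale_zero_right)
  also have "\<dots> = (\<Sum>p<m. U i p * cnj (U j p)) *\<^sub>C cl_one I"
    by (simp add: complex_vector.scale_sum_left)
  also have "\<dots> = mat_diag m cl_one i j I"
  proof (cases "i < m \<and> j < m")
    case True
    then show ?thesis using U
      by (simp add: unitary_matrix_def mat_diag_def scaleC_one complex_vector.scale_zero_left)
  next
    case False
    then have "(\<Sum>p<m. U i p * cnj (U j p)) = 0"
      using U by (intro sum.neutral) (auto simp: unitary_matrix_def)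
    then show ?thesis using False by (auto simp: mat_diag_def complex_vector.scale_zero_left)
  qed
  finally show "unitary_conj m U (mat_diag m cl_one :: 'a clmat) i j I = mat_diag m cl_one i j I" .
qed

lemma unitary_conj_osu:
  assumes U: "unitary_matrix m U" and S: "complex_vector.subspace S" and x: "x \<in> osu gr m k S"
  shows "unitary_conj m U x \<in> osu gr m k S"
proof -
  have xc: "x \<in> clmat m k S" and hom: "A.homogeneous 1 x" and adj: "A.graded_adjoint {} star 1 x x"
    and xx: "mat_mult gr m k x x = mat_diag m cl_one"
    using x by (simp_all add: osu_iff)
  interpret st: additive "star :: 'a \<Rightarrow> 'a" by standard (rule star_add)
  have "unitary_conj m U x \<in> clmat m k S"
    unfolding clmat_iff
  proof (intro conjI allI impI)
    fix i j I assume "I \<subseteq> {..<k}"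
    then have "x p q I \<in> S" if "p < m" "q < m" for p q using xc that by (simp add: clmat_iff)
    then show "unitary_conj m U x i j I \<in> S"
      unfolding unitary_conj_def
      by (intro complex_vector.subspace_sum[OF S] complex_vector.subspace_scale[OF S]) auto
  next
    fix i j I assume n: "\<not> (i < m \<and> j < m \<and> I \<subseteq> {..<k})"
    have "(U i p * cnj (U j q)) *\<^sub>C x p q I = 0" for p q
    proof (cases "i < m \<and> j < m")
      case True
      then have "x p q I = 0" using xc n by (simp add: clmat_iff)
      then show ?thesis by (simp add: complex_vector.scale_zero_right)
    next
      case False
      then show ?thesis using U by (auto simp: unitary_matrix_def complex_vector.scale_zero_left)
    qed
    then show "unitary_conj m U x i j I = 0" by (simp only: unitary_conj_def sum.neutral_const)
  qed
  moreover have "A.homogeneous 1 (unitary_conj m U x)"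
    unfolding A.homogeneous_def
  proof (intro allI)
    fix i j I
    show "gr (unitary_conj m U x i j I) = (-1) ^ (1 + card I) *\<^sub>C unitary_conj m U x i j I"
      unfolding unitary_conj_def A.g_pow_sum[of 1, simplified] A.g_pow_scaleC[of 1, simplified]
        complex_vector.scale_sum_right A.homogeneousD[OF hom] scaleC_scaleC
      by (simp only: mult_ac)
  qed
  moreover have "A.graded_adjoint {} star 1 (unitary_conj m U x) (unitary_conj m U x)"
    unfolding A.graded_adjoint_def
  proof (intro allI impI)
    fix i j and I :: "nat set" assume I: "finite I"
    let ?\<eta> = "(-1 :: complex) ^ (card (I \<inter> {}) + (card I choose 2) + Suc 1 * card I)"
    have "star (unitary_conj m U x i j I) = (\<Sum>p<m. \<Sum>q<m. ?\<eta> *\<^sub>C (U j q * cnj (U i p)) *\<^sub>C x q p I)"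
      unfolding unitary_conj_def st.sum star_scaleC A.graded_adjointD[OF adj I] scaleC_scaleC
      by (simp only: complex_cnj_mult complex_cnj_cnj mult_ac)
    also have "\<dots> = (\<Sum>q<m. \<Sum>p<m. ?\<eta> *\<^sub>C (U j q * cnj (U i p)) *\<^sub>C x q p I)" by (rule sum.swap)
    finally show "star (unitary_conj m U x i j I) = ?\<eta> *\<^sub>C unitary_conj m U x j i I"
      by (simp only: unitary_conj_def complex_vector.scale_sum_right)
  qed
  moreover have "mat_mult gr m k (unitary_conj m U x) (unitary_conj m U x) = mat_diag m cl_one"
    by (simp only: A.mat_mult_unitary_conj[OF U] xx unitary_conj_one[OF U])
  ultimately show ?thesis by (simp add: osu_iff)
qed

end

lemma (in graded_real_cstar_algebra) unitary_conj_real_osu: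
  assumes U: "unitary_matrix m U" and real: "\<And>i j. cnj (U i j) = U i j"
    and x: "x \<in> real_osu gr rs r s m UNIV"
  shows "unitary_conj m U x \<in> real_osu gr rs r s m UNIV"
proof -
  interpret rs: additive rs by standard (rule rs_add)
  have "unitary_conj m U x \<in> osu gr m (r + s) UNIV"
    by (rule unitary_conj_osu[OF U]) (use x in \<open>simp_all add: real_osu_def\<close>)
  moreover have "cl_real rs r s (unitary_conj m U x i j) = unitary_conj m U x i j" for i j
  proof
    fix I
    have "(-1) ^ card (I \<inter> {r..<r+s}) *\<^sub>C rs (x p q I) = x p q I" for p q
      using x by (simp add: real_osu_def cl_real_def fun_eq_iff)
    then have "(-1) ^ card (I \<inter> {r..<r+s}) *\<^sub>C (c *\<^sub>C rs (x p q I)) = c *\<^sub>C x p q I" for p q c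
      by (metis complex_vector.scale_left_commute)
    then show "cl_real rs r s (unitary_conj m U x i j) I = unitary_conj m U x i j I"
      unfolding cl_real_def unitary_conj_def rs.sum rs_scaleC complex_vector.scale_sum_right
      by (simp add: real)
  qed
  ultimately show ?thesis by (simp add: real_osu_def)
qed

text \<open>The matrix of the reflection \<open>1 - 2 v v\<^sup>T / (v\<^sup>T v)\<close>.\<close>

definition reflection :: "nat \<Rightarrow> (nat \<Rightarrow> real) \<Rightarrow> nat \<Rightarrow> nat \<Rightarrow> complex" where
  "reflection m v i j = (if i < m \<and> j < m
     then of_real ((if i = j then 1 else 0) - 2 / (\<Sum>l<m. (v l)\<^sup>2) * v i * v j) else 0)"

lemma unitary_reflection:
  assumes "(\<Sum>l<m. (v l)\<^sup>2) \<noteq> 0"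
  shows "unitary_matrix m (reflection m v)"
proof -
  define N where "N = (\<Sum>l<m. (v l)\<^sup>2)"
  define c where "c = 2 / N"
  let ?H = "\<lambda>i j. (if i = j then 1 else 0) - c * v i * v j"
  have cN: "c * N = 2" using assms by (simp add: c_def N_def)
  have sym: "?H i j = ?H j i" for i j by simp
  have sq: "(\<Sum>l<m. ?H i l * ?H j l) = (if i = j then 1 else 0)" if "i < m" "j < m" for i j
  proof -
    have "(\<Sum>l<m. ?H i l * ?H j l) = (\<Sum>l<m. (if l = i then (if j = i then 1 else 0) else 0)
        - (if l = i then c * v j * v i else 0) - (if l = j then c * v i * v j else 0)
        + c * c * v i * v j * (v l)\<^sup>2)"
      by (intro sum.cong refl) (auto simp: algebra_simps power2_eq_square)
    also have "\<dots> = (if i = j then 1 else 0) - c * v j * v i - c * v i * v j + c * c * v i * v j * N"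
      using that by (simp add: sum.distrib sum_subtractf N_def flip: sum_distrib_left)
    also have "c * c * v i * v j * N = (c * N) * (c * v i * v j)" by simp
    finally show ?thesis by (simp add: cN)
  qed
  have H: "reflection m v i j = of_real (?H i j)" if "i < m" "j < m" for i j
    using that by (simp add: reflection_def c_def N_def)
  have "(\<Sum>l<m. reflection m v i l * cnj (reflection m v j l)) = of_real (\<Sum>l<m. ?H i l * ?H j l)"
    if "i < m" "j < m" for i j
    unfolding of_real_sum by (rule sum.cong) (use that in \<open>simp_all only: H lessThan_iff complex_cnj_complex_of_real of_real_mult\<close>)
  moreover have "(\<Sum>l<m. cnj (reflection m v l i) * reflection m v l j) = of_real (\<Sum>l<m. ?H i l * ?H j l)"
    if "i < m" "j < m" for i j
    unfolding of_real_sum by (rule sum.cong)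
      (use that in \<open>simp_all only: H lessThan_iff complex_cnj_complex_of_real of_real_mult sym[of i] sym[of j]\<close>)
  ultimately show ?thesis
    unfolding unitary_matrix_def by (simp only: sq) (auto simp: reflection_def)
qed

lemma cnj_reflection: "cnj (reflection m v i j) = reflection m v i j"
  by (simp add: reflection_def)

text \<open>The reflection in the hyperplane orthogonal to \<open>\<epsilon>\<^sub>a - \<epsilon>\<^sub>b\<close> is the transposition of \<open>a\<close> and \<open>b\<close>.\<close>

lemma unitary_conj_transposition:
  fixes x :: "'a::complex_algebra clmat"
  assumes ab: "a < m" "b < m" "a \<noteq> b" and x: "x \<in> clmat m k UNIV" and c: "c \<noteq> 0"
  shows "unitary_conj m (reflection m (\<lambda>l. (if l = a then c else 0) - (if l = b then c else 0))) x =
    (\<lambda>i j. x (Transposition.transpose a b i) (Transposition.transpose a b j))"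
proof (intro ext)
  fix i j I
  let ?t = "Transposition.transpose a b" and ?v = "\<lambda>l. (if l = a then c else 0) - (if l = b then c else 0)"
  have "(?v l)\<^sup>2 = (if l = a then c\<^sup>2 else 0) + (if l = b then c\<^sup>2 else 0)" for l
    using ab by (cases "l = a"; cases "l = b") simp_all
  then have N: "(\<Sum>l<m. (?v l)\<^sup>2) = 2 * c\<^sup>2" using ab by (simp add: sum.distrib)
  define u :: "nat \<Rightarrow> real" where "u l = (if l = a then 1 else 0) - (if l = b then 1 else 0)" for l
  have "?v l = c * u l" for l by (simp add: u_def)
  then have "2 / (2 * c\<^sup>2) * ?v i * ?v j = u i * u j" for i j
    using c by (simp only:) (simp add: power2_eq_square)
  moreover have "(if i = j then 1 else 0) - u i * u j = (if j = ?t i then 1 else 0)" for i j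
  proof -
    consider "i = a" | "i = b" | "i \<noteq> a" "i \<noteq> b" by blast
    then show ?thesis using ab by cases (auto simp: u_def Transposition.transpose_def)
  qed
  ultimately have "(if i = j then 1 else 0) - 2 / (2 * c\<^sup>2) * ?v i * ?v j = (if j = ?t i then 1 else 0)" for i j
    by (simp only:)
  then have H: "reflection m ?v i j = (if i < m \<and> j = ?t i then 1 else 0)" if "j < m" for i j
    using that by (simp only: reflection_def N) simp
  have t: "?t i < m \<longleftrightarrow> i < m" for i using ab by (auto simp: Transposition.transpose_def)
  have "unitary_conj m (reflection m ?v) x i j I =
      (\<Sum>p<m. \<Sum>q<m. if q = ?t j then (if p = ?t i then (if i < m \<and> j < m then x p q I else 0) else 0) else 0)"
    unfolding unitary_conj_def
  proof (intro sum.cong refl)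
    fix p q assume "p \<in> {..<m}" "q \<in> {..<m}"
    then have "p < m" "q < m" by simp_all
    then show "(reflection m ?v i p * cnj (reflection m ?v j q)) *\<^sub>C x p q I =
        (if q = ?t j then (if p = ?t i then (if i < m \<and> j < m then x p q I else 0) else 0) else 0)"
      by (simp only: H) (simp add: scaleC_one complex_vector.scale_zero_left)
  qed
  also have "\<dots> = (if i < m \<and> j < m then x (?t i) (?t j) I else 0)"
    by (cases "i < m"; cases "j < m"; simp add: t)
  also have "\<dots> = x (?t i) (?t j) I"
    using x[unfolded clmat_iff, THEN conjunct2, rule_format, of "?t i" "?t j" I] t by auto
  finally show "unitary_conj m (reflection m ?v) x i j I = x (?t i) (?t j) I" .
qed

section \<open>Direct sums and the semigroup of Van Daele\<close>

lemma sum_lessThan_add: "(\<Sum>p<m + l. f p) = (\<Sum>p<m. f p) + (\<Sum>p<l. f (m + p) :: 'b::comm_monoid_add)" for l :: nat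
  by (induction l) (simp_all add: add.assoc)

lemma mat_dsum_assoc: "mat_dsum (m + l) (mat_dsum m x y) z = mat_dsum m x (mat_dsum l y z)"
proof (intro ext)
  fix i j I
  show "mat_dsum (m + l) (mat_dsum m x y) z i j I = mat_dsum m x (mat_dsum l y z) i j I"
  proof (cases "i < m \<or> j < m")
    case False
    then obtain i' j' where "i = m + i'" "j = m + j'" by (metis not_less le_Suc_ex)
    then show ?thesis by (simp add: mat_dsum_def)
  next
    case True
    then show ?thesis by (cases "i < m"; cases "j < m") (simp_all add: mat_dsum_def)
  qed
qed

lemma mat_dsum_diag: "mat_dsum m (mat_diag m e) (mat_diag l e) = mat_diag (m + l) e"
proof (intro ext)
  fix i j I
  show "mat_dsum m (mat_diag m e) (mat_diag l e) i j I = mat_diag (m + l) e i j I"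
    by (cases "i < m"; cases "j < m") (auto simp: mat_dsum_def mat_diag_def)
qed

lemma mat_dsum_diag_zero:
  assumes "x \<in> clmat m k UNIV"
  shows "mat_dsum m x (mat_diag 0 e) = x"
proof (intro ext)
  fix i j I
  show "mat_dsum m x (mat_diag 0 e) i j I = x i j I"
    using assms by (auto simp: mat_dsum_def mat_diag_def clmat_iff)
qed

lemma mat_dsum_cases:
  obtains "\<And>I. mat_dsum m x y i j I = x i j I" "i < m" "j < m"
    | "\<And>I. mat_dsum m x y i j I = y (i - m) (j - m) I" "m \<le> i" "m \<le> j"
    | "\<And>I. mat_dsum m x y i j I = 0" "i < m \<longleftrightarrow> \<not> j < m"
  by (cases "i < m"; cases "j < m") (auto simp: mat_dsum_def)

lemma continuous_on_mat_dsum: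
  fixes p q :: "real \<Rightarrow> 'a::unital_cstar_algebra clmat"
  assumes "continuous_on T p" "continuous_on T q"
  shows "continuous_on T (\<lambda>t. mat_dsum m (p t) (q t))"
proof (intro continuous_on_coordinatewise_then_product)
  fix i j I
  have entry: "continuous_on T (\<lambda>t. f t i j I)" if "continuous_on T f" for f :: "real \<Rightarrow> 'a clmat" and i j I
  proof -
    have "continuous_on T (\<lambda>t. f t i)" by (rule continuous_on_product_then_coordinatewise[OF that])
    from continuous_on_product_then_coordinatewise[OF this]
    have "continuous_on T (\<lambda>t. f t i j)" .
    from continuous_on_product_then_coordinatewise[OF this] show ?thesis .
  qed
  show "continuous_on T (\<lambda>t. mat_dsum m (p t) (q t) i j I)"
    by (cases "i < m"; cases "j < m") (simp_all add: mat_dsum_def entry assms)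
qed

lemma bounded_linear_scaleC_left: "bounded_linear (\<lambda>c. c *\<^sub>C (a :: 'a::unital_cstar_algebra))"
  by (rule bounded_linear_intro[where K = "norm a"])
    (simp_all add: scaleC_add_left scaleR_scaleC scaleC_scaleC norm_scaleC scaleR_conv_of_real)

context graded_cstar_algebra
begin

lemma mat_mult_dsum:
  "mat_mult gr (m + l) k (mat_dsum m x y) (mat_dsum m x' y') =
    mat_dsum m (mat_mult gr m k x x') (mat_mult gr l k y y')"
proof (intro ext)
  fix i j K
  show "mat_mult gr (m + l) k (mat_dsum m x y) (mat_dsum m x' y') i j K =
      mat_dsum m (mat_mult gr m k x x') (mat_mult gr l k y y') i j K"
    by (cases "i < m"; cases "j < m")
      (simp_all add: mat_mult_def sum_lessThan_add mat_dsum_def cl_mult_zero_left cl_mult_zero_right)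
qed

end

context graded_real_cstar_algebra
begin

lemma real_self_adjoint_dsum:
  assumes x: "real_self_adjoint r s p x" and y: "real_self_adjoint r s p y"
  shows "real_self_adjoint r s p (mat_dsum m x y)"
proof -
  have 0: "star (0 :: 'a) = 0" "gr 0 = 0" "rs 0 = 0"
    using star_add[of "0 :: 'a" 0] A.g_pow_zero[of 1] rs_add[of 0 0] by simp_all
  have "gr (mat_dsum m x y i j I) = (-1) ^ (p + card I) *\<^sub>C mat_dsum m x y i j I \<and>
      (finite I \<longrightarrow> star (mat_dsum m x y i j I) =
        (-1) ^ (card (I \<inter> {}) + (card I choose 2) + Suc p * card I) *\<^sub>C mat_dsum m x y j i I) \<and>
      rs (mat_dsum m x y i j I) = (-1) ^ card (I \<inter> {r..<r+s}) *\<^sub>C mat_dsum m x y i j I" for i j I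
  proof (cases rule: mat_dsum_cases[where m = m and x = x and y = y and i = i and j = j])
    case 1
    then have "mat_dsum m x y j i I = x j i I" by (simp add: mat_dsum_def)
    with 1 x show ?thesis by (simp add: real_self_adjoint_def A.homogeneous_def A.graded_adjoint_def)
  next
    case 2
    then have "mat_dsum m x y j i I = y (j - m) (i - m) I" by (simp add: mat_dsum_def)
    with 2 y show ?thesis by (simp add: real_self_adjoint_def A.homogeneous_def A.graded_adjoint_def)
  next
    case 3
    then have "mat_dsum m x y j i I = 0" by (auto simp: mat_dsum_def)
    with 3 show ?thesis by (simp add: 0 complex_vector.scale_zero_right)
  qed
  then show ?thesis
    unfolding real_self_adjoint_def A.homogeneous_def A.graded_adjoint_def by (intro conjI allI impI) simp_all
qed

lemma clmat_dsum: "x \<in> clmat m k S \<Longrightarrow> y \<in> clmat l k S \<Longrightarrow> 0 \<in> S \<Longrightarrow> mat_dsum m x y \<in> clmat (m + l) k S"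
  unfolding clmat_iff
proof (intro conjI allI impI; elim conjE)
  fix i j I
  assume "0 \<in> S" "i < m + l" "j < m + l" "I \<subseteq> {..<k}"
    "\<forall>i<m. \<forall>j<m. \<forall>I\<subseteq>{..<k}. x i j I \<in> S" "\<forall>i<l. \<forall>j<l. \<forall>I\<subseteq>{..<k}. y i j I \<in> S"
  then show "mat_dsum m x y i j I \<in> S"
    by (cases rule: mat_dsum_cases[where m = m and x = x and y = y and i = i and j = j]) (simp_all add: less_diff_conv2 add.commute)
next
  fix i j I
  assume *: "\<not> (i < m + l \<and> j < m + l \<and> I \<subseteq> {..<k})"
    "\<forall>i j I. \<not> (i < m \<and> j < m \<and> I \<subseteq> {..<k}) \<longrightarrow> x i j I = 0"
    "\<forall>i j I. \<not> (i < l \<and> j < l \<and> I \<subseteq> {..<k}) \<longrightarrow> y i j I = 0"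
  show "mat_dsum m x y i j I = 0"
  proof (cases rule: mat_dsum_cases[where m = m and x = x and y = y and i = i and j = j])
    case 1
    then show ?thesis using * by auto
  next
    case 2
    then have "\<not> (i - m < l \<and> j - m < l \<and> I \<subseteq> {..<k})" using *(1) by auto
    then show ?thesis using 2 *(3) by simp
  qed simp
qed

lemma real_osu_dsum:
  assumes "x \<in> real_osu gr rs r s m S" "y \<in> real_osu gr rs r s l S" "0 \<in> S"
  shows "mat_dsum m x y \<in> real_osu gr rs r s (m + l) S"
  using assms
  by (simp add: real_osu_iff clmat_dsum real_self_adjoint_dsum mat_mult_dsum mat_dsum_diag)

lemma osu_dsum:
  assumes "x \<in> osu gr m k S" "y \<in> osu gr l k S" "0 \<in> S"
  shows "mat_dsum m x y \<in> osu gr (m + l) k S"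
proof -
  have 0: "star (0 :: 'a) = 0" "gr 0 = 0"
    using star_add[of "0 :: 'a" 0] A.g_pow_zero[of 1] by simp_all
  have "cl_grading gr (mat_dsum m x y i j) = (\<lambda>I. - mat_dsum m x y i j I) \<and>
      cl_star gr (mat_dsum m x y j i) = mat_dsum m x y i j" for i j
    using assms(1,2) by (cases "i < m"; cases "j < m")
      (simp_all add: osu_def mat_dsum_def cl_grading_def cl_star_def fun_eq_iff 0 A.g_pow_zero
        complex_vector.scale_zero_right)
  then show ?thesis
    using assms by (simp add: osu_def clmat_dsum mat_mult_dsum mat_dsum_diag)
qed

lemma real_osu_diag:
  assumes e: "mat_diag 1 e \<in> real_osu gr rs r s 1 UNIV"
  shows "mat_diag n e \<in> real_osu gr rs r s n UNIV"
proof (induction n)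
  case 0
  have "mat_diag 0 e = (\<lambda>i j I. 0)" by (simp add: mat_diag_def fun_eq_iff)
  moreover have "real_self_adjoint r s 1 (\<lambda>i j I. 0)"
    using real_self_adjoint_linear[of r s 1 "mat_diag 1 e" "mat_diag 1 e" 0 0] e
    by (simp add: real_osu_iff)
  ultimately show ?case
    by (simp add: real_osu_iff clmat_iff mat_mult_def fun_eq_iff mat_diag_def)
next
  case (Suc n)
  from real_osu_dsum[OF Suc e] show ?case by (simp add: mat_dsum_diag)
qed

lemma real_osu_transposition:
  assumes x: "x \<in> real_osu gr rs r s n UNIV" and ab: "a < n" "b < n" "a \<noteq> b"
  shows "(\<lambda>i j. x (Transposition.transpose a b i) (Transposition.transpose a b j))
    \<in> real_osu gr rs r s n UNIV"
proof -
  let ?v = "\<lambda>l. (if l = a then 1 else 0) - (if l = b then 1 else 0) :: real"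
  have "0 < (\<Sum>l<n. (?v l)\<^sup>2)"
    by (rule sum_pos2[of _ a]) (use ab in auto)
  then have U: "unitary_matrix n (reflection n ?v)" by (intro unitary_reflection) simp
  have "x \<in> clmat n (r + s) UNIV" using x by (simp add: real_osu_iff)
  from unitary_conj_real_osu[OF U cnj_reflection x] unitary_conj_transposition[OF ab this, of 1]
  show ?thesis by simp
qed

text \<open>A transposition is a reflection, of determinant -1, and so is not connected to the identity by a
  path of orthogonal matrices.  But \<open>e\<close> is invariant under conjugation by \<open>-1\<close>: conjugation by the
  reflection in the last coordinate fixes \<open>x \<oplus> e\<close>, and moving its hyperplane ends at the
  transposition of \<open>a\<close> and \<open>b\<close>.\<close>

lemma transposition_homotopic:
  assumes x: "x \<in> real_osu gr rs r s n UNIV" and e: "mat_diag 1 e \<in> real_osu gr rs r s 1 UNIV"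
    and ab: "a < n" "b < n" "a \<noteq> b"
  shows "path_component (real_osu gr rs r s (n + 1) UNIV) (mat_dsum n x (mat_diag 1 e))
    (mat_dsum n (\<lambda>i j. x (Transposition.transpose a b i) (Transposition.transpose a b j)) (mat_diag 1 e))"
proof -
  let ?t = "Transposition.transpose a b" and ?m = "n + 1"
  define w where "w = mat_dsum n x (mat_diag 1 e)"
  (* The normal vector moves from the last coordinate vector to the difference of those of a and b. *)
  define v where "v t l = (if l = n then 1 - t else 0) + (if l = a then t else 0) - (if l = b then t else 0)"
    for t :: real and l
  define N where "N t = (\<Sum>l<?m. (v t l)\<^sup>2)" for t
  define P where "P t = unitary_conj ?m (reflection ?m (v t)) w" for t
  have w: "w \<in> real_osu gr rs r s ?m UNIV" unfolding w_def by (rule real_osu_dsum[OF x e]) simp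
  then have wc: "w \<in> clmat ?m (r + s) UNIV" by (simp add: real_osu_iff)
  have "(v t l)\<^sup>2 = (if l = n then (1 - t)\<^sup>2 else 0) + (if l = a then t\<^sup>2 else 0) + (if l = b then t\<^sup>2 else 0)" for t l
    using ab by (cases "l = a"; cases "l = b"; cases "l = n") (simp_all add: v_def)
  then have N: "N t = (1 - t)\<^sup>2 + 2 * t\<^sup>2" for t
    using ab by (simp add: N_def sum.distrib del: sum.lessThan_Suc)
  have N0: "N t \<noteq> 0" for t
    unfolding N by (smt (verit) zero_le_power2 power2_eq_iff_nonneg power2_less_eq_zero_iff zero_eq_power2)
  have PS: "P t \<in> real_osu gr rs r s ?m UNIV" for t
    unfolding P_def
    by (rule unitary_conj_real_osu[OF unitary_reflection cnj_reflection w]) (use N0[of t] in \<open>simp add: N_def\<close>)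
  have v_cont: "continuous_on {0..1} (\<lambda>t. v t i)" for i
    unfolding v_def by (cases "i = n"; cases "i = a"; cases "i = b") (simp_all add: continuous_intros)
  have "continuous_on {0..1} (\<lambda>t. reflection ?m (v t) i j)" for i j
  proof (cases "i < ?m \<and> j < ?m")
    case True
    have "continuous_on {0..1} N" unfolding N by (intro continuous_intros)
    then have "continuous_on {0..1} (\<lambda>t. (if i = j then 1 else 0) - 2 / N t * v t i * v t j)"
      using N0 by (intro continuous_intros v_cont) auto
    then show ?thesis
      unfolding reflection_def if_P[OF True] N_def by (rule continuous_on_of_real)
  next
    case False
    then show ?thesis by (simp only: reflection_def if_False continuous_on_const)
  qed
  then have "continuous_on {0..1} P"
    unfolding P_def unitary_conj_def
    by (intro continuous_on_coordinatewise_then_product continuous_on_sum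
      bounded_linear.continuous_on[OF bounded_linear_scaleC_left] continuous_on_mult continuous_on_cnj)
  moreover have "P 0 = w"
  proof (intro ext)
    fix i j I
    have v0: "v 0 l = (if l = n then 1 else 0)" for l using ab by (simp add: v_def)
    have N: "(\<Sum>l<?m. (v 0 l)\<^sup>2) = 1" using N[of 0] by (simp add: N_def)
    have H: "reflection ?m (v 0) i p = (if p = i \<and> i < ?m then (if i = n then -1 else 1) else 0)" if "p < ?m" for i p
      using that unfolding reflection_def N v0 by auto
    have "P 0 i j I = (\<Sum>p<?m. \<Sum>q<?m. if q = j then (if p = i then w p q I else 0) else 0)"
      unfolding P_def unitary_conj_def
    proof (intro sum.cong refl)
      fix p q assume "p \<in> {..<?m}" "q \<in> {..<?m}"
      then have pq: "p < ?m" "q < ?m" by simp_all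
      have "w p q I = 0" if "(p = n) \<noteq> (q = n)" using that pq by (auto simp: w_def mat_dsum_def)
      then show "(reflection ?m (v 0) i p * cnj (reflection ?m (v 0) j q)) *\<^sub>C w p q I =
          (if q = j then (if p = i then w p q I else 0) else 0)"
        using pq unfolding H[OF pq(1)] H[OF pq(2)]
        by (auto simp: scaleC_one complex_vector.scale_zero_left complex_vector.scale_zero_right)
    qed
    also have "\<dots> = (if i < ?m \<and> j < ?m then w i j I else 0)"
      by (cases "i < ?m"; cases "j < ?m"; simp del: sum.lessThan_Suc)
    also have "\<dots> = w i j I" using wc[unfolded clmat_iff, THEN conjunct2, rule_format, of i j I] by auto
    finally show "P 0 i j I = w i j I" .
  qed
  moreover have "P 1 = mat_dsum n (\<lambda>i j. x (?t i) (?t j)) (mat_diag 1 e)"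
  proof -
    have "v 1 = (\<lambda>l. (if l = a then 1 else 0) - (if l = b then 1 else 0))" by (simp add: v_def fun_eq_iff)
    then have "P 1 = (\<lambda>i j. w (?t i) (?t j))"
      unfolding P_def using unitary_conj_transposition[OF _ _ ab(3) wc, of 1] ab by simp
    moreover have t: "?t i < n \<longleftrightarrow> i < n" "\<not> i < n \<Longrightarrow> ?t i = i" for i
      using ab by (auto simp: Transposition.transpose_def)
    have t': "n \<le> ?t i \<longleftrightarrow> n \<le> i" for i using t(1)[of i] by linarith
    have "w (?t i) (?t j) I = mat_dsum n (\<lambda>i j. x (?t i) (?t j)) (mat_diag 1 e) i j I" for i j I
      by (cases "i < n"; cases "j < n") (simp_all add: w_def mat_dsum_def t t')
    ultimately show ?thesis by (simp add: fun_eq_iff)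
  qed
  ultimately show ?thesis
    unfolding path_component_def w_def[symmetric] using PS
    by (intro exI[of _ P]) (auto simp: path_def path_image_def pathstart_def pathfinish_def)
qed

end

text \<open>What the definition of Van Daele's group needs to know about the spaces \<open>S m\<close>: closure under
  direct sums, and that simultaneous transpositions of rows and columns are stably homotopic to the
  identity.\<close>

locale van_daele =
  fixes S :: "nat \<Rightarrow> 'a::unital_cstar_algebra clmat set" and e :: "'a cl" and k :: nat
  assumes S_clmat: "x \<in> S m \<Longrightarrow> x \<in> clmat m k UNIV"
    and S_dsum: "x \<in> S m \<Longrightarrow> y \<in> S l \<Longrightarrow> mat_dsum m x y \<in> S (m + l)"
    and S_diag: "mat_diag m e \<in> S m"
    and S_transposition: "x \<in> S m \<Longrightarrow> a < m \<Longrightarrow> b < m \<Longrightarrow> a \<noteq> b \<Longrightarrow>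
      (\<lambda>i j. x (Transposition.transpose a b i) (Transposition.transpose a b j)) \<in> S m"
    and S_homotopic: "x \<in> S m \<Longrightarrow> a < m \<Longrightarrow> b < m \<Longrightarrow> a \<noteq> b \<Longrightarrow>
      path_component (S (m + 1)) (mat_dsum m x (mat_diag 1 e))
        (mat_dsum m (\<lambda>i j. x (Transposition.transpose a b i) (Transposition.transpose a b j)) (mat_diag 1 e))"
begin

lemma path_component_dsum_right:
  assumes xy: "path_component (S m) x y" and z: "z \<in> S l"
  shows "path_component (S (m + l)) (mat_dsum m x z) (mat_dsum m y z)"
proof -
  obtain p where p: "path p" "path_image p \<subseteq> S m" "pathstart p = x" "pathfinish p = y"
    using xy unfolding path_component_def by blast
  have "path (\<lambda>t. mat_dsum m (p t) z)"
    using p(1) unfolding path_def by (intro continuous_on_mat_dsum continuous_on_const)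
  moreover have "path_image (\<lambda>t. mat_dsum m (p t) z) \<subseteq> S (m + l)"
    using p(2) z S_dsum by (auto simp: path_image_def)
  ultimately show ?thesis
    unfolding path_component_def using p(3,4)
    by (intro exI[of _ "\<lambda>t. mat_dsum m (p t) z"]) (auto simp: pathstart_def pathfinish_def)
qed

lemma path_component_dsum_left:
  assumes xy: "path_component (S m) x y" and z: "z \<in> S l"
  shows "path_component (S (l + m)) (mat_dsum l z x) (mat_dsum l z y)"
proof -
  obtain p where p: "path p" "path_image p \<subseteq> S m" "pathstart p = x" "pathfinish p = y"
    using xy unfolding path_component_def by blast
  have "path (\<lambda>t. mat_dsum l z (p t))"
    using p(1) unfolding path_def by (intro continuous_on_mat_dsum continuous_on_const)
  moreover have "path_image (\<lambda>t. mat_dsum l z (p t)) \<subseteq> S (l + m)"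
    using p(2) z S_dsum by (auto simp: path_image_def)
  ultimately show ?thesis
    unfolding path_component_def using p(3,4)
    by (intro exI[of _ "\<lambda>t. mat_dsum l z (p t)"]) (auto simp: pathstart_def pathfinish_def)
qed

lemma vd_relI:
  assumes "1 \<le> m" "1 \<le> l" "x \<in> S m" "y \<in> S l" "m \<le> n" "l \<le> n"
    "path_component (S n) (mat_dsum m x (mat_diag (n - m) e)) (mat_dsum l y (mat_diag (n - l) e))"
  shows "((m, x), (l, y)) \<in> vd_rel S e"
  using assms unfolding vd_rel_def by blast

lemma vd_relE:
  assumes "((m, x), (l, y)) \<in> vd_rel S e"
  obtains n0 where "1 \<le> m" "1 \<le> l" "x \<in> S m" "y \<in> S l" "m \<le> n0" "l \<le> n0"
    "\<And>n. n0 \<le> n \<Longrightarrow>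
      path_component (S n) (mat_dsum m x (mat_diag (n - m) e)) (mat_dsum l y (mat_diag (n - l) e))"
proof -
  obtain n0 where *: "1 \<le> m" "1 \<le> l" "x \<in> S m" "y \<in> S l" "m \<le> n0" "l \<le> n0"
    and pc: "path_component (S n0) (mat_dsum m x (mat_diag (n0 - m) e)) (mat_dsum l y (mat_diag (n0 - l) e))"
    using assms unfolding vd_rel_def by blast
  have pad: "mat_dsum n0 (mat_dsum m x (mat_diag (n0 - m) e)) (mat_diag (n - n0) e) =
      mat_dsum m x (mat_diag (n - m) e)" if "m \<le> n0" "n0 \<le> n" for m n and x :: "'a clmat"
    using that mat_dsum_assoc[of m "n0 - m" x "mat_diag (n0 - m) e" "mat_diag (n - n0) e"]
    by (simp add: mat_dsum_diag)
  have "path_component (S n) (mat_dsum m x (mat_diag (n - m) e)) (mat_dsum l y (mat_diag (n - l) e))"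
    if "n0 \<le> n" for n
    using path_component_dsum_right[OF pc S_diag[of "n - n0"]] that * by (simp add: pad)
  then show ?thesis using that * by blast
qed

lemma vd_rel_homotopic:
  assumes "1 \<le> m" "path_component (S m) x y"
  shows "((m, x), (m, y)) \<in> vd_rel S e"
proof -
  have xy: "x \<in> S m" "y \<in> S m" using path_component_mem[OF assms(2)] by auto
  then show ?thesis
    using assms S_clmat by (intro vd_relI[of _ _ _ _ m]) (simp_all add: mat_dsum_diag_zero[of _ m k])
qed

lemma vd_rel_refl: "1 \<le> m \<Longrightarrow> x \<in> S m \<Longrightarrow> ((m, x), (m, x)) \<in> vd_rel S e"
  by (rule vd_rel_homotopic) (auto intro: path_component_refl)

lemma vd_rel_sym: "(u, v) \<in> vd_rel S e \<Longrightarrow> (v, u) \<in> vd_rel S e"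
  unfolding vd_rel_def using path_component_sym by fastforce

lemma vd_rel_trans:
  assumes "(u, v) \<in> vd_rel S e" "(v, w) \<in> vd_rel S e"
  shows "(u, w) \<in> vd_rel S e"
proof -
  obtain m x l y p z where uvw: "u = (m, x)" "v = (l, y)" "w = (p, z)" by (metis surj_pair)
  obtain n1 where n1: "1 \<le> m" "x \<in> S m" "m \<le> n1" "l \<le> n1"
    "\<And>n. n1 \<le> n \<Longrightarrow>
      path_component (S n) (mat_dsum m x (mat_diag (n - m) e)) (mat_dsum l y (mat_diag (n - l) e))"
    using assms(1) unfolding uvw by (rule vd_relE) blast
  obtain n2 where n2: "1 \<le> p" "z \<in> S p" "p \<le> n2"
    "\<And>n. n2 \<le> n \<Longrightarrow>
      path_component (S n) (mat_dsum l y (mat_diag (n - l) e)) (mat_dsum p z (mat_diag (n - p) e))"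
    using assms(2) unfolding uvw by (rule vd_relE) blast
  show ?thesis
    unfolding uvw using n1 n2 path_component_trans[OF n1(5)[of "max n1 n2"] n2(4)[of "max n1 n2"]]
    by (intro vd_relI[of _ _ _ _ "max n1 n2"]) auto
qed

lemma equiv_vd_rel: "equiv {(m, x). 1 \<le> m \<and> x \<in> S m} (vd_rel S e)"
proof (rule equivI)
  show "vd_rel S e \<subseteq> {(m, x). 1 \<le> m \<and> x \<in> S m} \<times> {(m, x). 1 \<le> m \<and> x \<in> S m}"
    by (auto simp: vd_rel_def)
  show "refl_on {(m, x). 1 \<le> m \<and> x \<in> S m} (vd_rel S e)"
    by (rule refl_onI) (auto intro: vd_rel_refl)
  show "sym (vd_rel S e)" by (rule symI) (rule vd_rel_sym)
  show "trans (vd_rel S e)" by (rule transI) (rule vd_rel_trans)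
qed

lemma vd_rel_permute:
  assumes "\<pi> permutes {..<m}" "1 \<le> m" "x \<in> S m"
  shows "((m, x), (m, \<lambda>i j. x (\<pi> i) (\<pi> j))) \<in> vd_rel S e"
proof -
  have "finite {..<m}" by simp
  with assms(1) have "\<forall>x\<in>S m. ((m, x), (m, \<lambda>i j. x (\<pi> i) (\<pi> j))) \<in> vd_rel S e"
  proof (induction rule: permutes_induct)
    case id
    then show ?case using assms(2) vd_rel_refl by simp
  next
    case (swap a b p)
    show ?case
    proof
      fix x assume x: "x \<in> S m"
      let ?y = "\<lambda>i j. x (Transposition.transpose a b i) (Transposition.transpose a b j)"
      have ab: "a < m" "b < m" "a \<noteq> b" using swap by auto
      have y: "?y \<in> S m" by (rule S_transposition[OF x ab])
      have "((m, x), (m, ?y)) \<in> vd_rel S e"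
        by (rule vd_relI[where n = "m + 1"]) (use assms(2) x y S_homotopic[OF x ab] in simp_all)
      moreover have "((m, ?y), (m, \<lambda>i j. ?y (p i) (p j))) \<in> vd_rel S e"
        using swap.IH y by blast
      ultimately show "((m, x), (m, \<lambda>i j. x ((Transposition.transpose a b \<circ> p) i)
          ((Transposition.transpose a b \<circ> p) j))) \<in> vd_rel S e"
        unfolding comp_def by (rule vd_rel_trans)
    qed
  qed
  then show ?thesis using assms(3) by blast
qed

text \<open>Interchanging the two blocks is a permutation of the indices.\<close>

lemma vd_rel_dsum_commute:
  assumes "1 \<le> m" "1 \<le> l" and x: "x \<in> S m" and y: "y \<in> S l"
  shows "((l + m, mat_dsum l y x), (m + l, mat_dsum m x y)) \<in> vd_rel S e"
proof -
  define \<pi> where "\<pi> i = (if i < m then i + l else if i < m + l then i - m else i)" for i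
  have "bij_betw \<pi> {..<l + m} {..<l + m}"
    by (rule bij_betw_byWitness[of _ "\<lambda>i. if i < l then i + m else if i < l + m then i - l else i"])
      (auto simp: \<pi>_def)
  then have "\<pi> permutes {..<l + m}" by (rule bij_imp_permutes) (auto simp: \<pi>_def)
  then have "((l + m, mat_dsum l y x), (l + m, \<lambda>i j. mat_dsum l y x (\<pi> i) (\<pi> j))) \<in> vd_rel S e"
    by (rule vd_rel_permute) (use assms S_dsum in auto)
  moreover have "(\<lambda>i j. mat_dsum l y x (\<pi> i) (\<pi> j)) = mat_dsum m x y"
  proof (intro ext)
    fix i j I
    have out: "x i j I = 0" if "\<not> (i < m \<and> j < m)" for i j
      using S_clmat[OF x, unfolded clmat_iff, THEN conjunct2, rule_format] that by blast
    have out': "y i j I = 0" if "\<not> (i < l \<and> j < l)" for i j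
      using S_clmat[OF y, unfolded clmat_iff, THEN conjunct2, rule_format] that by blast
    consider "i < m" "j < m" | "i < m" "m \<le> j" | "m \<le> i" "j < m" | "m \<le> i" "m \<le> j" by linarith
    then show "mat_dsum l y x (\<pi> i) (\<pi> j) I = mat_dsum m x y i j I"
    proof cases
      case 1
      then show ?thesis by (simp add: \<pi>_def mat_dsum_def)
    next
      case 2
      then show ?thesis by (cases "j < m + l") (auto simp: \<pi>_def mat_dsum_def intro!: out)
    next
      case 3
      then show ?thesis by (cases "i < m + l") (auto simp: \<pi>_def mat_dsum_def intro!: out)
    next
      case 4
      show ?thesis
      proof (cases "i < m + l \<and> j < m + l")
        case True
        with 4 show ?thesis by (simp add: \<pi>_def mat_dsum_def less_diff_conv2 add.commute)
      next
        case False
        then have "y (i - m) (j - m) I = 0" using 4 by (intro out') auto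
        moreover have "mat_dsum l y x (\<pi> i) (\<pi> j) I = 0"
          using 4 False by (cases "i < m + l"; cases "j < m + l") (auto simp: \<pi>_def mat_dsum_def intro!: out)
        ultimately show ?thesis using 4 by (simp add: mat_dsum_def)
      qed
    qed
  qed
  ultimately show ?thesis by (simp add: add.commute)
qed

lemma vd_rel_dsum_left:
  assumes xx': "((m, x), (m', x')) \<in> vd_rel S e" and y: "1 \<le> l" "y \<in> S l"
  shows "((l + m, mat_dsum l y x), (l + m', mat_dsum l y x')) \<in> vd_rel S e"
proof -
  obtain n where n: "1 \<le> m" "1 \<le> m'" "x \<in> S m" "x' \<in> S m'" "m \<le> n" "m' \<le> n"
    "path_component (S n) (mat_dsum m x (mat_diag (n - m) e)) (mat_dsum m' x' (mat_diag (n - m') e))"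
    using xx' unfolding vd_rel_def by blast
  show ?thesis
    using n y S_dsum path_component_dsum_left[OF n(7) y(2)]
    by (intro vd_relI[where n = "l + n"]) (simp_all add: mat_dsum_assoc)
qed

text \<open>Stabilisation adds the basepoint at the end.  It is therefore compatible with changing the second
  summand, and commutativity reduces a change of the first summand to this case.\<close>

lemma vd_rel_dsum:
  assumes x: "((m, x), (m', x')) \<in> vd_rel S e" and y: "((l, y), (l', y')) \<in> vd_rel S e"
  shows "((m + l, mat_dsum m x y), (m' + l', mat_dsum m' x' y')) \<in> vd_rel S e"
proof -
  have S: "1 \<le> m" "x \<in> S m" "1 \<le> m'" "x' \<in> S m'" "1 \<le> l" "y \<in> S l"
    using x y by (auto simp: vd_rel_def)
  have "((m + l, mat_dsum m x y), (l + m, mat_dsum l y x)) \<in> vd_rel S e"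
    using S by (intro vd_rel_dsum_commute)
  moreover have "((l + m, mat_dsum l y x), (l + m', mat_dsum l y x')) \<in> vd_rel S e"
    using x S by (intro vd_rel_dsum_left)
  moreover have "((l + m', mat_dsum l y x'), (m' + l, mat_dsum m' x' y)) \<in> vd_rel S e"
    using S by (intro vd_rel_dsum_commute)
  moreover have "((m' + l, mat_dsum m' x' y), (m' + l', mat_dsum m' x' y')) \<in> vd_rel S e"
    using y S by (intro vd_rel_dsum_left)
  ultimately show ?thesis by (meson vd_rel_trans)
qed

lemma vd_class_eq: "((m, x), (l, y)) \<in> vd_rel S e \<Longrightarrow> vd_class S e m x = vd_class S e l y"
  unfolding vd_class_def using equiv_vd_rel by (rule equiv_class_eq)

lemma vd_class_in_semigroup: "1 \<le> m \<Longrightarrow> x \<in> S m \<Longrightarrow> vd_class S e m x \<in> vd_semigroup S e"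
  unfolding vd_class_def vd_semigroup_def by (rule quotientI) simp

lemma vd_semigroupE:
  assumes "u \<in> vd_semigroup S e"
  obtains m x where "1 \<le> m" "x \<in> S m" "u = vd_class S e m x"
  using assms unfolding vd_semigroup_def vd_class_def by (auto elim!: quotientE)

lemma vd_add_class:
  assumes "1 \<le> m" "x \<in> S m" "1 \<le> l" "y \<in> S l"
  shows "vd_add S e (vd_class S e m x) (vd_class S e l y) = vd_class S e (m + l) (mat_dsum m x y)"
proof -
  let ?C = "vd_class S e (m + l) (mat_dsum m x y)"
  have C: "vd_class S e (m' + l') (mat_dsum m' x' y') = ?C"
    if "(m', x') \<in> vd_class S e m x" "(l', y') \<in> vd_class S e l y" for m' x' l' y'
  proof -
    have "((m, x), (m', x')) \<in> vd_rel S e" "((l, y), (l', y')) \<in> vd_rel S e"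
      using that by (simp_all add: vd_class_def)
    then show ?thesis by (rule vd_class_eq[OF vd_rel_dsum, symmetric])
  qed
  have ne: "vd_class S e m x \<noteq> {}" "vd_class S e l y \<noteq> {}"
    using assms vd_rel_refl by (auto simp: vd_class_def)
  have "vd_add S e (vd_class S e m x) (vd_class S e l y) =
      (\<Union>p\<in>vd_class S e m x. \<Union>q\<in>vd_class S e l y. ?C)"
    unfolding vd_add_def
  proof (rule SUP_cong[OF refl])
    fix p assume p: "p \<in> vd_class S e m x"
    show "(case p of (m', x') \<Rightarrow> \<Union>(l', y')\<in>vd_class S e l y. vd_class S e (m' + l') (mat_dsum m' x' y')) =
        (\<Union>q\<in>vd_class S e l y. ?C)"
    proof (cases p)
      case (Pair m' x')
      show ?thesis
        unfolding Pair prod.case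
      proof (rule SUP_cong[OF refl])
        fix q assume q: "q \<in> vd_class S e l y"
        show "(case q of (l', y') \<Rightarrow> vd_class S e (m' + l') (mat_dsum m' x' y')) = ?C"
          using C[of m' x'] p q Pair by (cases q) simp
      qed
    qed
  qed
  also have "\<dots> = ?C" using ne by simp
  finally show ?thesis .
qed

lemma vd_add_in_semigroup:
  assumes "u \<in> vd_semigroup S e" "v \<in> vd_semigroup S e"
  shows "vd_add S e u v \<in> vd_semigroup S e"
proof -
  obtain m x l y where *: "1 \<le> m" "x \<in> S m" "u = vd_class S e m x" "1 \<le> l" "y \<in> S l" "v = vd_class S e l y"
    using assms by (metis vd_semigroupE)
  then show ?thesis
    using vd_class_in_semigroup[OF _ S_dsum[of x m y l]] by (simp add: vd_add_class)
qed

end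

lemma (in graded_real_cstar_algebra) van_daele_real_osu:
  assumes "mat_diag 1 e \<in> real_osu gr rs r s 1 UNIV"
  shows "van_daele (\<lambda>m. real_osu gr rs r s m UNIV) e (r + s)"
proof (rule van_daele.intro)
  fix x y :: "'a clmat" and m l a b :: nat
  assume x: "x \<in> real_osu gr rs r s m UNIV"
  then show "x \<in> clmat m (r + s) UNIV" by (simp add: real_osu_iff)
  show "mat_dsum m x y \<in> real_osu gr rs r s (m + l) UNIV" if "y \<in> real_osu gr rs r s l UNIV"
    using x that by (rule real_osu_dsum) simp
  assume ab: "a < m" "b < m" "a \<noteq> b"
  show "(\<lambda>i j. x (Transposition.transpose a b i) (Transposition.transpose a b j)) \<in> real_osu gr rs r s m UNIV"
    by (rule real_osu_transposition[OF x ab])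
  show "path_component (real_osu gr rs r s (m + 1) UNIV) (mat_dsum m x (mat_diag 1 e))
      (mat_dsum m (\<lambda>i j. x (Transposition.transpose a b i) (Transposition.transpose a b j)) (mat_diag 1 e))"
    by (rule transposition_homotopic[OF x assms ab])
qed (rule real_osu_diag[OF assms])


section \<open>Homomorphisms on a Grothendieck group\<close>

context
  fixes V :: "'v set" and add :: "'v \<Rightarrow> 'v \<Rightarrow> 'v"
  assumes add_closed: "u \<in> V \<Longrightarrow> v \<in> V \<Longrightarrow> add u v \<in> V"
begin

lemma normal_grothendieck_rels: "grothendieck_rels V add \<lhd> free_Abelian_group V"
proof -
  interpret comm_group "free_Abelian_group V" by (rule abelian_free_Abelian_group)
  have "{frag_of (add u v) - frag_of u - frag_of v | u v. u \<in> V \<and> v \<in> V} \<subseteq> carrier (free_Abelian_group V)"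
  proof clarify
    fix u v assume "u \<in> V" "v \<in> V"
    then show "frag_of (add u v) - frag_of u - frag_of v \<in> carrier (free_Abelian_group V)"
      using add_closed keys_diff[of "frag_of (add u v) - frag_of u" "frag_of v"]
        keys_diff[of "frag_of (add u v)" "frag_of u"]
      by (auto simp: carrier_free_Abelian_group_iff)
  qed
  then have "subgroup (grothendieck_rels V add) (free_Abelian_group V)"
    unfolding grothendieck_rels_def by (rule generate_is_subgroup)
  then show ?thesis by (rule subgroup_imp_normal)
qed

text \<open>Such a homomorphism lifts to the free abelian group, where it vanishes on the relations and is
  determined by its values on the generators.\<close>

lemma
  assumes \<Phi>: "\<Phi> \<in> hom (grothendieck_group V add) complex_add_group"
  shows grothendieck_hom_add: "u \<in> V \<Longrightarrow> v \<in> V \<Longrightarrow> \<Phi> (grothendieck_class V add (add u v)) =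
      \<Phi> (grothendieck_class V add u) + \<Phi> (grothendieck_class V add v)"
    and grothendieck_hom_eq_zero: "(\<And>v. v \<in> V \<Longrightarrow> \<Phi> (grothendieck_class V add v) = 0) \<Longrightarrow>
      g \<in> carrier (grothendieck_group V add) \<Longrightarrow> \<Phi> g = 0"
proof -
  let ?G = "free_Abelian_group V" and ?H = "grothendieck_rels V add"
  interpret G: comm_group ?G by (rule abelian_free_Abelian_group)
  define \<Psi> where "\<Psi> c = \<Phi> (?H #>\<^bsub>?G\<^esub> c)" for c
  have "\<Phi> \<circ> (\<lambda>c. ?H #>\<^bsub>?G\<^esub> c) \<in> hom ?G complex_add_group"
    using hom_compose[OF normal.r_coset_hom_Mod[OF normal_grothendieck_rels]
      \<Phi>[unfolded grothendieck_group_def]] .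
  from hom_mult[OF this] have \<Psi>_add: "\<Psi> (b + c) = \<Psi> b + \<Psi> c"
    if "Poly_Mapping.keys b \<subseteq> V" "Poly_Mapping.keys c \<subseteq> V" for b c
    using that by (simp add: \<Psi>_def complex_add_group_def)
  have \<Psi>_zero: "\<Psi> 0 = 0" using \<Psi>_add[of 0 0] by simp
  have sub: "subgroup ?H ?G" using normal_grothendieck_rels by (rule normal_imp_subgroup)
  have \<Psi>_rel: "\<Psi> h = 0" if "h \<in> ?H" for h
  proof -
    have "?H #>\<^bsub>?G\<^esub> h = ?H #>\<^bsub>?G\<^esub> 0"
      using G.coset_join2[OF _ sub that] G.coset_join2[OF _ sub, of 0] subgroup.one_closed[OF sub]
        subgroup.mem_carrier[OF sub that] by simp
    then show ?thesis using \<Psi>_zero by (simp add: \<Psi>_def)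
  qed
  show "\<Phi> (grothendieck_class V add (add u v)) =
      \<Phi> (grothendieck_class V add u) + \<Phi> (grothendieck_class V add v)" if uv: "u \<in> V" "v \<in> V"
  proof -
    let ?h = "frag_of (add u v) - frag_of u - frag_of v"
    have h: "?h \<in> ?H"
      unfolding grothendieck_rels_def using uv by (intro generate.incl) blast
    then have kh: "Poly_Mapping.keys ?h \<subseteq> V" using subgroup.mem_carrier[OF sub] by simp
    have kuv: "Poly_Mapping.keys (frag_of u + frag_of v) \<subseteq> V"
      using uv Poly_Mapping.keys_add[of "frag_of u" "frag_of v"] by auto
    have "\<Psi> (frag_of (add u v)) = \<Psi> (?h + (frag_of u + frag_of v))" by simp
    also have "\<dots> = \<Psi> (frag_of u) + \<Psi> (frag_of v)"
      using \<Psi>_add[OF kh kuv] \<Psi>_rel[OF h] \<Psi>_add[of "frag_of u" "frag_of v"] uv by simp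
    finally show ?thesis by (simp add: \<Psi>_def grothendieck_class_def)
  qed
  show "\<Phi> g = 0" if 0: "\<And>v. v \<in> V \<Longrightarrow> \<Phi> (grothendieck_class V add v) = 0"
    and g: "g \<in> carrier (grothendieck_group V add)"
  proof -
    obtain c where c: "Poly_Mapping.keys c \<subseteq> V" "g = ?H #>\<^bsub>?G\<^esub> c"
      using g by (auto simp: grothendieck_group_def FactGroup_def RCOSETS_def)
    from c(1) have "Poly_Mapping.keys c \<subseteq> V \<and> \<Psi> c = 0"
    proof (induction rule: frag_induction)
      case zero
      then show ?case by (simp add: \<Psi>_zero)
    next
      case (one v)
      then show ?case using 0[of v] by (simp add: \<Psi>_def grothendieck_class_def)
    next
      case (diff b c)
      then have k: "Poly_Mapping.keys (b - c) \<subseteq> V" using keys_diff[of b c] by blast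
      then show ?case using diff \<Psi>_add[of "b - c" c] by simp
    qed
    then show ?thesis by (simp add: c \<Psi>_def)
  qed
qed

end

section \<open>Doubled classes have representatives over the domain algebra\<close>

text \<open>Density is used in this form: the topology is that of coordinatewise convergence, and a matrix has
  finitely many coordinates that can be nonzero.\<close>

lemma closure_approx_coordinates:
  fixes x :: "'a::unital_cstar_algebra clmat"
  assumes "x \<in> closure T" "finite F" "0 < \<epsilon>"
  obtains y where "y \<in> T" "\<And>i j I. (i, j, I) \<in> F \<Longrightarrow> norm (y i j I - x i j I) < \<epsilon>"
proof -
  let ?U = "\<Inter>(i, j, I)\<in>F. {y :: 'a clmat. dist (y i j I) (x i j I) < \<epsilon>}"
  have "open {y :: 'a clmat. dist (y i j I) (x i j I) < \<epsilon>}" for i j I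
  proof (intro open_Collect_less continuous_intros)
    have "continuous_on UNIV (\<lambda>y :: 'a clmat. y i)" by (rule continuous_on_product_coordinates)
    from continuous_on_product_then_coordinatewise[OF this]
    have "continuous_on UNIV (\<lambda>y :: 'a clmat. y i j)" .
    from continuous_on_product_then_coordinatewise[OF this]
    show "continuous_on UNIV (\<lambda>y :: 'a clmat. y i j I)" .
  qed
  then have "open ?U" using assms(2) by (intro open_INT) auto
  moreover have "x \<in> ?U" using assms(3) by auto
  ultimately obtain y where "y \<in> T" "y \<in> ?U"
    using assms(1) by (meson closure_iff_nhds_not_empty disjoint_iff order_refl)
  have "norm (y i j I - x i j I) < \<epsilon>" if "(i, j, I) \<in> F" for i j I
    using INT_D[OF \<open>y \<in> ?U\<close> that] by (simp add: dist_norm)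
  then show ?thesis using \<open>y \<in> T\<close> that by blast
qed

definition inv_sqrt2 :: complex where
  "inv_sqrt2 = of_real (1 / sqrt 2)"

lemma inv_sqrt2_square: "inv_sqrt2 * inv_sqrt2 = 1 / 2" "inv_sqrt2 * (inv_sqrt2 * c) = c / 2"
  "inv_sqrt2 * (c * inv_sqrt2) = c / 2" "c * inv_sqrt2 * inv_sqrt2 = c / 2"
  "c * inv_sqrt2 * (d * inv_sqrt2) = c * d / 2" "cnj inv_sqrt2 = inv_sqrt2"
proof -
  show 1: "inv_sqrt2 * inv_sqrt2 = 1 / 2" by (simp add: inv_sqrt2_def flip: of_real_mult)
  have 2: "c * (inv_sqrt2 * inv_sqrt2) = c / 2" for c unfolding 1 by simp
  show "inv_sqrt2 * (inv_sqrt2 * c) = c / 2" "inv_sqrt2 * (c * inv_sqrt2) = c / 2"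
    "c * inv_sqrt2 * inv_sqrt2 = c / 2" "c * inv_sqrt2 * (d * inv_sqrt2) = c * d / 2"
    using 2[of c] 2[of "c * d"] by (simp_all only: mult_ac)
  show "cnj inv_sqrt2 = inv_sqrt2" by (simp add: inv_sqrt2_def)
qed

text \<open>The block matrix with rows \<open>(1, 1)\<close> and \<open>(i, -i)\<close>, divided by the square root of 2.  It
  conjugates \<open>diag(i, -i)\<close> to the real matrix with rows \<open>(0, 1)\<close> and \<open>(-1, 0)\<close>.\<close>

definition doubling_unitary :: "nat \<Rightarrow> nat \<Rightarrow> nat \<Rightarrow> complex" where
  "doubling_unitary m i l =
    (if i < m \<and> (l = i \<or> l = m + i) then inv_sqrt2
     else if m \<le> i \<and> i < 2 * m \<and> l = i - m then \<i> * inv_sqrt2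
     else if m \<le> i \<and> i < 2 * m \<and> l = i then - \<i> * inv_sqrt2 else 0)"

lemma doubling_unitary_simps:
  assumes "i < m" "l < m"
  shows "doubling_unitary m i l = (if l = i then inv_sqrt2 else 0)"
    and "doubling_unitary m i (m + l) = (if l = i then inv_sqrt2 else 0)"
    and "doubling_unitary m (m + i) l = (if l = i then \<i> * inv_sqrt2 else 0)"
    and "doubling_unitary m (m + i) (m + l) = (if l = i then - \<i> * inv_sqrt2 else 0)"
  using assms by (auto simp: doubling_unitary_def)

lemma less_double_cases:
  assumes "i < 2 * (m::nat)"
  obtains i' where "i' < m" "i = i'" | i' where "i' < m" "i = m + i'"
  using assms by (metis add_diff_inverse_nat mult_2 nat_add_left_cancel_less)

lemma unitary_doubling: "unitary_matrix (2 * m) (doubling_unitary m)"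
proof -
  have split: "(\<Sum>l<2 * m. f l) = (\<Sum>l<m. f l) + (\<Sum>l<m. f (m + l))" for f :: "nat \<Rightarrow> complex"
    using sum_lessThan_add[of f m m] by (simp add: mult_2)
  let ?U = "doubling_unitary m"
  have "(\<Sum>l<2 * m. ?U i l * cnj (?U j l)) = (if i = j then 1 else 0)" if ij: "i < 2 * m" "j < 2 * m" for i j
  proof -
    have prod: "(\<Sum>l<m. (if l = a then c else 0) * cnj (if l = b then d else 0)) =
        (if a = b then c * cnj d else 0)" if "a < m" for a b :: nat and c d :: complex
    proof -
      have "(\<Sum>l<m. (if l = a then c else 0) * cnj (if l = b then d else 0)) =
          (\<Sum>l<m. if l = a then (if a = b then c * cnj d else 0) else 0)"
        by (rule sum.cong) auto
      then show ?thesis using that by simp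
    qed
    from ij(1) show ?thesis
    proof (cases rule: less_double_cases)
      case (1 a)
      from ij(2) show ?thesis
        by (cases rule: less_double_cases)
          (use 1 in \<open>auto simp: split doubling_unitary_simps prod inv_sqrt2_square cong: sum.cong_simp\<close>)
    next
      case (2 a)
      from ij(2) show ?thesis
        by (cases rule: less_double_cases)
          (use 2 in \<open>auto simp: split doubling_unitary_simps prod inv_sqrt2_square cong: sum.cong_simp\<close>)
    qed
  qed
  moreover have "(\<Sum>l<2 * m. cnj (?U l i) * ?U l j) = (if i = j then 1 else 0)" if ij: "i < 2 * m" "j < 2 * m" for i j
  proof -
    have prod: "(\<Sum>l<m. cnj (if a = l then c else 0) * (if b = l then d else 0)) =
        (if a = b then cnj c * d else 0)" if "a < m" for a b :: nat and c d :: complex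
    proof -
      have "(\<Sum>l<m. cnj (if a = l then c else 0) * (if b = l then d else 0)) =
          (\<Sum>l<m. if l = a then (if a = b then cnj c * d else 0) else 0)"
        by (rule sum.cong) auto
      then show ?thesis using that by simp
    qed
    from ij(1) show ?thesis
    proof (cases rule: less_double_cases)
      case (1 a)
      from ij(2) show ?thesis
        by (cases rule: less_double_cases)
          (use 1 in \<open>auto simp: split doubling_unitary_simps prod inv_sqrt2_square cong: sum.cong_simp\<close>)
    next
      case (2 a)
      from ij(2) show ?thesis
        by (cases rule: less_double_cases)
          (use 2 in \<open>auto simp: split doubling_unitary_simps prod inv_sqrt2_square cong: sum.cong_simp\<close>)
    qed
  qed
  moreover have "?U i l = 0" if "\<not> (i < 2 * m \<and> l < 2 * m)" for i l
    using that by (auto simp: doubling_unitary_def)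
  ultimately show ?thesis unfolding unitary_matrix_def by blast
qed

lemma unitary_conj_doubling:
  fixes y z :: "'a::complex_algebra clmat" and m :: nat
  defines "Y \<equiv> unitary_conj (2 * m) (doubling_unitary m) (mat_dsum m y z)"
  assumes ij: "i < m" "j < m"
  shows "Y i j I = (1/2) *\<^sub>C (y i j I + z i j I)"
    and "Y i (m + j) I = (\<i>/2) *\<^sub>C (z i j I - y i j I)"
    and "Y (m + i) j I = (\<i>/2) *\<^sub>C (y i j I - z i j I)"
    and "Y (m + i) (m + j) I = (1/2) *\<^sub>C (y i j I + z i j I)"
proof -
  let ?U = "doubling_unitary m"
  have split: "(\<Sum>l<2 * m. f l) = (\<Sum>l<m. f l) + (\<Sum>l<m. f (m + l))" for f :: "nat \<Rightarrow> 'a"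
    using sum_lessThan_add[of f m m] by (simp add: mult_2)
  have Y: "Y a b I = (\<Sum>p<m. \<Sum>q<m. (?U a p * cnj (?U b q)) *\<^sub>C y p q I) +
      (\<Sum>p<m. \<Sum>q<m. (?U a (m + p) * cnj (?U b (m + q))) *\<^sub>C z p q I)" for a b
    by (simp add: Y_def unitary_conj_def split mat_dsum_def sum.distrib complex_vector.scale_zero_right)
  have pick: "(\<Sum>p<m. \<Sum>q<m. ((if p = i then c else 0) * cnj (if q = j then d else 0)) *\<^sub>C w p q I) =
      (c * cnj d) *\<^sub>C w i j I" for c d and w :: "'a clmat"
  proof -
    have "(\<Sum>p<m. \<Sum>q<m. ((if p = i then c else 0) * cnj (if q = j then d else 0)) *\<^sub>C w p q I) =
        (\<Sum>p<m. \<Sum>q<m. if q = j then (if p = i then (c * cnj d) *\<^sub>C w p q I else 0) else 0)"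
      by (intro sum.cong refl) (simp add: complex_vector.scale_zero_left)
    then show ?thesis using ij by simp
  qed
  have U1: "(\<Sum>p<m. \<Sum>q<m. (?U a (u + p) * cnj (?U b (v + q))) *\<^sub>C w p q I) = (c * cnj d) *\<^sub>C w i j I"
    if "\<And>p. p < m \<Longrightarrow> ?U a (u + p) = (if p = i then c else 0)"
      "\<And>q. q < m \<Longrightarrow> ?U b (v + q) = (if q = j then d else 0)" for a b c d u v and w :: "'a clmat"
    unfolding pick[symmetric] by (intro sum.cong refl) (simp add: that)
  have YY: "Y a b I = (c * cnj d) *\<^sub>C y i j I + (c' * cnj d') *\<^sub>C z i j I"
    if "\<And>p. p < m \<Longrightarrow> ?U a p = (if p = i then c else 0)" "\<And>q. q < m \<Longrightarrow> ?U b q = (if q = j then d else 0)"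
      "\<And>p. p < m \<Longrightarrow> ?U a (m + p) = (if p = i then c' else 0)"
      "\<And>q. q < m \<Longrightarrow> ?U b (m + q) = (if q = j then d' else 0)" for a b c d c' d'
    unfolding Y using U1[of a 0 c b 0 d y] U1[of a m c' b m d' z] that by simp
  note simps = doubling_unitary_simps[OF ij(1)] doubling_unitary_simps[OF ij(2)]
  show "Y i j I = (1/2) *\<^sub>C (y i j I + z i j I)"
    by (subst YY[OF simps(1) simps(5) simps(2) simps(6)]) (simp_all add: inv_sqrt2_square scaleC_add_right)
  show "Y i (m + j) I = (\<i>/2) *\<^sub>C (z i j I - y i j I)"
    by (subst YY[OF simps(1) simps(7) simps(2) simps(8)])
      (simp_all add: inv_sqrt2_square complex_vector.scale_right_diff_distrib complex_vector.scale_minus_left)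
  show "Y (m + i) j I = (\<i>/2) *\<^sub>C (y i j I - z i j I)"
    by (subst YY[OF simps(3) simps(5) simps(4) simps(6)])
      (simp_all add: inv_sqrt2_square complex_vector.scale_right_diff_distrib complex_vector.scale_minus_left)
  show "Y (m + i) (m + j) I = (1/2) *\<^sub>C (y i j I + z i j I)"
    by (subst YY[OF simps(3) simps(7) simps(4) simps(8)]) (simp_all add: inv_sqrt2_square scaleC_add_right)
qed

context graded_real_cstar_algebra
begin

lemma cl_real_osu:
  assumes y: "y \<in> osu gr m k S" and S: "complex_vector.subspace S" "rs ` S \<subseteq> S"
  shows "(\<lambda>i j. cl_real rs r s (y i j)) \<in> osu gr m k S"
proof -
  interpret rs: additive rs by standard (rule rs_add)
  let ?R = "\<lambda>i j. cl_real rs r s (y i j)"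
  have "?R \<in> clmat m k S"
  proof -
    have "rs a \<in> S" if "a \<in> S" for a using S(2) that by blast
    then show ?thesis
      using y complex_vector.subspace_scale[OF S(1)]
      by (auto simp: osu_def clmat_iff cl_real_def rs.zero complex_vector.scale_zero_right)
  qed
  moreover have "cl_grading gr (?R i j) = (\<lambda>I. - ?R i j I)" for i j
  proof
    fix I
    have "(-1) ^ card I *\<^sub>C gr (y i j I) = - y i j I" using y by (simp add: osu_def cl_grading_def fun_eq_iff)
    then have "rs ((-1) ^ card I *\<^sub>C gr (y i j I)) = - rs (y i j I)" by (simp add: rs.minus)
    then have "(-1) ^ card I *\<^sub>C gr (rs (y i j I)) = - rs (y i j I)" by (simp add: rs_sign rs_gr)
    then show "cl_grading gr (?R i j) I = - ?R i j I"
      unfolding cl_grading_def cl_real_def A.g_pow_scaleC[of 1, simplified]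
      by (subst complex_vector.scale_left_commute) (simp only: complex_vector.scale_minus_right)
  qed
  moreover have "cl_star gr (?R j i) = ?R i j" for i j
  proof
    fix I
    have "(-1) ^ (card I choose 2) *\<^sub>C (gr ^^ card I) (star (y j i I)) = y i j I"
      using y by (simp add: osu_def cl_star_def fun_eq_iff)
    then have "(-1) ^ (card I choose 2) *\<^sub>C (gr ^^ card I) (star (rs (y j i I))) = rs (y i j I)"
      by (metis rs_sign rs_gr_pow rs_star)
    then show "cl_star gr (?R j i) I = ?R i j I"
      unfolding cl_star_def cl_real_def star_scaleC A.g_pow_scaleC
      by (subst complex_vector.scale_left_commute) simp
  qed
  moreover have "mat_mult gr m k ?R ?R = mat_diag m cl_one"
  proof (intro ext)
    fix i j K
    have "mat_mult gr m k ?R ?R i j K = cl_real rs r s (mat_mult gr m k y y i j) K"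
      by (simp add: cl_real_mat_mult)
    also have "\<dots> = mat_diag m cl_one i j K"
      using y by (auto simp: osu_def cl_real_def mat_diag_def cl_one_def rs.zero rs_one scaleC_one
        complex_vector.scale_zero_right)
    finally show "mat_mult gr m k ?R ?R i j K = mat_diag m cl_one i j K" .
  qed
  ultimately show ?thesis by (simp add: osu_def)
qed

text \<open>An odd self-adjoint unitary \<open>y\<close> near the real one \<open>x\<close> need not be real.  Writing \<open>y = a + i b\<close>
  with real \<open>a\<close> and \<open>b\<close> and replacing \<open>i\<close> by a real \<open>2 \<times> 2\<close> matrix of square -1 makes it real, and
  does not leave the domain algebra; the result is close to \<open>x \<oplus> x\<close>.\<close>

lemma doubled_representative:
  assumes x: "x \<in> real_osu gr rs r s m UNIV" and m: "1 \<le> m"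
    and dense: "osu gr m (r + s) UNIV \<subseteq> closure (osu gr m (r + s) S)"
    and S: "complex_vector.subspace S" "rs ` S \<subseteq> S"
  obtains y where "y \<in> real_osu gr rs r s (m + m) S"
    "path_component (real_osu gr rs r s (m + m) UNIV) y (mat_dsum m x x)"
proof -
  define k where "k = r + s"
  (* The distance that the homotopy lemma admits for matrices of size 2 m. *)
  define \<delta> where "\<delta> = 1 / (real (m + m) * 2 ^ k)"
  have \<delta>: "0 < \<delta>" using m by (simp add: \<delta>_def)
  have xc: "x \<in> clmat m k UNIV" using x by (simp add: real_osu_iff k_def)
  have x_osu: "x \<in> osu gr m k UNIV" using x by (simp add: real_osu_def k_def)
  obtain y where y: "y \<in> osu gr m k S"
    and near: "\<And>i j I. (i, j, I) \<in> {..<m} \<times> {..<m} \<times> Pow {..<k} \<Longrightarrow> norm (y i j I - x i j I) < \<delta>"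
    by (rule closure_approx_coordinates[of x "osu gr m k S" "{..<m} \<times> {..<m} \<times> Pow {..<k}" \<delta>])
      (use dense x_osu \<delta> in \<open>auto simp: k_def\<close>)
  define z where "z = (\<lambda>i j. cl_real rs r s (y i j))"
  have z: "z \<in> osu gr m k S" unfolding z_def by (rule cl_real_osu[OF y S])
  have yc: "y \<in> clmat m k S" using y by (simp add: osu_def)
  have y_near: "norm (y i j I - x i j I) \<le> \<delta>" for i j I
  proof (cases "i < m \<and> j < m \<and> I \<subseteq> {..<k}")
    case True
    then show ?thesis using near[of i j I] by simp
  next
    case False
    then have "x i j I = 0" "y i j I = 0" using xc yc by (simp_all add: clmat_iff)
    then show ?thesis using \<delta> by simp
  qed
  have z_near: "norm (z i j I - x i j I) \<le> \<delta>" for i j I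
  proof -
    interpret rs: additive rs by standard (rule rs_add)
    have "x i j I = (-1) ^ card (I \<inter> {r..<r+s}) *\<^sub>C rs (x i j I)"
      using x by (simp add: real_osu_def cl_real_def fun_eq_iff)
    then have "z i j I - x i j I = (-1) ^ card (I \<inter> {r..<r+s}) *\<^sub>C rs (y i j I - x i j I)"
      by (simp add: z_def cl_real_def rs.diff complex_vector.scale_right_diff_distrib)
    then show ?thesis
      using norm_rs_le[of "y i j I - x i j I"] y_near[of i j I] by (simp add: norm_scaleC norm_power)
  qed
  define Y where "Y = unitary_conj (2 * m) (doubling_unitary m) (mat_dsum m y z)"
  note Y = unitary_conj_doubling[where m = m and y = y and z = z, folded Y_def]
  have 0: "0 \<in> S" by (rule complex_vector.subspace_0[OF S(1)])
  have Y_osu: "Y \<in> osu gr (2 * m) k S"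
    unfolding Y_def by (rule unitary_conj_osu[OF unitary_doubling S(1)])
      (use osu_dsum[OF y z 0] in \<open>simp add: mult_2\<close>)
  have Y_zero: "Y i j I = 0" if "\<not> (i < 2 * m \<and> j < 2 * m)" for i j I
    using Y_osu[unfolded osu_def clmat_iff] that by blast
  have "cl_real rs r s (Y i j) I = Y i j I" for i j I
  proof (cases "i < 2 * m \<and> j < 2 * m")
    case True
    then have i: "i < 2 * m" and j: "j < 2 * m" by auto
    interpret rs: additive rs by standard (rule rs_add)
    define \<rho> where "\<rho> a = (-1) ^ card (I \<inter> {r..<r+s}) *\<^sub>C rs a" for a
    have \<rho>: "\<rho> (c *\<^sub>C (u + v)) = cnj c *\<^sub>C (\<rho> u + \<rho> v)" "\<rho> (c *\<^sub>C (u - v)) = cnj c *\<^sub>C (\<rho> u - \<rho> v)" for c u v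
      by (simp_all add: \<rho>_def rs_scaleC rs.add rs.diff scaleC_add_right
        complex_vector.scale_right_diff_distrib mult.commute)
    have "z a b I = \<rho> (y a b I)" for a b by (simp add: z_def \<rho>_def cl_real_def)
    then have yz: "\<rho> (y a b I) = z a b I" "\<rho> (z a b I) = y a b I" for a b
      by (simp_all add: \<rho>_def rs_sign rs_rs scaleC_sign_cancel)
    have neg: "- ((\<i> / 2) *\<^sub>C (u - v)) = (\<i> / 2) *\<^sub>C (v - u)" for u v :: 'a
      by (simp add: complex_vector.scale_right_diff_distrib)
    have comm: "z a b I + y a b I = y a b I + z a b I" for a b by (rule add.commute)
    have "\<rho> (Y i j I) = Y i j I"
      using i
    proof (cases rule: less_double_cases)
      case (1 a)
      from j show ?thesis
        by (cases rule: less_double_cases) (simp_all add: Y 1 \<rho> yz comm neg)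
    next
      case (2 a)
      from j show ?thesis
        by (cases rule: less_double_cases) (simp_all add: Y 2 \<rho> yz comm neg)
    qed
    then show ?thesis by (simp add: cl_real_def \<rho>_def)
  next
    case False
    then show ?thesis using rs_add[of 0 0] by (simp add: Y_zero cl_real_def complex_vector.scale_zero_right)
  qed
  then have Y_real: "Y \<in> real_osu gr rs r s (m + m) S"
    using Y_osu by (simp add: real_osu_def k_def mult_2 fun_eq_iff)
  have "norm (Y i j I - mat_dsum m x x i j I) \<le> \<delta>" for i j I
  proof (cases "i < 2 * m \<and> j < 2 * m")
    case True
    then have i: "i < 2 * m" and j: "j < 2 * m" by auto
    have sum_le: "norm ((1/2) *\<^sub>C (y a b I + z a b I) - x a b I) \<le> \<delta>" for a b
    proof -
      have "(1/2) *\<^sub>C x a b I + (1/2) *\<^sub>C x a b I = x a b I"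
        by (simp add: scaleC_one flip: scaleC_add_left)
      moreover have "(1/2) *\<^sub>C ((y a b I - x a b I) + (z a b I - x a b I)) =
          (1/2) *\<^sub>C (y a b I + z a b I) - ((1/2) *\<^sub>C x a b I + (1/2) *\<^sub>C x a b I)"
        by (simp add: scaleC_add_right complex_vector.scale_right_diff_distrib)
      ultimately have "(1/2) *\<^sub>C (y a b I + z a b I) - x a b I =
          (1/2) *\<^sub>C ((y a b I - x a b I) + (z a b I - x a b I))"
        by simp
      then show ?thesis
        using norm_triangle_ineq[of "y a b I - x a b I" "z a b I - x a b I"] y_near[of a b I] z_near[of a b I]
        by (simp add: norm_scaleC)
    qed
    have diff_le: "norm ((\<i>/2) *\<^sub>C (y a b I - z a b I)) \<le> \<delta>" "norm ((\<i>/2) *\<^sub>C (z a b I - y a b I)) \<le> \<delta>" for a b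
    proof -
      have "norm (y a b I - z a b I) \<le> 2 * \<delta>"
        using norm_triangle_ineq4[of "y a b I - x a b I" "z a b I - x a b I"] y_near[of a b I] z_near[of a b I]
        by simp
      then show "norm ((\<i>/2) *\<^sub>C (y a b I - z a b I)) \<le> \<delta>" "norm ((\<i>/2) *\<^sub>C (z a b I - y a b I)) \<le> \<delta>"
        by (simp_all add: norm_scaleC norm_divide norm_minus_commute)
    qed
    from i show ?thesis
    proof (cases rule: less_double_cases)
      case (1 a)
      from j show ?thesis
        by (cases rule: less_double_cases) (use 1 in \<open>auto simp: Y sum_le diff_le mat_dsum_def\<close>)
    next
      case (2 a)
      from j show ?thesis
        by (cases rule: less_double_cases) (use 2 in \<open>auto simp: Y sum_le diff_le mat_dsum_def\<close>)
    qed
  next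
    case False
    have "mat_dsum m x x \<in> clmat (m + m) k UNIV" by (rule clmat_dsum[OF xc xc]) simp
    then have "mat_dsum m x x i j I = 0" using False unfolding clmat_iff mult_2 by blast
    then show ?thesis using False \<delta> by (simp add: Y_zero)
  qed
  then have "path_component (real_osu gr rs r s (m + m) UNIV) Y (mat_dsum m x x)"
    using Y_real m real_osu_dsum[OF x x]
    by (intro close_real_osu_homotopic) (auto simp: real_osu_def osu_def clmat_iff \<delta>_def k_def)
  with Y_real show ?thesis by (rule that)
qed

end

section \<open>Parity and sign of the pairing\<close>

sublocale nc_cycle \<subseteq> W: graded_involution gr\<Omega>
  by (rule graded_involution.intro) (rule gr\<Omega>_linear gr\<Omega>_mult gr\<Omega>_gr\<Omega>)+

lemma bit_sign_of_nat: "bit_sign (of_nat p) = (-1) ^ p"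
  by (induction p) (auto simp: bit_sign_def)

lemma span_closed_linear:
  assumes "w \<in> complex_vector.span B" and "complex_vector.subspace S"
    and "\<And>x y. \<theta> (x + y) = \<theta> x + \<theta> y" "\<And>c x. \<theta> (c *\<^sub>C x) = c *\<^sub>C \<theta> x"
    and "\<And>b. b \<in> B \<Longrightarrow> \<theta> b \<in> S"
  shows "\<theta> w \<in> S"
  using assms(1)
proof (induction rule: complex_vector.span_induct_alt)
  case base
  have "\<theta> 0 = 0" using assms(4)[of 0 0] by (simp add: complex_vector.scale_zero_left)
  then show ?case using complex_vector.subspace_0[OF assms(2)] by simp
next
  case (step c x y)
  then show ?case
    using assms(3-5) complex_vector.subspace_add[OF assms(2)] complex_vector.subspace_scale[OF assms(2)]
    by simp
qed

context nc_cycle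
begin

lemma emb_scaleC: "emb (c *\<^sub>C a) = c *\<^sub>C emb a"
proof -
  interpret Vector_Spaces.linear "(*\<^sub>C)" "(*\<^sub>C)" emb by (rule emb_linear)
  show ?thesis by (rule scale)
qed

text \<open>The forms of degree \<open>j\<close> over the domain algebra.  Since \<open>\<Omega>\<close> need not have a unit,
  \<open>da\<^sub>1 \<cdots> da\<^sub>j\<close> is not a special case of \<open>a\<^sub>0 da\<^sub>1 \<cdots> da\<^sub>j\<close>.\<close>

definition form_words :: "nat \<Rightarrow> 'w set" where
  "form_words j =
    {foldl (\<lambda>\<omega> b. \<omega> * d (emb b)) (emb a) as | a as. a \<in> \<A> \<and> set as \<subseteq> \<A> \<and> length as = j} \<union>
    {foldl (\<lambda>\<omega> b. \<omega> * d (emb b)) (d (emb a)) as | a as. a \<in> \<A> \<and> set as \<subseteq> \<A> \<and> Suc (length as) = j}"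

abbreviation forms :: "nat \<Rightarrow> 'w set" where
  "forms j \<equiv> complex_vector.span (form_words j)"

lemma forms_subspace: "complex_vector.subspace (forms j)"
  by (rule complex_vector.subspace_span)

lemma emb_form: "a \<in> \<A> \<Longrightarrow> emb a \<in> forms 0"
  by (rule complex_vector.span_base) (force simp: form_words_def)

lemma d_form: "a \<in> \<A> \<Longrightarrow> d (emb a) \<in> forms 1"
  by (rule complex_vector.span_base) (force simp: form_words_def)

lemma form_words_domtr: "form_words n \<subseteq> domtr"
  using tr_domain tr_closed unfolding form_words_def by blast

lemma forms_domtr: "forms n \<subseteq> domtr"
  using form_words_domtr domtr_subspace by (rule complex_vector.span_minimal)

lemma form_mult_d:
  assumes "w \<in> forms j" "b \<in> \<A>"
  shows "w * d (emb b) \<in> forms (Suc j)"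
proof (rule span_closed_linear[OF assms(1) forms_subspace, where \<theta> = "\<lambda>w. w * d (emb b)"])
  fix v assume "v \<in> form_words j"
  then obtain u as where v: "v = foldl (\<lambda>\<omega> b. \<omega> * d (emb b)) u as" "set as \<subseteq> \<A>"
    and u: "(\<exists>a\<in>\<A>. u = emb a) \<and> length as = j \<or> (\<exists>a\<in>\<A>. u = d (emb a)) \<and> Suc (length as) = j"
    unfolding form_words_def by blast
  have "v * d (emb b) = foldl (\<lambda>\<omega> b. \<omega> * d (emb b)) u (as @ [b])" "set (as @ [b]) \<subseteq> \<A>"
    using v assms(2) by simp_all
  moreover have "length (as @ [b]) = Suc (length as)" by simp
  ultimately have "v * d (emb b) \<in> form_words (Suc j)"
    using u unfolding form_words_def by (smt (verit) UnCI mem_Collect_eq)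
  then show "v * d (emb b) \<in> forms (Suc j)" by (rule complex_vector.span_base)
qed (simp_all add: distrib_right mult_scaleC_left)

text \<open>By the Leibniz rule \<open>(da) b = d(a b) - a db\<close>.  The adjoint of \<open>a\<^sub>0 da\<^sub>1 \<cdots> da\<^sub>n\<close> has the form
  \<open>db\<^sub>1 \<cdots> db\<^sub>n b\<^sub>0\<close>, so this puts it into the domain of the integral, where the sign condition
  applies.\<close>

lemma form_mult_right:
  assumes "w \<in> forms j" "b \<in> \<A>"
  shows "w * emb b \<in> forms j"
  using assms
proof (induction j arbitrary: w b)
  case 0
  show ?case
  proof (rule span_closed_linear[OF 0(1) forms_subspace, where \<theta> = "\<lambda>w. w * emb b"])
    fix v assume "v \<in> form_words 0"
    then obtain a where "a \<in> \<A>" "v = emb a" by (auto simp: form_words_def)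
    then show "v * emb b \<in> forms 0" using emb_form[OF \<A>_mult[OF _ 0(2)]] by (simp add: emb_mult)
  qed (simp_all add: distrib_right mult_scaleC_left)
next
  case (Suc j)
  have leibniz: "d (emb c) * emb b = d (emb (c * b)) - emb c * d (emb b)" if "c \<in> \<A>" for c
  proof -
    have "emb c \<in> domd" "emb b \<in> domd" using \<A>_domd that Suc.prems(2) by auto
    then show ?thesis using d_leibniz[of "emb c" 0 "emb b"] emb_deg by (simp add: emb_mult scaleC_one)
  qed
  show ?case
  proof (rule span_closed_linear[OF Suc.prems(1) forms_subspace, where \<theta> = "\<lambda>w. w * emb b"])
    fix v assume v: "v \<in> form_words (Suc j)"
    show "v * emb b \<in> forms (Suc j)"
    proof (cases "\<exists>u\<in>forms j. \<exists>c\<in>\<A>. v = u * d (emb c)")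
      case True
      then obtain u c where u: "u \<in> forms j" "c \<in> \<A>" "v = u * d (emb c)" by blast
      have "v * emb b = u * d (emb (c * b)) - (u * emb c) * d (emb b)"
        by (simp add: u mult.assoc leibniz right_diff_distrib)
      then show ?thesis
        using form_mult_d[OF u(1) \<A>_mult[OF u(2) Suc.prems(2)]] form_mult_d[OF Suc.IH[OF u(1,2)] Suc.prems(2)]
        by (simp add: complex_vector.span_diff)
    next
      case False
      have "\<exists>a\<in>\<A>. v = d (emb a) \<and> j = 0"
      proof -
        have *: "foldl (\<lambda>\<omega> b. \<omega> * d (emb b)) u as = foldl (\<lambda>\<omega> b. \<omega> * d (emb b)) u (butlast as) * d (emb (last as))"
          if "as \<noteq> []" for u as
          using that by (cases as rule: rev_cases) simp_all
        obtain a as where a: "a \<in> \<A>" "set as \<subseteq> \<A>"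
          and "v = foldl (\<lambda>\<omega> b. \<omega> * d (emb b)) (emb a) as \<and> length as = Suc j \<or>
            v = foldl (\<lambda>\<omega> b. \<omega> * d (emb b)) (d (emb a)) as \<and> length as = j"
          using v unfolding form_words_def by auto
        then consider "as \<noteq> []" "v = foldl (\<lambda>\<omega> b. \<omega> * d (emb b)) (emb a) as" "length as = Suc j"
          | "as \<noteq> []" "v = foldl (\<lambda>\<omega> b. \<omega> * d (emb b)) (d (emb a)) as" "length as = j"
          | "v = d (emb a)" "j = 0" by (cases as) auto
        then show ?thesis
        proof cases
          case 1
          have "foldl (\<lambda>\<omega> b. \<omega> * d (emb b)) (emb a) (butlast as) \<in> form_words j"
            unfolding form_words_def using a 1 in_set_butlastD[of _ as]
            by (intro UnI1 CollectI exI[of _ a] exI[of _ "butlast as"]) auto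
          then have "foldl (\<lambda>\<omega> b. \<omega> * d (emb b)) (emb a) (butlast as) \<in> forms j"
            by (rule complex_vector.span_base)
          moreover have "last as \<in> \<A>" using a last_in_set[OF 1(1)] by blast
          ultimately show ?thesis using False unfolding 1(2) *[OF 1(1)] by blast
        next
          case 2
          have "foldl (\<lambda>\<omega> b. \<omega> * d (emb b)) (d (emb a)) (butlast as) \<in> form_words j"
            unfolding form_words_def using a 2 in_set_butlastD[of _ as]
            by (intro UnI2 CollectI exI[of _ a] exI[of _ "butlast as"]) auto
          then have "foldl (\<lambda>\<omega> b. \<omega> * d (emb b)) (d (emb a)) (butlast as) \<in> forms j"
            by (rule complex_vector.span_base)
          moreover have "last as \<in> \<A>" using a last_in_set[OF 2(1)] by blast
          ultimately show ?thesis using False unfolding 2(2) *[OF 2(1)] by blast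
        next
          case 3
          then show ?thesis using a by blast
        qed
      qed
      then obtain a where a: "a \<in> \<A>" "v = d (emb a)" "j = 0" by blast
      have "v * emb b = d (emb (a * b)) - emb a * d (emb b)" using leibniz a by simp
      moreover have "emb a * d (emb b) \<in> forms 1"
        using form_mult_d[OF emb_form[OF a(1)] Suc.prems(2)] by simp
      ultimately show ?thesis
        using d_form[OF \<A>_mult[OF a(1) Suc.prems(2)]] a(3) by (simp add: complex_vector.span_diff)
    qed
  qed (simp_all add: distrib_right mult_scaleC_left)
qed

lemma form_mult_left:
  assumes "w \<in> forms j" "b \<in> \<A>"
  shows "emb b * w \<in> forms j"
proof (rule span_closed_linear[OF assms(1) forms_subspace, where \<theta> = "\<lambda>w. emb b * w"])
  fix v assume v: "v \<in> form_words j"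
  have fold: "emb b * foldl (\<lambda>\<omega> b. \<omega> * d (emb b)) u as = foldl (\<lambda>\<omega> b. \<omega> * d (emb b)) (emb b * u) as" for u as
    by (induction as arbitrary: u) (simp_all add: mult.assoc)
  obtain a as where a: "a \<in> \<A>" "set as \<subseteq> \<A>"
    and "v = foldl (\<lambda>\<omega> b. \<omega> * d (emb b)) (emb a) as \<and> length as = j \<or>
      v = foldl (\<lambda>\<omega> b. \<omega> * d (emb b)) (d (emb a)) as \<and> Suc (length as) = j"
    using v unfolding form_words_def by blast
  then have "emb b * v = foldl (\<lambda>\<omega> b. \<omega> * d (emb b)) (emb (b * a)) as \<and> length as = j \<or>
      emb b * v = foldl (\<lambda>\<omega> b. \<omega> * d (emb b)) (emb b) (a # as) \<and> length (a # as) = j"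
    by (auto simp: fold emb_mult)
  then have "emb b * v \<in> form_words j"
  proof
    assume "emb b * v = foldl (\<lambda>\<omega> b. \<omega> * d (emb b)) (emb (b * a)) as \<and> length as = j"
    then show ?thesis
      unfolding form_words_def using a \<A>_mult[OF assms(2) a(1)] by blast
  next
    assume "emb b * v = foldl (\<lambda>\<omega> b. \<omega> * d (emb b)) (emb b) (a # as) \<and> length (a # as) = j"
    moreover have "set (a # as) \<subseteq> \<A>" using a by simp
    ultimately show ?thesis unfolding form_words_def using assms(2) by blast
  qed
  then show "emb b * v \<in> forms j" by (rule complex_vector.span_base)
qed (simp_all add: distrib_left mult_scaleC_right)

lemma forms_algebra_generated: "forms j \<subseteq> algebra_generated (emb ` \<A> \<union> d ` emb ` \<A>)"
proof (rule complex_vector.span_minimal)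
  let ?G = "algebra_generated (emb ` \<A> \<union> d ` emb ` \<A>)"
  have gen: "emb a \<in> ?G" "d (emb a) \<in> ?G" if "a \<in> \<A>" for a
    using that by (auto intro: algebra_generated.intros(1))
  have fold: "foldl (\<lambda>\<omega> b. \<omega> * d (emb b)) u as \<in> ?G" if "u \<in> ?G" "set as \<subseteq> \<A>" for u as
    using that by (induction as arbitrary: u) (auto intro: algebra_generated.intros(3) gen)
  show "form_words j \<subseteq> ?G"
    unfolding form_words_def using fold gen by blast
  have "0 *\<^sub>C emb 0 \<in> ?G"
    using gen(1)[OF complex_vector.subspace_0[OF \<A>_subspace]] by (rule algebra_generated.intros(4))
  then show "complex_vector.subspace ?G"
    unfolding complex_vector.subspace_def
    by (auto simp: complex_vector.scale_zero_left intro: algebra_generated.intros(2,4))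
qed

lemma homogeneous_emb:
  assumes "A.homogeneous p y"
  shows "W.homogeneous p (\<lambda>i j I. emb (y i j I))"
  unfolding W.homogeneous_def
  by (simp only: emb_gr[symmetric] A.homogeneousD[OF assms] emb_scaleC simp_thms)

lemma homogeneous_d:
  assumes "A.homogeneous p y" and "\<And>i j I. y i j I \<in> \<A>"
  shows "W.homogeneous p (\<lambda>i j I. d (emb (y i j I)))"
  unfolding W.homogeneous_def
proof (intro allI)
  fix i j I
  have "emb (y i j I) \<in> domd" using assms(2) \<A>_domd by blast
  from d_degree[OF this emb_deg, of "of_nat (p + card I)", unfolded bit_sign_of_nat]
  show "gr\<Omega> (d (emb (y i j I))) = (-1) ^ (p + card I) *\<^sub>C d (emb (y i j I))"
    using W.homogeneousD[OF homogeneous_emb[OF assms(1)]] by blast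
qed

end

context star_real_cycle
begin

lemma star_rs_entry:
  assumes "real_self_adjoint r s p y" "finite I"
  shows "star (rs (y i j I)) =
    (-1) ^ (card (I \<inter> {r..<r+s}) + (card I choose 2) + Suc p * card I) *\<^sub>C y j i I"
proof -
  have "rs (y i j I) = (-1) ^ card (I \<inter> {r..<r+s}) *\<^sub>C y i j I"
    and adj: "A.graded_adjoint {} star p y y"
    using assms by (auto simp: real_self_adjoint_def)
  then have "star (rs (y i j I)) = (-1) ^ card (I \<inter> {r..<r+s}) *\<^sub>C star (y i j I)"
    by (simp add: star_scaleC)
  then show ?thesis
    unfolding A.graded_adjointD[OF adj assms(2)] by (simp add: scaleC_scaleC power_add mult.assoc)
qed

lemma graded_adjoint_emb:
  assumes "real_self_adjoint r s p y"
  shows "W.graded_adjoint {r..<r+s} (\<lambda>\<omega>. star\<Omega> (rs\<Omega> \<omega>)) p (\<lambda>i j I. emb (y i j I)) (\<lambda>i j I. emb (y i j I))"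
  unfolding W.graded_adjoint_def
  by (intro allI impI) (simp only: emb_rs[symmetric] emb_star[symmetric] star_rs_entry[OF assms] emb_scaleC)

lemma graded_adjoint_d:
  assumes "real_self_adjoint r s p y" and y: "\<And>i j I. y i j I \<in> \<A>"
  shows "W.graded_adjoint {r..<r+s} (\<lambda>\<omega>. star\<Omega> (rs\<Omega> \<omega>)) p
    (\<lambda>i j I. d (emb (y i j I))) (\<lambda>i j I. d (emb (y i j I)))"
  unfolding W.graded_adjoint_def
proof (intro allI impI)
  fix i j and I :: "nat set" assume I: "finite I"
  have "rs (y i j I) \<in> \<A>" using y \<A>_real by blast
  then have "star\<Omega> (rs\<Omega> (d (emb (y i j I)))) = d (emb (star (rs (y i j I))))"
    by (simp add: d_star d_rs y)
  also have "\<dots> = (-1) ^ (card (I \<inter> {r..<r+s}) + (card I choose 2) + Suc p * card I) *\<^sub>C d (emb (y j i I))"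
    unfolding star_rs_entry[OF assms(1) I] emb_scaleC using y \<A>_domd by (intro d_scaleC) blast
  finally show "star\<Omega> (rs\<Omega> (d (emb (y i j I)))) =
    (-1) ^ (card (I \<inter> {r..<r+s}) + (card I choose 2) + Suc p * card I) *\<^sub>C d (emb (y j i I))" .
qed

lemma tr_sum:
  assumes "\<And>a. a \<in> S \<Longrightarrow> f a \<in> domtr"
  shows "tr (sum f S) = (\<Sum>a\<in>S. tr (f a))"
proof -
  have 0: "0 \<in> domtr" by (rule complex_vector.subspace_0[OF domtr_subspace])
  then have "tr 0 = 0" using tr_add[of 0 0] by simp
  then show ?thesis
    using assms
  proof (induction S rule: infinite_finite_induct)
    case (insert a S)
    then have "sum f S \<in> domtr" by (intro complex_vector.subspace_sum[OF domtr_subspace]) auto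
    then show ?case using insert by (simp add: tr_add)
  qed simp_all
qed

text \<open>The integral is applied to the top coefficient \<open>w\<close> of the trace of \<open>X D\<^sup>n\<close>, where \<open>X = x - e\<close> and
  \<open>D = dx\<close> are odd, self-adjoint and real.  The parity of \<open>w\<close> is \<open>n + 1\<close> minus that of the top word,
  which gives the condition on \<open>\<nu>\<close>.  The adjoint of \<open>X D\<^sup>n\<close> is \<open>D\<^sup>n X\<close>, so up to the sign of the
  graded involution on the top word, \<open>w\<close> is sent to the top coefficient \<open>w'\<close> of the trace of
  \<open>D\<^sup>n X\<close>.  The trace property, in which \<open>X\<close> has degree 0 and total parity 1, and \<open>D\<^sup>n\<close> has total
  parity \<open>n\<close>, compares the two integrals.\<close>

lemma pairing_constraints:
  assumes e: "basepoint r s e" and x: "x \<in> real_osu gr rs r s m \<A>"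
    and nz: "pairing_value m (r + s) e x \<noteq> 0"
  shows "sgn\<Omega> = (-1) ^ (s + ((r + s) choose 2) + n * (r + s) + n)"
    and "has_parity \<nu> \<Longrightarrow> \<nu> = of_nat (n + 1 + (r + s))"
proof -
  define k where "k = r + s"
  define M where "M = (mat_mult gr\<Omega> m k :: 'w clmat \<Rightarrow> 'w clmat \<Rightarrow> 'w clmat)"
  define y where "y = (\<lambda>i j I. x i j I - mat_diag m e i j I)"
  define X where "X = (\<lambda>i j I. emb (y i j I))"
  define D where "D = (\<lambda>i j I. d (emb (x i j I)))"
  define top where "top = {..<k}"
  let ?\<sigma> = "\<lambda>\<omega>. star\<Omega> (rs\<Omega> \<omega>)" and ?T = "{r..<r+s}"
  have 0: "0 \<in> \<A>" using \<A>_subspace by (rule complex_vector.subspace_0)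
  have e1: "mat_diag 1 e \<in> real_osu gr rs r s 1 \<A>" using e by (simp add: basepoint_def)
  have coeff: "z i j I \<in> \<A>" if "z \<in> real_osu gr rs r s l \<A>" for z l i j I
  proof (cases "i < l \<and> j < l \<and> I \<subseteq> {..<r + s}")
    case True
    then show ?thesis using that by (simp add: real_osu_iff clmat_iff)
  next
    case False
    then have "z i j I = 0" using that unfolding real_osu_iff clmat_iff by blast
    then show ?thesis using 0 by simp
  qed
  have xA: "x i j I \<in> \<A>" for i j I by (rule coeff[OF x])
  have "e I \<in> \<A>" for I using coeff[OF e1, of 0 0 I] by (simp add: mat_diag_def)
  then have yA: "y i j I \<in> \<A>" for i j I
    using xA 0 complex_vector.subspace_diff[OF \<A>_subspace] by (simp add: y_def mat_diag_def)
  have mono: "z \<in> real_osu gr rs r s l UNIV" if "z \<in> real_osu gr rs r s l \<A>" for z l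
    using that by (auto simp: real_osu_iff clmat_iff)
  have xr: "real_self_adjoint r s 1 x" using x by (simp add: real_osu_iff)
  have "real_self_adjoint r s 1 (mat_diag m e)"
    using real_osu_diag[OF mono[OF e1]] by (simp add: real_osu_iff)
  then have yr: "real_self_adjoint r s 1 y"
    using real_self_adjoint_linear[OF xr, of "mat_diag m e" 1 "-1"] by (simp add: y_def)
  have \<sigma>_add: "?\<sigma> (a + b) = ?\<sigma> a + ?\<sigma> b" and \<sigma>_mult: "?\<sigma> (a * b) = ?\<sigma> b * ?\<sigma> a" for a b
    using rs\<Omega>_antilinear star\<Omega>_antilinear by (simp_all add: antilinear_def rs\<Omega>_mult star\<Omega>_mult)
  have hX: "W.homogeneous 1 X" unfolding X_def
    by (rule homogeneous_emb) (use yr in \<open>simp add: real_self_adjoint_def\<close>)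
  have hD: "W.homogeneous 1 D" unfolding D_def
    by (rule homogeneous_d) (use xr xA in \<open>simp_all add: real_self_adjoint_def\<close>)
  have aX: "W.graded_adjoint ?T ?\<sigma> 1 X X" unfolding X_def by (rule graded_adjoint_emb[OF yr])
  have aD: "W.graded_adjoint ?T ?\<sigma> 1 D D" unfolding D_def by (rule graded_adjoint_d[OF xr xA])
  have X_form: "X i j I \<in> forms 0" for i j I unfolding X_def by (rule emb_form[OF yA])
  have assoc: "M (M u v) w = M u (M v w)" for u v w by (simp add: M_def W.mat_mult_assoc)
  have M_forms: "M u v i j I \<in> forms p"
    if "W.homogeneous q v" "\<And>i l j I J. u i l I * v l j J \<in> forms p" for u v p q i j I
  proof (cases "I \<subseteq> {..<k}")
    case True
    show ?thesis
      unfolding M_def W.mat_mult_homogeneous_apply[OF that(1)] if_P[OF True]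
      by (intro complex_vector.span_sum complex_vector.span_scale that(2))
  next
    case False
    then show ?thesis using complex_vector.span_zero by (simp add: M_def mat_mult_apply)
  qed
  (* An index shift, V j = D^(j+1), because \<Omega> need not contain a unit. *)
  define V where "V j = ((\<lambda>w. M w D) ^^ j) D" for j
  have VS: "V (Suc j) = M (V j) D" for j by (simp add: V_def)
  have VS': "V (Suc j) = M D (V j)" for j
    by (induction j) (simp_all add: VS assoc, simp add: V_def)
  have hV: "W.homogeneous (Suc j) (V j)" for j
  proof (induction j)
    case (Suc j)
    then show ?case using W.homogeneous_mat_mult[OF Suc hD] by (simp add: VS M_def)
  qed (use hD in \<open>simp add: V_def\<close>)
  have aV: "W.graded_adjoint ?T ?\<sigma> (Suc j) (V j) (V j)" for j
  proof (induction j)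
    case (Suc j)
    have "W.graded_adjoint ?T ?\<sigma> (Suc j + 1) (M (V j) D) (M D (V j))"
      unfolding M_def by (rule W.graded_adjoint_mat_mult[OF \<sigma>_add \<sigma>_mult Suc aD hD hV])
    then show ?case using VS[of j] VS'[of j] by simp
  qed (use aD in \<open>simp add: V_def\<close>)
  have V_form: "V j i l I \<in> forms (Suc j)" for j i l I
  proof (induction j arbitrary: i l I)
    case 0
    show ?case using d_form[OF xA] by (simp add: V_def D_def)
  next
    case (Suc j)
    show ?case
      unfolding VS by (rule M_forms[OF hD]) (use form_mult_d[OF Suc xA] in \<open>simp add: D_def\<close>)
  qed
  define C where "C = char_form m k e x"
  have C: "C = ((\<lambda>w. M w D) ^^ n) X"
    by (simp add: C_def char_form_def M_def D_def X_def y_def)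
  have C_Suc: "((\<lambda>w. M w D) ^^ Suc j) X = M X (V j)" for j
    by (induction j) (simp_all add: VS assoc, simp add: V_def)
  define C' where "C' = (if n = 0 then X else M (V (n - 1)) X)"
  have C_cases: "n = 0 \<and> C = X \<and> C' = X \<or> (\<exists>j. n = Suc j \<and> C = M X (V j) \<and> C' = M (V j) X)"
    using C C_Suc by (cases n) (auto simp: C'_def)
  have hC: "W.homogeneous (Suc n) C"
    using C_cases hX W.homogeneous_mat_mult[OF hX hV] by (auto simp: M_def)
  have aC: "W.graded_adjoint ?T ?\<sigma> (Suc n) C C'"
    using C_cases aX W.graded_adjoint_mat_mult[OF \<sigma>_add \<sigma>_mult aX aV hV hX] by (auto simp: M_def)
  have XV: "X i l I * V j l' i' J \<in> forms (Suc j)" "V j l' i' J * X i l I \<in> forms (Suc j)" for i l I j l' i' J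
    unfolding X_def by (rule form_mult_left[OF V_form yA] form_mult_right[OF V_form yA])+
  have C_form: "C i j I \<in> forms n" "C' i j I \<in> forms n" for i j I
    using C_cases X_form M_forms[OF hV XV(1)] M_forms[OF hX XV(2)] by auto
  define w where "w = (\<Sum>i<m. C i i top)"
  define w' where "w' = (\<Sum>i<m. C' i i top)"
  have w: "w \<in> domtr" "w' \<in> domtr"
    unfolding w_def w'_def using C_form forms_domtr
    by (auto intro!: complex_vector.subspace_sum[OF domtr_subspace])
  have "pairing_value m k e x = tr (kappa ^ k *\<^sub>C w)"
    by (simp add: pairing_value_def kappa_Tr_def C_def w_def top_def complex_vector.scale_sum_right)
  then have "tr w \<noteq> 0" using nz tr_scaleC[OF w(1)] by (auto simp: k_def)
  have top: "finite top" "card top = k" "top \<inter> ?T = ?T" by (auto simp: top_def k_def)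
  let ?\<eta> = "s + (k choose 2) + Suc (Suc n) * k"
  have \<sigma>w: "?\<sigma> w = (-1) ^ ?\<eta> *\<^sub>C w'"
  proof -
    interpret \<sigma>: additive ?\<sigma> by standard (rule \<sigma>_add)
    show ?thesis
      unfolding w_def w'_def \<sigma>.sum complex_vector.scale_sum_right
      by (simp only: W.graded_adjointD[OF aC top(1)] top) simp
  qed
  have "tr (?\<sigma> w) = sgn\<Omega> * tr w"
    by (rule tr_sign[OF w(1)]) (unfold \<sigma>w, rule complex_vector.subspace_scale[OF domtr_subspace w(2)])
  then have sgn: "sgn\<Omega> * tr w = (-1) ^ ?\<eta> * tr w'" unfolding \<sigma>w tr_scaleC[OF w(2)] by simp
  have "tr w' = (-1) ^ n * tr w"
  proof (cases n)
    case 0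
    then show ?thesis using C_cases by (simp add: w_def w'_def)
  next
    case (Suc j)
    then have Cn: "C = M X (V j)" "C' = M (V j) X" using C_cases by auto
    define J where "J I = sym_diff I top" for I
    let ?s = "\<lambda>p I J. inversions I J + card I * (p + card J)"
    have w'_sum: "w' = (\<Sum>i<m. \<Sum>l<m. \<Sum>I\<in>Pow top. (-1) ^ ?s 1 I (J I) *\<^sub>C (V j i l I * X l i (J I)))"
      unfolding w'_def Cn M_def W.mat_mult_homogeneous_apply[OF hX] by (simp add: top_def J_def)
    have "w = (\<Sum>i<m. \<Sum>l<m. \<Sum>I\<in>Pow top. (-1) ^ ?s n I (J I) *\<^sub>C (X i l I * V j l i (J I)))"
      unfolding w_def Cn M_def W.mat_mult_homogeneous_apply[OF hV] Suc by (simp add: top_def J_def)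
    (* Exchange the roles of the word I and its complement, so that V carries I in both sums. *)
    also have "\<dots> = (\<Sum>i<m. \<Sum>l<m. \<Sum>I\<in>Pow top. (-1) ^ ?s n (J I) I *\<^sub>C (X i l (J I) * V j l i I))"
      unfolding J_def by (rule sum.cong[OF refl], rule sum.cong[OF refl], rule sum_sym_diff_reindex) simp
    also have "\<dots> = (\<Sum>i<m. \<Sum>l<m. \<Sum>I\<in>Pow top. (-1) ^ ?s n (J I) I *\<^sub>C (X l i (J I) * V j i l I))"
      by (rule sum.swap)
    finally have w_sum: "w = \<dots>" .
    have VX: "V j i l I * X l' i' K \<in> domtr" "X l' i' K * V j i l I \<in> domtr" for i l I l' i' K
      using XV forms_domtr Suc by blast+
    have trade: "tr ((-1) ^ ?s 1 I (J I) *\<^sub>C (V j i l I * X l i (J I))) =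
        (-1) ^ n * tr ((-1) ^ ?s n (J I) I *\<^sub>C (X l i (J I) * V j i l I))" if I: "I \<in> Pow top" for i l I
    proof -
      have V: "V j i l I \<in> algebra_generated (emb ` \<A> \<union> d ` emb ` \<A>)" "V j i l I \<in> deg (int n)"
        "gr\<Omega> (V j i l I) = bit_sign (of_nat (n + card I)) *\<^sub>C V j i l I"
        using V_form[of j i l I] forms_algebra_generated forms_domtr domtr_deg Suc W.homogeneousD[OF hV[of j]]
        unfolding bit_sign_of_nat by blast+
      have X: "X l i (J I) \<in> algebra_generated (emb ` \<A> \<union> d ` emb ` \<A>)" "X l i (J I) \<in> deg 0"
        "gr\<Omega> (X l i (J I)) = bit_sign (of_nat (1 + card (J I))) *\<^sub>C X l i (J I)"
        using X_form forms_algebra_generated emb_deg W.homogeneousD[OF hX]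
        unfolding bit_sign_of_nat X_def by blast+
      have "tr (V j i l I * X l i (J I)) =
          bit_sign (of_nat (n + card I) * of_nat (1 + card (J I))) * tr (X l i (J I) * V j i l I)"
        using tr_graded_trace[OF V(1) X(1) V(2,3) X(2,3)] by simp
      also have "bit_sign (of_nat (n + card I) * of_nat (1 + card (J I))) =
          (-1) ^ ((n + card I) * (1 + card (J I)))"
        unfolding of_nat_mult[symmetric] by (rule bit_sign_of_nat)
      finally have "tr ((-1) ^ ?s 1 I (J I) *\<^sub>C (V j i l I * X l i (J I))) =
          (-1) ^ (?s 1 I (J I) + (n + card I) * (1 + card (J I))) * tr (X l i (J I) * V j i l I)"
        unfolding tr_scaleC[OF VX(1)] by (simp add: power_add)
      also have "(-1 :: complex) ^ (?s 1 I (J I) + (n + card I) * (1 + card (J I))) =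
          (-1) ^ (n + ?s n (J I) I)"
      proof (rule minus_one_power_cong)
        have "finite I" "finite (J I)" "I \<inter> J I = {}"
          using I top(1) finite_subset by (auto simp: J_def)
        then have "even (inversions I (J I) + inversions (J I) I) = even (card I * card (J I))"
          using inversions_swap[of I "J I"] by simp
        then show "even (?s 1 I (J I) + (n + card I) * (1 + card (J I))) = even (n + ?s n (J I) I)"
          by (cases "even n"; cases "even (card I)"; cases "even (card (J I))") auto
      qed
      finally show ?thesis unfolding tr_scaleC[OF VX(2)] by (simp add: power_add)
    qed
    have "0 \<in> domtr" by (rule complex_vector.subspace_0[OF domtr_subspace])
    note sub = complex_vector.subspace_sum[OF domtr_subspace] complex_vector.subspace_scale[OF domtr_subspace]
    show ?thesis
      unfolding w'_sum w_sum sum_distrib_left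
      by (simp only: tr_sum sub VX sum_distrib_left) (intro sum.cong refl trade)
  qed
  then have "sgn\<Omega> * tr w = (-1) ^ (?\<eta> + n) * tr w" using sgn by (simp add: power_add mult_ac)
  then have "sgn\<Omega> = (-1) ^ (?\<eta> + n)" using \<open>tr w \<noteq> 0\<close> by simp
  also have "\<dots> = (-1) ^ (s + (k choose 2) + n * k + n)"
    by (rule minus_one_power_cong) (cases "even k"; cases "even n"; simp)
  finally show "sgn\<Omega> = (-1) ^ (s + ((r + s) choose 2) + n * (r + s) + n)" by (simp add: k_def)
  show "\<nu> = of_nat (n + 1 + (r + s))" if "has_parity \<nu>"
  proof (rule ccontr)
    assume "\<nu> \<noteq> of_nat (n + 1 + (r + s))"
    then have "\<nu> + 1 = of_nat (Suc n + card top)"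
      unfolding top k_def by (cases \<nu>; cases "of_nat (n + 1 + (r + s)) :: bit") auto
    moreover have "gr\<Omega> w = (-1) ^ (Suc n + card top) *\<^sub>C w"
      unfolding w_def complex_vector.scale_sum_right W.g_pow_sum[of 1, simplified]
      by (simp only: W.homogeneousD[OF hC])
    ultimately have "gr\<Omega> w = bit_sign (\<nu> + 1) *\<^sub>C w" by (simp only: bit_sign_of_nat)
    then show False using that w(1) \<open>tr w \<noteq> 0\<close> by (auto simp: has_parity_def)
  qed
qed

end

lemma even_choose_two: "even (k choose 2) = even (k div 2)"
proof (induction k rule: nat_less_induct)
  case (1 k)
  show ?case
  proof (cases "k < 2")
    case True
    then show ?thesis by (simp add: binomial_eq_0)
  next
    case False
    then obtain l where k: "k = l + 2" by (metis add.commute le_add_diff_inverse not_less)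
    then have "even (l choose 2) = even (l div 2)" using 1 by simp
    moreover have "even ((l + 2) choose 2) = odd (l choose 2)"
      unfolding choose_two_add by (simp add: choose_two)
    ultimately show ?thesis unfolding k by simp
  qed
qed

lemma minus_one_powi: "(-1 :: complex) powi z = (if even z then 1 else -1)"
proof (cases "z \<ge> 0")
  case True
  then show ?thesis by (cases z) (auto simp: power_int_def minus_one_power_iff)
next
  case False
  then show ?thesis by (auto simp: power_int_def minus_one_power_iff even_nat_iff)
qed

lemma pairing_sign_eq:
  "(-1 :: complex) ^ (s + ((r + s) choose 2) + n * (r + s) + n) =
    (-1) powi (mu (int r - int s) + int n * (int r - int s + 1))"
proof -
  have "mu (int r - int s) = (int r - int s) div 2"
    unfolding mu_def using floor_divide_of_int_eq[of "int r - int s" 2, where 'a = real] by simp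
  also have "\<dots> = int ((r + s) div 2) - int s"
    using div_mult_self1[of 2 "int r + int s" "- int s"] by (simp add: zdiv_int)
  finally have "even (mu (int r - int s)) = (even ((r + s) div 2) = even s)" by simp
  then have "even (s + ((r + s) choose 2) + n * (r + s) + n) =
      even (mu (int r - int s) + int n * (int r - int s + 1))"
    by (cases "even r"; cases "even s"; cases "even n"; simp add: even_choose_two)
  then show ?thesis by (simp add: minus_one_powi minus_one_power_iff)
qed

theorem corollary4p14:
  fixes gr rs :: "'a::unital_cstar_algebra \<Rightarrow> 'a"
    and deg :: "int \<Rightarrow> 'w::{complex_algebra, topological_space} set"
    and gr\<Omega> star\<Omega> rs\<Omega> d :: "'w \<Rightarrow> 'w"
    and emb :: "'a \<Rightarrow> 'w"
    and domd domtr :: "'w set"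
    and tr :: "'w \<Rightarrow> complex"
    and \<A> :: "'a set"
    and sgn\<Omega> :: complex and \<nu> :: bit
    and n r s :: nat
    and e :: "'a cl"
  assumes "star_real_cycle gr rs deg gr\<Omega> emb domd d domtr tr \<A> n star\<Omega> rs\<Omega> sgn\<Omega>"
    and "nc_cycle.has_parity gr\<Omega> domtr tr \<nu>"
    and "star_real_cycle.basepoint gr rs emb d \<A> r s e"
    and "star_real_cycle.pairs_nontrivially gr rs gr\<Omega> emb d tr \<A> n r s e"
  shows "sgn\<Omega> = (-1) powi (mu (int r - int s) + int n * (int r - int s + 1)) \<and>
    \<nu> = of_nat n + 1 - of_nat r + of_nat s"
proof -
  interpret star_real_cycle gr rs deg gr\<Omega> emb domd d domtr tr \<A> n star\<Omega> rs\<Omega> sgn\<Omega>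
    by (rule assms(1))
  define S where "S = (\<lambda>m. real_osu gr rs r s m UNIV)"
  let ?V = "vd_semigroup S e" and ?add = "vd_add S e"
  have "mat_diag 1 e \<in> S 1"
    using assms(3) by (auto simp: basepoint_def S_def real_osu_iff clmat_iff)
  then interpret van_daele S e "r + s" unfolding S_def by (rule van_daele_real_osu)
  obtain \<Phi> g where \<Phi>: "is_pairing r s e \<Phi>" and g: "g \<in> carrier (DK S e)" "\<Phi> g \<noteq> 0"
    using assms(4) unfolding pairs_nontrivially_def S_def by blast
  have hom: "\<Phi> \<in> hom (grothendieck_group ?V ?add) complex_add_group"
    using \<Phi> unfolding is_pairing_def DK_def S_def by blast
  have \<Phi>_eq: "\<Phi> (DK_class S e m x) = pairing_value m (r + s) e x"
    if "1 \<le> m" "x \<in> real_osu gr rs r s m \<A>" for m x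
    using \<Phi> that unfolding is_pairing_def S_def by blast
  (* The group is generated by classes over A; twice such a class is represented over the domain
     algebra, and doubling does not lose information because the complex numbers are torsion-free. *)
  obtain v where v: "v \<in> ?V" "\<Phi> (grothendieck_class ?V ?add v) \<noteq> 0"
    using grothendieck_hom_eq_zero[OF vd_add_in_semigroup hom] g unfolding DK_def by blast
  obtain m x where x: "1 \<le> m" "x \<in> S m" "v = vd_class S e m x"
    using v(1) by (rule vd_semigroupE)
  obtain y where y: "y \<in> real_osu gr rs r s (m + m) \<A>" "path_component (S (m + m)) y (mat_dsum m x x)"
    using doubled_representative[OF x(2)[unfolded S_def] x(1) \<A>_osu_dense[OF x(1)] \<A>_subspace \<A>_real]
    unfolding S_def by blast
  have "vd_class S e (m + m) y = vd_class S e (m + m) (mat_dsum m x x)"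
    by (rule vd_class_eq, rule vd_rel_homotopic) (use x(1) y(2) in simp_all)
  then have "DK_class S e (m + m) y = grothendieck_class ?V ?add (?add v v)"
    using x by (simp add: DK_class_def vd_add_class)
  then have "\<Phi> (DK_class S e (m + m) y) = 2 * \<Phi> (grothendieck_class ?V ?add v)"
    using grothendieck_hom_add[OF vd_add_in_semigroup hom v(1) v(1)] by simp
  then have "pairing_value (m + m) (r + s) e y \<noteq> 0"
    using v(2) \<Phi>_eq[OF _ y(1)] x(1) by simp
  from pairing_constraints[OF assms(3) y(1) this] assms(2)
  have "sgn\<Omega> = (-1) ^ (s + ((r + s) choose 2) + n * (r + s) + n)" "\<nu> = of_nat (n + 1 + (r + s))"
    by blast+
  moreover have "(of_nat (n + 1 + (r + s)) :: bit) = of_nat n + 1 - of_nat r + of_nat s"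
    by (cases "of_nat n :: bit"; cases "of_nat r :: bit"; cases "of_nat s :: bit") simp_all
  ultimately show ?thesis by (simp only: pairing_sign_eq simp_thms)
qed

end
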